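(* Let $n\ge 2$. There are $n-2$ expressions $C_1,\dots,C_{n-2}$ (depending only on $n$) of the form $$C_k\Big(F_i,\frac{\mathrm{d}F_i}{\mathrm{d}x},\dots,\frac{\mathrm{d}^{n-1}F_i}{\mathrm{d}x^{n-1}}\Big),\qquad i=0,\dots,n-1,\quad k=1,\dots,n-2,$$ each a polynomial in the derivatives of $F$ of order less than or equal to $n$, such that the following hold for every $n$th order ODE $y^{(n)}=F(x,y,y',\dots,y^{(n-1)})$ with (local) space of solutions $M$. (i) Assume that $M$ is equipped with a paraconformal structure $TM\cong S^{n-1}(\mathbb{S})$ such that the two-parameter family of hypersurfaces $\{t\in M: y=Z(x,t)\}$, labelled by the points $(x,y)$ of $\mathcal{Z}$, are maximally null. Then $F$ satisfies the $n-2$ conditions $$C_k\Big(F_i,\frac{\mathrm{d}F_i}{\mathrm{d}x},\dots,\frac{\mathrm{d}^{n-1}F_i}{\mathrm{d}x^{n-1}}\Big)=0,\qquad k=1,\dots,n-2 .$$ (ii) The system of equations $C_k=0$, $k=1,\dots,n-2$, is invariant under point transformations on $\mathcal{Z}$, i.e. under transformations induced by a change of variables $\hat{x}=\hat{x}(x,y)$, $\hat{y}=\hat{y}(x,y)$. (iii) Conversely, if $C_k=0$ for all $k=1,\dots,n-2$, then there is a paraconformal structure on $M$ such that the points of $\mathcal{Z}$ define maximally null hypersurfaces in $M$.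
   Context: All considerations are local and all data are smooth. Consider the ODE $y^{(n)}=F(x,y,y',\dots,y^{(n-1)})$, where $y^{(k)}=\mathrm{d}^ky/\mathrm{d}x^k$. Its space of solutions $M$ is an $n$-dimensional manifold with local coordinates $t=(t^1,\dots,t^n)$, and the general solution is written $y=Z(x,t)$. The differentials with respect to $t$ of $Z,Z',\dots,Z^{(n-1)}$ (prime denoting $\mathrm{d}/\mathrm{d}x$) are linearly independent on $M$. $\mathcal{Z}$ is the two-dimensional manifold with local coordinates $(x,y)$; each point $(x,y)\in\mathcal{Z}$ defines the hypersurface $\{t: Z(x,t)=y\}$ in $M$. Notation: $F_i=\partial F/\partial y^{(i)}$ (with $y^{(0)}=y$), and the total derivative is $$\frac{\mathrm{d}}{\mathrm{d}x}=\frac{\partial}{\partial x}+\sum_{k=1}^{n-1}y^{(k)}\frac{\partial}{\partial y^{(k-1)}}+F\frac{\partial}{\partial y^{(n-1)}} .$$ A paraconformal structure on a smooth $n$-manifold $M$ is a bundle isomorphism $TM\cong \mathbb{S}\odot\cdots\odot\mathbb{S}=S^{n-1}(\mathbb{S})$, where $\mathbb{S}\to M$ is a real rank-two vector bundle and $\odot$ is the symmetric tensor product. It identifies each tangent space with the space of homogeneous polynomials of degree $n-1$ in two variables; dually $T^*M\cong S^{n-1}(\mathbb{S}^* )$, and $\mathbb{S}$ and $\mathbb{S}^*$ are identified by a fibrewise symplectic form defined up to scale. A vector (or, by this identification, a covector) is maximally null if the corresponding polynomial has a repeated root of multiplicity $n-1$, i.e. is (up to scale) an $(n-1)$th power of a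 linear form. A hypersurface in $M$ is maximally null if its normal is maximally null at each of its points. *)

theory Defs
  imports "HOL-Analysis.Analysis" "HOL-Library.Poly_Mapping"
begin

section \<open>Smooth maps\<close>

primrec Ck_on :: "nat \<Rightarrow> 'a::real_normed_vector set \<Rightarrow> ('a \<Rightarrow> 'b::real_normed_vector) \<Rightarrow> bool" where
  "Ck_on 0 U f \<longleftrightarrow> continuous_on U f"
| "Ck_on (Suc k) U f \<longleftrightarrow>
     f differentiable_on U \<and> (\<forall>v. Ck_on k U (\<lambda>x. frechet_derivative f (at x) v))"

definition smooth_on :: "'a::real_normed_vector set \<Rightarrow> ('a \<Rightarrow> 'b::real_normed_vector) \<Rightarrow> bool" where
  "smooth_on U f \<longleftrightarrow> open U \<and> (\<forall>k. Ck_on k U f)"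

definition diffeomorphism ::
    "'a::real_normed_vector set \<Rightarrow> 'b::real_normed_vector set \<Rightarrow> ('a \<Rightarrow> 'b) \<Rightarrow> bool" where
  "diffeomorphism W W' \<psi> \<longleftrightarrow>
     bij_betw \<psi> W W' \<and> smooth_on W \<psi> \<and> smooth_on W' (inv_into W \<psi>)"

section \<open>Jets and the total derivative\<close>

text \<open>
  Throughout, the order of the equation is \<^term>\<open>CARD('n)\<close>. Where the components of a vector
  indexed by \<^typ>\<open>'n\<close> have to be numbered by 0, ..., n - 1, this is done by the bijection
  \<^term>\<open>to_nat_on (UNIV :: 'n::finite set)\<close> and its inverse.
\<close>

abbreviation pos :: "'n::finite \<Rightarrow> nat" where
  "pos \<equiv> to_nat_on UNIV"

abbreviation idx :: "nat \<Rightarrow> 'n::finite" where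
  "idx \<equiv> from_nat_into UNIV"

text \<open>A jet \<open>(x, (y, y', ..., y^(n-1)))\<close>.\<close>

type_synonym 'n jet = "real \<times> (real ^ 'n)"

definition ycoord :: "nat \<Rightarrow> 'n::finite jet \<Rightarrow> real" where
  "ycoord k p = snd p $ idx k"

definition pd_x :: "('n::finite jet \<Rightarrow> real) \<Rightarrow> 'n jet \<Rightarrow> real" where
  "pd_x G p = frechet_derivative G (at p) (1, 0)"

definition pd_y :: "nat \<Rightarrow> ('n::finite jet \<Rightarrow> real) \<Rightarrow> 'n jet \<Rightarrow> real" where
  "pd_y k G p = frechet_derivative G (at p) (0, axis (idx k) 1)"

definition total_deriv :: "('n::finite jet \<Rightarrow> real) \<Rightarrow> ('n jet \<Rightarrow> real) \<Rightarrow> 'n jet \<Rightarrow> real" where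
  "total_deriv F G p =
     pd_x G p + (\<Sum>k = 1..CARD('n) - 1. ycoord k p * pd_y (k - 1) G p)
       + F p * pd_y (CARD('n) - 1) G p"

section \<open>Differential polynomials in the \<open>F_i\<close>\<close>

text \<open>Real polynomials in the indeterminates \<open>(i, j)\<close>, which stand for \<open>d^j F_i / dx^j\<close>.\<close>

type_synonym dpoly = "((nat \<times> nat) \<Rightarrow>\<^sub>0 nat) \<Rightarrow>\<^sub>0 real"

definition dpoly_vars :: "dpoly \<Rightarrow> (nat \<times> nat) set" where
  "dpoly_vars P = (\<Union>m \<in> Poly_Mapping.keys P. Poly_Mapping.keys m)"

definition dpoly_eval :: "(nat \<times> nat \<Rightarrow> real) \<Rightarrow> dpoly \<Rightarrow> real" where
  "dpoly_eval v P =
     (\<Sum>m \<in> Poly_Mapping.keys P. Poly_Mapping.lookup P m *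
        (\<Prod>ij \<in> Poly_Mapping.keys m. v ij ^ Poly_Mapping.lookup m ij))"

definition F_derivs :: "('n::finite jet \<Rightarrow> real) \<Rightarrow> 'n jet \<Rightarrow> nat \<times> nat \<Rightarrow> real" where
  "F_derivs F p = (\<lambda>(i, j). (total_deriv F ^^ j) (pd_y i F) p)"

definition satisfies_conditions ::
    "(nat \<Rightarrow> dpoly) \<Rightarrow> ('n::finite jet \<Rightarrow> real) \<Rightarrow> 'n jet set \<Rightarrow> bool" where
  "satisfies_conditions C F U \<longleftrightarrow>
     (\<forall>k \<in> {1..CARD('n) - 2}. \<forall>p \<in> U. dpoly_eval (F_derivs F p) (C k) = 0)"

section \<open>The space of solutions\<close>

definition x_deriv :: "nat \<Rightarrow> (real \<Rightarrow> real ^ 'n \<Rightarrow> real) \<Rightarrow> real \<Rightarrow> real ^ 'n::finite \<Rightarrow> real" where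
  "x_deriv k Z x t = (deriv ^^ k) (\<lambda>s. Z s t) x"

definition solution_jet :: "(real \<Rightarrow> real ^ 'n \<Rightarrow> real) \<Rightarrow> real \<Rightarrow> real ^ 'n \<Rightarrow> 'n::finite jet" where
  "solution_jet Z x t = (x, \<chi> i. x_deriv (pos i) Z x t)"

text \<open>
  \<open>y = Z(x, t)\<close>, with \<open>x\<close> in an open interval \<open>I\<close> and \<open>t\<close> in the coordinate domain \<open>M\<close>, is the
  general solution of the equation \<open>y^(n) = F\<close> on the region \<open>U\<close> of jet space: exactly one member
  of the family passes through each jet in \<open>U\<close>.
\<close>

definition general_solution ::
    "('n::finite jet \<Rightarrow> real) \<Rightarrow> 'n jet set \<Rightarrow> real set \<Rightarrow> (real ^ 'n) set
      \<Rightarrow> (real \<Rightarrow> real ^ 'n \<Rightarrow> real) \<Rightarrow> bool" where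
  "general_solution F U I M Z \<longleftrightarrow>
     open I \<and> is_interval I \<and> open M \<and>
     smooth_on (I \<times> M) (\<lambda>(x, t). Z x t) \<and>
     bij_betw (\<lambda>(x, t). solution_jet Z x t) (I \<times> M) U \<and>
     (\<forall>x\<in>I. \<forall>t\<in>M. x_deriv CARD('n) Z x t = F (solution_jet Z x t)) \<and>
     (\<forall>x\<in>I. \<forall>t\<in>M. \<forall>c :: nat \<Rightarrow> real.
        (\<forall>v. (\<Sum>k<CARD('n). c k * frechet_derivative (x_deriv k Z x) (at t) v) = 0)
          \<longrightarrow> (\<forall>k<CARD('n). c k = 0))"

definition solution_points :: "real set \<Rightarrow> (real ^ 'n::finite) set
      \<Rightarrow> (real \<Rightarrow> real ^ 'n \<Rightarrow> real) \<Rightarrow> (real \<times> real) set" where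
  "solution_points I M Z = (\<lambda>(x, t). (x, Z x t)) ` (I \<times> M)"

section \<open>Binary forms and paraconformal structures\<close>

text \<open>
  A vector \<open>c\<close> indexed by \<^typ>\<open>'n\<close> serves as the coefficient vector of the binary form
  \<open>\<Sum>\<^sub>j c\<^sub>j z\<^sub>1^j z\<^sub>2^(n-1-j)\<close> of degree \<open>n - 1\<close>; this is the fibre of the (n-1)st symmetric
  power of a rank-two bundle in a local frame.
\<close>

definition binary_form :: "real ^ 'n::finite \<Rightarrow> real ^ 2 \<Rightarrow> real" where
  "binary_form c z = (\<Sum>i\<in>UNIV. c $ i * (z $ 1) ^ pos i * (z $ 2) ^ (CARD('n) - 1 - pos i))"

text \<open>
  The natural pairing of the (n-1)st symmetric powers of a two-dimensional space and of its dual
  (in dual frames), normalised so that the (n-1)st powers of a vector \<open>u\<close> and of a covector \<open>l\<close>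
  pair to \<open>(l u)^(n-1)\<close>.
\<close>

definition form_pairing :: "real ^ 'n::finite \<Rightarrow> real ^ 'n \<Rightarrow> real" where
  "form_pairing c d = (\<Sum>i\<in>UNIV. c $ i * d $ i / real ((CARD('n) - 1) choose pos i))"

definition max_null_form :: "real ^ 'n::finite \<Rightarrow> bool" where
  "max_null_form c \<longleftrightarrow>
     (\<exists>(l :: real ^ 2) k. l \<noteq> 0 \<and> k \<noteq> 0 \<and>
        (\<forall>z. binary_form c z = k * (l \<bullet> z) ^ (CARD('n) - 1)))"

text \<open>
  A rank-two bundle \<open>S\<close> over \<open>M\<close> is given by an open cover \<open>V\<close> with a frame of \<open>S\<close> over each
  \<open>V a\<close>, and transition matrices \<open>g\<close>. The cover is indexed by the points of \<open>M\<close>, with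
  \<open>a \<in> V a\<close>, which is no restriction. Components \<open>s\<^sub>a\<close> of a section with respect to the frames
  transform by \<open>s\<^sub>a = g a b t *v s\<^sub>b\<close>.
\<close>

definition rank_two_bundle :: "(real ^ 'n::finite) set \<Rightarrow> (real ^ 'n \<Rightarrow> (real ^ 'n) set)
      \<Rightarrow> (real ^ 'n \<Rightarrow> real ^ 'n \<Rightarrow> real ^ 'n \<Rightarrow> real ^ 2 ^ 2) \<Rightarrow> bool" where
  "rank_two_bundle M V g \<longleftrightarrow>
     (\<forall>a\<in>M. open (V a) \<and> a \<in> V a \<and> V a \<subseteq> M) \<and>
     (\<forall>a\<in>M. \<forall>b\<in>M. smooth_on (V a \<inter> V b) (g a b) \<and> (\<forall>t\<in>V a \<inter> V b. invertible (g a b t))) \<and>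
     (\<forall>a\<in>M. \<forall>b\<in>M. \<forall>c\<in>M. \<forall>t\<in>V a \<inter> V b \<inter> V c. g a b t ** g b c t = g a c t)"

text \<open>
  \<open>\<phi> a t\<close> is the isomorphism from the tangent space at \<open>t \<in> V a\<close> to the symmetric power of \<open>S\<close>,
  in the frame over \<open>V a\<close>. An element of the symmetric power is a polynomial on the dual of \<open>S\<close>,
  where components transform by \<open>z\<^sub>b = z\<^sub>a v* g a b t\<close>; hence the compatibility condition.
\<close>

definition paraconformal_structure :: "(real ^ 'n::finite) set \<Rightarrow> (real ^ 'n \<Rightarrow> (real ^ 'n) set)
      \<Rightarrow> (real ^ 'n \<Rightarrow> real ^ 'n \<Rightarrow> real ^ 'n \<Rightarrow> real ^ 2 ^ 2)
      \<Rightarrow> (real ^ 'n \<Rightarrow> real ^ 'n \<Rightarrow> real ^ 'n \<Rightarrow> real ^ 'n) \<Rightarrow> bool" where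
  "paraconformal_structure M V g \<phi> \<longleftrightarrow>
     rank_two_bundle M V g \<and>
     (\<forall>a\<in>M. \<forall>t\<in>V a. linear (\<phi> a t) \<and> bij (\<phi> a t)) \<and>
     (\<forall>a\<in>M. \<forall>v. smooth_on (V a) (\<lambda>t. \<phi> a t v)) \<and>
     (\<forall>a\<in>M. \<forall>b\<in>M. \<forall>t\<in>V a \<inter> V b. \<forall>v z.
        binary_form (\<phi> a t v) z = binary_form (\<phi> b t v) (z v* g a b t))"

text \<open>
  The form \<open>q\<close> below is the image of the covector \<open>\<omega>\<close> at \<open>t\<close> under the dual isomorphism of the
  cotangent space with the symmetric power of the dual of \<open>S\<close>. The condition does not depend on
  the frame \<open>a\<close>.
\<close>

definition max_null_covector :: "(real ^ 'n::finite) set \<Rightarrow> (real ^ 'n \<Rightarrow> (real ^ 'n) set)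
      \<Rightarrow> (real ^ 'n \<Rightarrow> real ^ 'n \<Rightarrow> real ^ 'n \<Rightarrow> real ^ 'n)
      \<Rightarrow> real ^ 'n \<Rightarrow> (real ^ 'n \<Rightarrow> real) \<Rightarrow> bool" where
  "max_null_covector M V \<phi> t \<omega> \<longleftrightarrow>
     (\<forall>a\<in>M. t \<in> V a \<longrightarrow>
        (\<exists>q. (\<forall>v. \<omega> v = form_pairing (\<phi> a t v) q) \<and> max_null_form q))"

text \<open>The hypersurface \<open>{t \<in> M. f t = c}\<close>, whose normal is the differential of \<open>f\<close>.\<close>

definition max_null_hypersurface :: "(real ^ 'n::finite) set \<Rightarrow> (real ^ 'n \<Rightarrow> (real ^ 'n) set)
      \<Rightarrow> (real ^ 'n \<Rightarrow> real ^ 'n \<Rightarrow> real ^ 'n \<Rightarrow> real ^ 'n)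
      \<Rightarrow> (real ^ 'n \<Rightarrow> real) \<Rightarrow> real \<Rightarrow> bool" where
  "max_null_hypersurface M V \<phi> f c \<longleftrightarrow>
     (\<forall>t \<in> {t \<in> M. f t = c}. max_null_covector M V \<phi> t (frechet_derivative f (at t)))"

section \<open>Point transformations\<close>

definition jet_base :: "'n::finite jet \<Rightarrow> real \<times> real" where
  "jet_base p = (fst p, ycoord 0 p)"

text \<open>
  For \<open>\<psi> = (xhat, yhat)\<close> and a solution curve of \<open>y^(n) = F\<close> with jet \<open>p\<close>, the value at \<open>p\<close> of the
  \<open>k\<close>-th derivative of the transformed curve. For \<open>k < n\<close> this does not depend on \<open>F\<close>; for \<open>k = n\<close>
  it is the right-hand side of the transformed equation.
\<close>

primrec prolonged_deriv :: "('n::finite jet \<Rightarrow> real) \<Rightarrow> (real \<times> real \<Rightarrow> real \<times> real)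
      \<Rightarrow> nat \<Rightarrow> 'n jet \<Rightarrow> real" where
  "prolonged_deriv F \<psi> 0 = (\<lambda>p. snd (\<psi> (jet_base p)))"
| "prolonged_deriv F \<psi> (Suc k) =
     (\<lambda>p. total_deriv F (prolonged_deriv F \<psi> k) p
            / total_deriv F (\<lambda>p. fst (\<psi> (jet_base p))) p)"

definition prolong :: "('n::finite jet \<Rightarrow> real) \<Rightarrow> (real \<times> real \<Rightarrow> real \<times> real)
      \<Rightarrow> 'n jet \<Rightarrow> 'n jet" where
  "prolong F \<psi> p = (fst (\<psi> (jet_base p)), \<chi> i. prolonged_deriv F \<psi> (pos i) p)"

text \<open>
  \<open>\<psi>\<close> carries the equation given by \<open>F\<close> on \<open>U\<close> to the one given by \<open>F'\<close> on \<open>U'\<close>. Along curves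
  with jets in \<open>U\<close> the new independent variable is required to be a valid parameter.
\<close>

definition point_transforms :: "(real \<times> real \<Rightarrow> real \<times> real)
      \<Rightarrow> ('n::finite jet \<Rightarrow> real) \<Rightarrow> 'n jet set \<Rightarrow> ('n jet \<Rightarrow> real) \<Rightarrow> 'n jet set \<Rightarrow> bool" where
  "point_transforms \<psi> F U F' U' \<longleftrightarrow>
     (\<exists>W W'. diffeomorphism W W' \<psi> \<and> jet_base ` U \<subseteq> W) \<and>
     (\<forall>p\<in>U. total_deriv F (\<lambda>p. fst (\<psi> (jet_base p))) p \<noteq> 0) \<and>
     U' = prolong F \<psi> ` U \<and>
     (\<forall>p\<in>U. F' (prolong F \<psi> p) = prolonged_deriv F \<psi> CARD('n) p)"

end

theory Submission
  imports Defs
begin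

text \<open>
  The differential of \<open>Z(x, \<sqdot>)\<close> at a solution \<open>t\<close>, evaluated on a tangent vector \<open>v\<close>, is a function
  of \<open>x\<close> that solves the linearised equation \<open>u^(n) = \<Sum>\<^sub>i F\<^sub>i u^(i)\<close>, and these functions form the whole
  \<open>n\<close>-dimensional solution space. The hypersurfaces are maximally null for some paraconformal
  structure if and only if this curve of covectors runs in the cone over a rational normal curve:
  the solutions are then the forms of degree \<open>n - 1\<close> in two functions. In other words, the linearised
  operator is the \<open>(n-1)\<close>st symmetric power of an operator \<open>w'' + p w' + q w\<close>.

  Symmetric powers are produced by the recursion
  \<open>S\<^sub>0 u = u\<close>, \<open>S\<^sub>i\<^sub>+\<^sub>1 u = (S\<^sub>i u)' + i p S\<^sub>i u + i (n - i) q S\<^sub>i\<^sub>-\<^sub>1 u\<close>, whose member \<open>S\<^sub>n\<close> is the symmetric power: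
  on \<open>u = w^(n-1)\<close> it gives \<open>S\<^sub>i u = (n-1) \<cdots> (n-i) w^(n-1-i) (w')^i\<close>. The two highest coefficients of \<open>S\<^sub>n\<close>
  below the leading one determine \<open>p\<close> and then \<open>q\<close> as polynomials in \<open>F\<^sub>n\<^sub>-\<^sub>1\<close>, its derivative and \<open>F\<^sub>n\<^sub>-\<^sub>2\<close>;
  equating the other \<open>n - 2\<close> coefficients with those of the linearised operator gives the expressions
  \<open>C\<^sub>k\<close>. Their vanishing is thus equivalent to the linearised operator being a symmetric power
  (\<open>conditions_iff_is_sympow\<close>). All of this works for an arbitrary derivation \<open>X\<close>, given by a vector field,
  in place of \<open>d/dx\<close>, and can therefore be used both along one solution and on jet space.

  The class of symmetric powers is preserved when \<open>X\<close> is divided by a function \<open>\<sigma>\<close> and the solutions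
  are multiplied by a function \<open>\<mu>\<close> (\<open>sympow_op_gauge\<close>). This gives the first two parts.

  If the hypersurfaces are maximally null, the solutions have locally the form \<open>\<rho> (a s + b)^(n-1)\<close> with
  constants \<open>a\<close> and \<open>b\<close>. In the parameter \<open>s\<close> and after division by \<open>\<rho>\<close> they become polynomials of degree
  at most \<open>n - 1\<close>, so that the linearised operator comes from the \<open>n\<close>-th derivative, which is the symmetric
  power with \<open>p = q = 0\<close> (\<open>is_sympow_of_powers\<close>).

  For point transformations, jet space takes the place of the solutions. The linearised operator \<open>L\<close>
  is recovered from the total derivative \<open>X\<close>: for the vertical field \<open>V\<close> with components
  \<open>\<eta>, X \<eta>, X\<^sup>2 \<eta>, \<dots>\<close> the commutator \<open>[X, V]\<close> is \<open>L \<eta>\<close> times the last coordinate field. A point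
  transformation divides \<open>X\<close> by a function, and carries \<open>V\<close>, up to a multiple of \<open>X\<close>, to the vertical
  field of a multiple of \<open>\<eta>\<close> (\<open>linearisation_intertwined\<close>).

  Conversely, let \<open>L\<close> be a symmetric power and fix \<open>x\<^sub>0\<close>. The form attached to \<open>v\<close> has the coefficients
  \<open>S\<^sub>i u(x\<^sub>0) / i!\<close>, where \<open>u\<close> is the variation in the direction \<open>v\<close>. For every \<open>x\<^sub>1\<close> there are \<open>\<alpha>\<close> and \<open>\<beta>\<close>, found
  by solving a linear system backwards from \<open>x\<^sub>1\<close> to \<open>x\<^sub>0\<close>, with
  \<open>u(x\<^sub>1) = \<Sum>\<^sub>i S\<^sub>i u(x\<^sub>0) \<alpha>^(n-1-i) \<beta>^i / i!\<close> for all \<open>v\<close> (\<open>sympow_chain_dual_pairing\<close>); the right-hand side is the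
  pairing with the \<open>(n-1)\<close>st power of a linear form, so the hypersurfaces are maximally null. The bundle
  is trivial in this case.
\<close>

section \<open>Smooth functions\<close>

lemma frechet_derivative_cong_open:
  assumes "open U" "x \<in> U" "\<And>y. y \<in> U \<Longrightarrow> f y = g y"
  shows "frechet_derivative f (at x) = frechet_derivative g (at x)"
proof -
  have "(f has_derivative D) (at x) = (g has_derivative D) (at x)" for D
    using has_derivative_transform_within_open[OF _ assms(1,2), of f D UNIV g]
      has_derivative_transform_within_open[OF _ assms(1,2), of g D UNIV f] assms(3) by auto
  then show ?thesis by (simp add: frechet_derivative_def)
qed

lemma differentiable_on_cong:
  assumes "\<And>y. y \<in> U \<Longrightarrow> f y = g y" "f differentiable_on U"
  shows "g differentiable_on U"
  unfolding differentiable_on_def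
proof
  fix x assume "x \<in> U"
  then show "g differentiable at x within U"
    using assms unfolding differentiable_on_def
    by (metis differentiable_transform_within zero_less_one)
qed

lemma Ck_on_cong:
  assumes "open U" "\<And>y. y \<in> U \<Longrightarrow> f y = g y" "Ck_on k U f"
  shows "Ck_on k U g"
  using assms(2,3)
proof (induction k arbitrary: f g)
  case 0
  then show ?case by (simp add: continuous_on_eq)
next
  case (Suc k)
  have "Ck_on k U (\<lambda>x. frechet_derivative g (at x) v)" for v
  proof (rule Suc.IH)
    show "Ck_on k U (\<lambda>x. frechet_derivative f (at x) v)" using Suc.prems by simp
    show "frechet_derivative f (at y) v = frechet_derivative g (at y) v" if "y \<in> U" for y
      using frechet_derivative_cong_open[OF assms(1) that] Suc.prems(1) by metis
  qed
  moreover have "g differentiable_on U"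
    using Suc.prems by (intro differentiable_on_cong[of U f g]) auto
  ultimately show ?case by simp
qed

lemma Ck_on_Suc_imp: "Ck_on (Suc k) U f \<Longrightarrow> Ck_on k U f"
  by (induction k arbitrary: f) (auto simp: differentiable_imp_continuous_on)

lemma smooth_on_cong:
  assumes "smooth_on U f" "\<And>y. y \<in> U \<Longrightarrow> f y = g y"
  shows "smooth_on U g"
  using assms(1) Ck_on_cong[of U f g, OF _ assms(2)] unfolding smooth_on_def by simp

lemma smooth_on_differentiable_at:
  assumes "smooth_on U f" "x \<in> U"
  shows "f differentiable (at x)"
proof -
  have "Ck_on (Suc 0) U f" "open U" using assms(1) by (simp_all add: smooth_on_def del: Ck_on.simps)
  then show ?thesis using assms(2) by (simp add: differentiable_on_eq_differentiable_at)
qed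

lemma smooth_on_has_derivative:
  assumes "smooth_on U f" "x \<in> U"
  shows "(f has_derivative frechet_derivative f (at x)) (at x)"
  using smooth_on_differentiable_at[OF assms] frechet_derivative_works by blast

lemma smooth_on_open: "smooth_on U f \<Longrightarrow> open U"
  by (simp add: smooth_on_def)

lemma smooth_on_frechet:
  assumes "smooth_on U f" shows "smooth_on U (\<lambda>x. frechet_derivative f (at x) v)"
proof -
  have "Ck_on (Suc k) U f" for k
    using assms unfolding smooth_on_def by blast
  then have "Ck_on k U (\<lambda>x. frechet_derivative f (at x) v)" for k
    unfolding Ck_on.simps by blast
  then show ?thesis using assms unfolding smooth_on_def by blast
qed

lemma smooth_on_subset:
  assumes "smooth_on U f" "open V" "V \<subseteq> U" shows "smooth_on V f"
proof -
  have "Ck_on k V f" if "Ck_on k U f" for k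
    using that
  proof (induction k arbitrary: f)
    case 0 then show ?case using assms(3) continuous_on_subset by auto
  next
    case (Suc k) then show ?case using assms(3) differentiable_on_subset by auto
  qed
  then show ?thesis using assms by (simp add: smooth_on_def)
qed

lemma Ck_on_const: "Ck_on k U (\<lambda>x. c)"
  by (induction k arbitrary: c) auto

lemma smooth_on_const [simp]: "open U \<Longrightarrow> smooth_on U (\<lambda>x. c)"
  by (simp add: smooth_on_def Ck_on_const)

lemma smooth_on_bounded_linear:
  assumes "bounded_linear f" "open U" shows "smooth_on U f"
proof -
  have "frechet_derivative f (at x) = f" for x
    using bounded_linear_imp_has_derivative[OF assms(1)] frechet_derivative_at by metis
  then have "Ck_on k U f" for k
    using Ck_on_const bounded_linear_imp_differentiable_on[OF assms(1)] assms(1)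
    by (cases k) (auto simp: linear_continuous_on)
  then show ?thesis using assms(2) by (simp add: smooth_on_def)
qed

lemma Ck_on_add:
  fixes f g :: "'a::real_normed_vector \<Rightarrow> 'b::real_normed_vector"
  assumes "open U" "Ck_on k U f" "Ck_on k U g"
  shows "Ck_on k U (\<lambda>x. f x + g x)"
  using assms(2,3)
proof (induction k arbitrary: f g)
  case 0 then show ?case by (simp add: continuous_on_add)
next
  case (Suc k)
  have d: "(f has_derivative frechet_derivative f (at x)) (at x)"
     "(g has_derivative frechet_derivative g (at x)) (at x)" if "x \<in> U" for x
    using Suc.prems that
    by (auto simp: differentiable_on_eq_differentiable_at[OF assms(1)] frechet_derivative_works)
  have eq: "frechet_derivative f (at x) v + frechet_derivative g (at x) v =
     frechet_derivative (\<lambda>x. f x + g x) (at x) v" if "x \<in> U" for x v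
    using frechet_derivative_at[OF has_derivative_add[OF d[OF that]]] by metis
  have "Ck_on k U (\<lambda>x. frechet_derivative (\<lambda>x. f x + g x) (at x) v)" for v
    by (rule Ck_on_cong[OF assms(1) eq], assumption, rule Suc.IH) (use Suc.prems in auto)
  moreover have "(\<lambda>x. f x + g x) differentiable_on U"
    using Suc.prems by auto
  ultimately show ?case by simp
qed

lemma Ck_on_mult:
  fixes f g :: "'a::real_normed_vector \<Rightarrow> real"
  assumes "open U" "Ck_on k U f" "Ck_on k U g"
  shows "Ck_on k U (\<lambda>x. f x * g x)"
  using assms(2,3)
proof (induction k arbitrary: f g)
  case 0 then show ?case by (simp add: continuous_on_mult)
next
  case (Suc k)
  have d: "(f has_derivative frechet_derivative f (at x)) (at x)"
     "(g has_derivative frechet_derivative g (at x)) (at x)" if "x \<in> U" for x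
    using Suc.prems that
    by (auto simp: differentiable_on_eq_differentiable_at[OF assms(1)] frechet_derivative_works)
  have eq: "f x * frechet_derivative g (at x) v + frechet_derivative f (at x) v * g x =
     frechet_derivative (\<lambda>x. f x * g x) (at x) v" if "x \<in> U" for x v
    using frechet_derivative_at[OF has_derivative_mult[OF d[OF that]]] by metis
  have k: "Ck_on k U f" "Ck_on k U g" using Suc.prems Ck_on_Suc_imp by blast+
  have "Ck_on k U (\<lambda>x. frechet_derivative (\<lambda>x. f x * g x) (at x) v)" for v
    by (rule Ck_on_cong[OF assms(1) eq]) (use Suc k in \<open>auto intro!: Ck_on_add assms(1)\<close>)
  moreover have "(\<lambda>x. f x * g x) differentiable_on U"
    using Suc.prems by auto
  ultimately show ?case by simp
qed

lemma smooth_on_add [intro]: 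
  assumes "smooth_on U f" "smooth_on U g" shows "smooth_on U (\<lambda>x. f x + g x)"
  using assms Ck_on_add[of U _ f g] unfolding smooth_on_def by blast

lemma smooth_on_mult [intro]:
  fixes f g :: "'a::real_normed_vector \<Rightarrow> real"
  assumes "smooth_on U f" "smooth_on U g" shows "smooth_on U (\<lambda>x. f x * g x)"
  using assms Ck_on_mult[of U _ f g] unfolding smooth_on_def by blast

lemma smooth_on_uminus [intro]:
  fixes f :: "'a::real_normed_vector \<Rightarrow> real"
  shows "smooth_on U f \<Longrightarrow> smooth_on U (\<lambda>x. - f x)"
  using smooth_on_mult[of U "\<lambda>x. -1" f] smooth_on_open[of U f] by simp

lemma smooth_on_diff [intro]:
  fixes f g :: "'a::real_normed_vector \<Rightarrow> real"
  shows "smooth_on U f \<Longrightarrow> smooth_on U g \<Longrightarrow> smooth_on U (\<lambda>x. f x - g x)"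
  using smooth_on_add[of U f "\<lambda>x. - g x"] smooth_on_uminus by auto

lemma smooth_on_sum [intro]:
  assumes "open U" "\<And>i. i \<in> A \<Longrightarrow> smooth_on U (f i)"
  shows "smooth_on U (\<lambda>x. \<Sum>i\<in>A. f i x)"
  using assms(2) by (induction A rule: infinite_finite_induct) (auto simp: assms(1))

lemma smooth_on_power [intro]:
  fixes f :: "'a::real_normed_vector \<Rightarrow> real"
  assumes "smooth_on U f" shows "smooth_on U (\<lambda>x. f x ^ k)"
  using smooth_on_open[OF assms] by (induction k) (auto intro!: smooth_on_mult assms)

lemma Ck_on_inverse:
  fixes f :: "'a::real_normed_vector \<Rightarrow> real"
  assumes "smooth_on U f" "\<And>x. x \<in> U \<Longrightarrow> f x \<noteq> 0"
  shows "Ck_on k U (\<lambda>x. inverse (f x))"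
proof (induction k)
  case 0
  have "Ck_on 0 U f" using assms(1) by (simp add: smooth_on_def del: Ck_on.simps)
  then show ?case using assms by (simp add: continuous_on_inverse)
next
  case (Suc k)
  have U: "open U" by (rule smooth_on_open[OF assms(1)])
  have d: "((\<lambda>x. inverse (f x)) has_derivative
      (\<lambda>v. - (inverse (f x) * frechet_derivative f (at x) v * inverse (f x)))) (at x)" if "x \<in> U" for x
    by (rule Deriv.has_derivative_inverse[OF assms(2)[OF that] smooth_on_has_derivative[OF assms(1) that]])
  have eq: "(-1) * ((inverse (f x) * frechet_derivative f (at x) v) * inverse (f x)) =
     frechet_derivative (\<lambda>x. inverse (f x)) (at x) v" if "x \<in> U" for x v
    using frechet_derivative_at[OF d[OF that]] by (metis mult_minus1)
  have "Ck_on k U (\<lambda>x. frechet_derivative f (at x) v)" for v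
    using smooth_on_frechet[OF assms(1)] by (simp add: smooth_on_def)
  then have "Ck_on k U (\<lambda>x. frechet_derivative (\<lambda>x. inverse (f x)) (at x) v)" for v
    by (intro Ck_on_cong[OF U eq] Ck_on_mult U Suc Ck_on_const)
  moreover have "(\<lambda>x. inverse (f x)) differentiable_on U"
    using d U differentiable_def differentiable_on_eq_differentiable_at by blast
  ultimately show ?case by simp
qed

lemma smooth_on_inverse [intro]:
  fixes f :: "'a::real_normed_vector \<Rightarrow> real"
  assumes "smooth_on U f" "\<And>x. x \<in> U \<Longrightarrow> f x \<noteq> 0"
  shows "smooth_on U (\<lambda>x. inverse (f x))"
  using Ck_on_inverse[OF assms] assms(1) by (simp add: smooth_on_def)

lemma smooth_on_divide [intro]:
  fixes f g :: "'a::real_normed_vector \<Rightarrow> real"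
  assumes "smooth_on U f" "smooth_on U g" "\<And>x. x \<in> U \<Longrightarrow> g x \<noteq> 0"
  shows "smooth_on U (\<lambda>x. f x / g x)"
  using assms smooth_on_mult[OF assms(1) smooth_on_inverse] by (simp add: divide_inverse)

lemma frechet_derivative_inner:
  assumes "f differentiable (at x)"
  shows "frechet_derivative (\<lambda>y. f y \<bullet> b) (at x) v = frechet_derivative f (at x) v \<bullet> b"
proof -
  have "((\<lambda>y. f y \<bullet> b) has_derivative (\<lambda>v. frechet_derivative f (at x) v \<bullet> b)) (at x)"
    by (rule bounded_linear.has_derivative[OF bounded_linear_inner_left
          assms[unfolded frechet_derivative_works]])
  from frechet_derivative_at[OF this] show ?thesis by metis
qed

lemma Ck_on_componentwise:
  fixes f :: "'a::real_normed_vector \<Rightarrow> 'b::euclidean_space"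
  assumes "open U"
  shows "Ck_on k U f \<longleftrightarrow> (\<forall>b\<in>Basis. Ck_on k U (\<lambda>x. f x \<bullet> b))"
proof (induction k arbitrary: f)
  case 0 then show ?case using continuous_on_componentwise[of U f] by simp
next
  case (Suc k)
  have df: "f differentiable_on U \<longleftrightarrow> (\<forall>b\<in>Basis. (\<lambda>x. f x \<bullet> b) differentiable_on U)"
    unfolding differentiable_on_def differentiable_componentwise_within[of f] by blast
  have "Ck_on k U (\<lambda>x. frechet_derivative f (at x) v \<bullet> b) \<longleftrightarrow>
        Ck_on k U (\<lambda>x. frechet_derivative (\<lambda>x. f x \<bullet> b) (at x) v)" if "f differentiable_on U" for v b
  proof -
    have "frechet_derivative f (at x) v \<bullet> b = frechet_derivative (\<lambda>x. f x \<bullet> b) (at x) v" if "x \<in> U" for x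
      using frechet_derivative_inner[of f x b v] \<open>f differentiable_on U\<close> that
      by (simp add: differentiable_on_eq_differentiable_at[OF assms])
    then show ?thesis
      by (metis (no_types, lifting) Ck_on_cong[OF assms, of "\<lambda>x. frechet_derivative f (at x) v \<bullet> b"
          "\<lambda>x. frechet_derivative (\<lambda>x. f x \<bullet> b) (at x) v"]
        Ck_on_cong[OF assms, of "\<lambda>x. frechet_derivative (\<lambda>x. f x \<bullet> b) (at x) v"
          "\<lambda>x. frechet_derivative f (at x) v \<bullet> b"])
  qed
  with df show ?case
    unfolding Ck_on.simps Suc.IH[of "\<lambda>x. frechet_derivative f (at x) v" for v] by blast
qed

lemma smooth_on_componentwise:
  fixes f :: "'a::real_normed_vector \<Rightarrow> 'b::euclidean_space"
  shows "smooth_on U f \<longleftrightarrow> open U \<and> (\<forall>b\<in>Basis. smooth_on U (\<lambda>x. f x \<bullet> b))"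
  using Ck_on_componentwise[of U _ f] by (auto simp: smooth_on_def)

lemma frechet_derivative_compose_basis:
  fixes f :: "'a::real_normed_vector \<Rightarrow> 'b::euclidean_space" and g :: "'b \<Rightarrow> real"
  assumes "f differentiable (at x)" "g differentiable (at (f x))"
  shows "frechet_derivative (\<lambda>x. g (f x)) (at x) v =
    (\<Sum>b\<in>Basis. frechet_derivative g (at (f x)) b * (frechet_derivative f (at x) v \<bullet> b))"
proof -
  have "frechet_derivative (\<lambda>x. g (f x)) (at x) v = frechet_derivative g (at (f x)) (frechet_derivative f (at x) v)"
    using frechet_derivative_compose[OF assms] by (simp add: o_def)
  also have "\<dots> = frechet_derivative g (at (f x)) (\<Sum>b\<in>Basis. (frechet_derivative f (at x) v \<bullet> b) *\<^sub>R b)"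
    by (simp add: euclidean_representation)
  also have "\<dots> = (\<Sum>b\<in>Basis. (frechet_derivative f (at x) v \<bullet> b) *\<^sub>R frechet_derivative g (at (f x)) b)"
    using linear_frechet_derivative[OF assms(2)] by (simp add: linear_sum linear_cmul)
  finally show ?thesis by (simp add: mult.commute)
qed

text \<open>
  In coordinates the derivative of \<open>g \<circ> f\<close> is a sum of products of derivatives of \<open>f\<close> with functions
  \<open>D\<^sub>b g \<circ> f\<close>, and the induction hypothesis applies to the smooth functions \<open>D\<^sub>b g\<close>.
\<close>

lemma Ck_on_compose:
  fixes f :: "'a::real_normed_vector \<Rightarrow> 'b::euclidean_space" and g :: "'b \<Rightarrow> real"
  assumes "smooth_on U f" "smooth_on V g" "f ` U \<subseteq> V"
  shows "Ck_on k U (\<lambda>x. g (f x))"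
  using assms(2)
proof (induction k arbitrary: g)
  case 0
  have "Ck_on 0 V g" "Ck_on 0 U f" using 0 assms by (simp_all add: smooth_on_def del: Ck_on.simps)
  then show ?case using continuous_on_compose2[OF _ _ assms(3)] by simp
next
  case (Suc k)
  have U: "open U" by (rule smooth_on_open[OF assms(1)])
  have d: "f differentiable (at x)" "g differentiable (at (f x))" if "x \<in> U" for x
    using smooth_on_differentiable_at[OF assms(1) that]
      smooth_on_differentiable_at[OF Suc.prems, of "f x"] assms(3) that by auto
  have "smooth_on U (\<lambda>x. frechet_derivative f (at x) v \<bullet> b)" if "b \<in> Basis" for v b
    using smooth_on_frechet[OF assms(1)] that by (subst (asm) smooth_on_componentwise) simp
  then have c: "Ck_on k U (\<lambda>x. frechet_derivative f (at x) v \<bullet> b)" if "b \<in> Basis" for v b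
    using that by (simp add: smooth_on_def)
  have e: "Ck_on k U (\<lambda>x. frechet_derivative g (at (f x)) b)" for b
    by (rule Suc.IH[OF smooth_on_frechet[OF Suc.prems]])
  have s: "Ck_on k U (\<lambda>x. \<Sum>b\<in>B. h b x)" if "\<And>b. b \<in> B \<Longrightarrow> Ck_on k U (h b)" "finite B"
    for B :: "'b set" and h :: "'b \<Rightarrow> 'a \<Rightarrow> real"
    using that(2,1) by (induction B) (auto intro!: Ck_on_const Ck_on_add U)
  have "Ck_on k U (\<lambda>x. frechet_derivative (\<lambda>x. g (f x)) (at x) v)" for v
    by (rule Ck_on_cong[OF U frechet_derivative_compose_basis[OF d, symmetric]])
      (auto intro!: s Ck_on_mult c e U)
  moreover have "(\<lambda>x. g (f x)) differentiable_on U"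
    unfolding differentiable_on_eq_differentiable_at[OF U]
    using differentiable_chain_at[OF d] by (auto simp: o_def)
  ultimately show ?case by simp
qed

lemma smooth_on_scaleR:
  fixes f :: "'a::real_normed_vector \<Rightarrow> 'b::euclidean_space"
  assumes c: "smooth_on U c" and f: "smooth_on U f"
  shows "smooth_on U (\<lambda>x. c x *\<^sub>R f x)"
  using smooth_on_mult[OF c] f
  unfolding smooth_on_componentwise[of U f] smooth_on_componentwise[of U "\<lambda>x. c x *\<^sub>R f x"] by simp

lemma smooth_on_compose:
  fixes f :: "'a::real_normed_vector \<Rightarrow> 'b::euclidean_space" and g :: "'b \<Rightarrow> 'c::euclidean_space"
  assumes "smooth_on U f" "smooth_on V g" "f ` U \<subseteq> V"
  shows "smooth_on U (\<lambda>x. g (f x))"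
  unfolding smooth_on_componentwise[of U "\<lambda>x. g (f x)"]
proof (intro conjI ballI)
  show "open U" using assms(1) by (rule smooth_on_open)
  fix b :: 'c assume "b \<in> Basis"
  then have "smooth_on V (\<lambda>x. g x \<bullet> b)" using assms(2) by (simp add: smooth_on_componentwise[of V g])
  from Ck_on_compose[OF assms(1) this assms(3)] assms(1)
  show "smooth_on U (\<lambda>x. g (f x) \<bullet> b)" by (simp add: smooth_on_def)
qed

lemma smooth_on_Pair:
  fixes f :: "'a::real_normed_vector \<Rightarrow> 'b::euclidean_space" and g :: "'a \<Rightarrow> 'c::euclidean_space"
  assumes "smooth_on U f" "smooth_on U g"
  shows "smooth_on U (\<lambda>x. (f x, g x))"
  using assms unfolding smooth_on_componentwise[of U "\<lambda>x. (f x, g x)"]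
    smooth_on_componentwise[of U f] smooth_on_componentwise[of U g] Basis_prod_def by auto

lemma smooth_on_vec:
  fixes f :: "'a::real_normed_vector \<Rightarrow> real ^ 'n"
  assumes "open U" "\<And>i. smooth_on U (\<lambda>x. f x $ i)"
  shows "smooth_on U f"
  using assms unfolding smooth_on_componentwise[of U f]
  by (auto simp: Basis_vec_def inner_axis)

lemma DERIV_along_line:
  fixes f :: "'a::euclidean_space \<Rightarrow> real"
  assumes "smooth_on U f" "y + s *\<^sub>R a \<in> U"
  shows "((\<lambda>s. f (y + s *\<^sub>R a)) has_real_derivative frechet_derivative f (at (y + s *\<^sub>R a)) a) (at s)"
proof -
  have d: "(f has_derivative frechet_derivative f (at (y + s *\<^sub>R a))) (at (y + s *\<^sub>R a))"
    using smooth_on_has_derivative[OF assms] .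
  have "((\<lambda>s. y + s *\<^sub>R a) has_derivative (\<lambda>h. h *\<^sub>R a)) (at s)"
    by (auto intro!: derivative_eq_intros)
  from diff_chain_at[OF this d]
  have "((\<lambda>s. f (y + s *\<^sub>R a)) has_derivative (\<lambda>h. frechet_derivative f (at (y + s *\<^sub>R a)) (h *\<^sub>R a))) (at s)"
    by (simp add: o_def)
  moreover have "frechet_derivative f (at (y + s *\<^sub>R a)) (h *\<^sub>R a)
      = frechet_derivative f (at (y + s *\<^sub>R a)) a * h" for h
    using has_derivative_linear[OF d] by (simp add: linear_cmul)
  ultimately show ?thesis by (simp add: has_field_derivative_def)
qed

text \<open>
  The mean value theorem, applied first along \<open>a\<close> and then along \<open>b\<close>, turns the second difference
  into a mixed derivative. The left-hand side is symmetric in \<open>a\<close> and \<open>b\<close>; this is what makes mixed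
  derivatives commute.
\<close>

lemma second_difference_mean_value:
  fixes f :: "'a::euclidean_space \<Rightarrow> real"
  assumes f: "smooth_on U f" and r: "ball x r \<subseteq> U" and h: "0 < h" "h * norm a + h * norm b < r"
  obtains s t where "0 < s" "s < h" "0 < t" "t < h"
    "f (x + h *\<^sub>R a + h *\<^sub>R b) - f (x + h *\<^sub>R a) - f (x + h *\<^sub>R b) + f x =
     h * h * frechet_derivative (\<lambda>y. frechet_derivative f (at y) a) (at (x + s *\<^sub>R a + t *\<^sub>R b)) b"
proof -
  have inU: "x + s *\<^sub>R a + t *\<^sub>R b \<in> U" if "0 \<le> s" "s \<le> h" "0 \<le> t" "t \<le> h" for s t
  proof -
    have "norm (s *\<^sub>R a + t *\<^sub>R b) \<le> s * norm a + t * norm b"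
      using that norm_triangle_ineq[of "s *\<^sub>R a" "t *\<^sub>R b"] by simp
    also have "\<dots> \<le> h * norm a + h * norm b"
      using that by (intro add_mono mult_right_mono) auto
    also have "norm (s *\<^sub>R a + t *\<^sub>R b) = dist (x + s *\<^sub>R a + t *\<^sub>R b) x"
      by (simp add: dist_norm add.assoc)
    finally have "dist x (x + s *\<^sub>R a + t *\<^sub>R b) < r"
      using h(2) by (simp add: dist_commute)
    then show ?thesis using r by auto
  qed
  have f2: "smooth_on U (\<lambda>y. frechet_derivative f (at y) a)" using f by (rule smooth_on_frechet)
  define \<phi> where "\<phi> s = f ((x + h *\<^sub>R b) + s *\<^sub>R a) - f (x + s *\<^sub>R a)" for s
  define \<phi>' where "\<phi>' s = frechet_derivative f (at ((x + h *\<^sub>R b) + s *\<^sub>R a)) a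
     - frechet_derivative f (at (x + s *\<^sub>R a)) a" for s
  have "(\<phi> has_real_derivative \<phi>' s) (at s)" if "0 \<le> s" "s \<le> h" for s
    unfolding \<phi>_def \<phi>'_def
  proof (intro DERIV_diff DERIV_along_line[OF f])
    show "x + h *\<^sub>R b + s *\<^sub>R a \<in> U" "x + s *\<^sub>R a \<in> U"
      using inU[OF that, of h] inU[OF that, of 0] h(1) by (simp_all add: add.assoc add.commute[of "h *\<^sub>R b"])
  qed
  from MVT2[OF h(1) this] obtain s where s: "0 < s" "s < h" "\<phi> h - \<phi> 0 = (h - 0) * \<phi>' s" by blast
  define \<psi> where "\<psi> t = frechet_derivative f (at ((x + s *\<^sub>R a) + t *\<^sub>R b)) a" for t
  define \<psi>' where "\<psi>' t = frechet_derivative (\<lambda>y. frechet_derivative f (at y) a) (at (x + s *\<^sub>R a + t *\<^sub>R b)) b" for t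
  have "(\<psi> has_real_derivative \<psi>' t) (at t)" if "0 \<le> t" "t \<le> h" for t
    unfolding \<psi>_def \<psi>'_def by (rule DERIV_along_line[OF f2 inU]) (use that s in simp_all)
  from MVT2[OF h(1) this] obtain t where t: "0 < t" "t < h" "\<psi> h - \<psi> 0 = (h - 0) * \<psi>' t" by blast
  have "\<phi>' s = \<psi> h - \<psi> 0" by (simp add: \<phi>'_def \<psi>_def add.assoc add.commute[of "h *\<^sub>R b"])
  then have "\<phi> h - \<phi> 0 = h * h * \<psi>' t" using s t by simp
  then have "f (x + h *\<^sub>R a + h *\<^sub>R b) - f (x + h *\<^sub>R a) - f (x + h *\<^sub>R b) + f x = h * h * \<psi>' t"
    by (simp add: \<phi>_def add.assoc add.commute[of "h *\<^sub>R b"])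
  then show ?thesis using that[OF s(1,2) t(1,2)] unfolding \<psi>'_def by simp
qed

theorem mixed_partials_commute:
  fixes f :: "'a::euclidean_space \<Rightarrow> real"
  assumes f: "smooth_on U f" and x: "x \<in> U"
  shows "frechet_derivative (\<lambda>y. frechet_derivative f (at y) a) (at x) b =
         frechet_derivative (\<lambda>y. frechet_derivative f (at y) b) (at x) a"
proof -
  define A where "A y = frechet_derivative (\<lambda>y. frechet_derivative f (at y) a) (at y) b" for y
  define B where "B y = frechet_derivative (\<lambda>y. frechet_derivative f (at y) b) (at y) a" for y
  have U: "open U" using f by (rule smooth_on_open)
  have sm: "smooth_on U A" "smooth_on U B" unfolding A_def B_def by (intro smooth_on_frechet f)+
  have cont: "isCont A x" "isCont B x"
    using smooth_on_differentiable_at[OF sm(1) x] smooth_on_differentiable_at[OF sm(2) x]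
    by (auto intro: differentiable_imp_continuous_within)
  have "\<bar>A x - B x\<bar> \<le> e" if e: "e > 0" for e
  proof -
    obtain d1 where d1: "d1 > 0" "\<And>y. dist y x < d1 \<Longrightarrow> dist (A y) (A x) < e/2"
      using cont(1) e unfolding continuous_at_eps_delta by (metis half_gt_zero)
    obtain d2 where d2: "d2 > 0" "\<And>y. dist y x < d2 \<Longrightarrow> dist (B y) (B x) < e/2"
      using cont(2) e unfolding continuous_at_eps_delta by (metis half_gt_zero)
    obtain r where r: "r > 0" "ball x r \<subseteq> U" using U x open_contains_ball by blast
    define R where "R = min r (min d1 d2)"
    have R: "R > 0" "R \<le> r" "R \<le> d1" "R \<le> d2" using r d1 d2 by (auto simp: R_def)
    \<comment> \<open>Small enough for the whole parallelogram with sides \<open>h a\<close> and \<open>h b\<close> to lie in the ball of radius \<open>R\<close>.\<close>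
    define h where "h = R / (2 * (norm a + norm b + 1))"
    have nn: "norm a + norm b + 1 > 0" by (simp add: add_nonneg_pos)
    then have h: "h > 0" using R by (simp add: h_def)
    have "h * (norm a + norm b + 1) = R / 2" using nn by (simp add: h_def field_simps)
    then have hR: "h * norm a + h * norm b < R" using h R by (simp add: algebra_simps)
    have near: "dist (x + s *\<^sub>R u + t *\<^sub>R v) x < R"
      if "0 < s" "s < h" "0 < t" "t < h" "h * norm u + h * norm v < R" for s t and u v :: 'a
    proof -
      have "dist (x + s *\<^sub>R u + t *\<^sub>R v) x = norm (s *\<^sub>R u + t *\<^sub>R v)"
        by (simp add: dist_norm add.assoc)
      also have "\<dots> \<le> s * norm u + t * norm v"
        using that norm_triangle_ineq[of "s *\<^sub>R u" "t *\<^sub>R v"] by simp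
      also have "\<dots> \<le> h * norm u + h * norm v"
        using that by (intro add_mono mult_right_mono) auto
      finally show ?thesis using that by linarith
    qed
    have hr: "h * norm a + h * norm b < r" "h * norm b + h * norm a < r" using hR R by auto
    obtain s t where st: "0 < s" "s < h" "0 < t" "t < h"
      "f (x + h *\<^sub>R a + h *\<^sub>R b) - f (x + h *\<^sub>R a) - f (x + h *\<^sub>R b) + f x = h * h * A (x + s *\<^sub>R a + t *\<^sub>R b)"
      using second_difference_mean_value[OF f r(2) h hr(1)] unfolding A_def by blast
    obtain s' t' where st': "0 < s'" "s' < h" "0 < t'" "t' < h"
      "f (x + h *\<^sub>R b + h *\<^sub>R a) - f (x + h *\<^sub>R b) - f (x + h *\<^sub>R a) + f x = h * h * B (x + s' *\<^sub>R b + t' *\<^sub>R a)"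
      using second_difference_mean_value[OF f r(2) h hr(2)] unfolding B_def by blast
    have "f (x + h *\<^sub>R a + h *\<^sub>R b) = f (x + h *\<^sub>R b + h *\<^sub>R a)" by (simp add: add.commute add.left_commute)
    then have "h * h * A (x + s *\<^sub>R a + t *\<^sub>R b) = h * h * B (x + s' *\<^sub>R b + t' *\<^sub>R a)"
      using st(5) st'(5) by linarith
    then have eq: "A (x + s *\<^sub>R a + t *\<^sub>R b) = B (x + s' *\<^sub>R b + t' *\<^sub>R a)" using h by simp
    have "dist (A (x + s *\<^sub>R a + t *\<^sub>R b)) (A x) < e/2"
      using near[OF st(1-4) hR] R by (intro d1) auto
    moreover have "dist (B (x + s' *\<^sub>R b + t' *\<^sub>R a)) (B x) < e/2"
      using near[OF st'(1-4), of b a] hR R by (intro d2) (simp add: add.commute)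
    ultimately show ?thesis using eq unfolding dist_real_def by linarith
  qed
  then have "\<bar>A x - B x\<bar> \<le> 0" by (rule field_le_epsilon) simp
  then show ?thesis by (simp add: A_def B_def)
qed

section \<open>Derivations along vector fields\<close>

text \<open>
  This plays the role of \<open>d/dx\<close>, along a single solution as well as on jet space.
\<close>

definition lie :: "('a::real_normed_vector \<Rightarrow> 'a) \<Rightarrow> ('a \<Rightarrow> real) \<Rightarrow> 'a \<Rightarrow> real" where
  "lie \<xi> f x = frechet_derivative f (at x) (\<xi> x)"

lemma frechet_derivative_basis:
  fixes f :: "'a::euclidean_space \<Rightarrow> real"
  assumes "f differentiable (at x)"
  shows "frechet_derivative f (at x) v = (\<Sum>b\<in>Basis. (v \<bullet> b) * frechet_derivative f (at x) b)"
proof -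
  have "frechet_derivative f (at x) v = frechet_derivative f (at x) (\<Sum>b\<in>Basis. (v \<bullet> b) *\<^sub>R b)"
    by (simp add: euclidean_representation)
  also have "\<dots> = (\<Sum>b\<in>Basis. (v \<bullet> b) *\<^sub>R frechet_derivative f (at x) b)"
    using linear_frechet_derivative[OF assms] by (simp add: linear_sum linear_cmul)
  finally show ?thesis by simp
qed

lemma lie_basis:
  fixes f :: "'a::euclidean_space \<Rightarrow> real"
  assumes "smooth_on U f" "x \<in> U"
  shows "lie \<xi> f x = (\<Sum>b\<in>Basis. (\<xi> x \<bullet> b) * frechet_derivative f (at x) b)"
  unfolding lie_def by (rule frechet_derivative_basis[OF smooth_on_differentiable_at[OF assms]])

lemma smooth_on_inner_Basis:
  fixes f :: "'a::real_normed_vector \<Rightarrow> 'b::euclidean_space"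
  assumes "smooth_on U f" "b \<in> Basis" shows "smooth_on U (\<lambda>x. f x \<bullet> b)"
  using assms smooth_on_componentwise[of U f] by simp

lemma smooth_on_lie [intro]:
  fixes f :: "'a::euclidean_space \<Rightarrow> real"
  assumes "smooth_on U \<xi>" "smooth_on U f"
  shows "smooth_on U (lie \<xi> f)"
proof (rule smooth_on_cong)
  show "smooth_on U (\<lambda>x. \<Sum>b\<in>Basis. (\<xi> x \<bullet> b) * frechet_derivative f (at x) b)"
    by (intro smooth_on_sum smooth_on_mult smooth_on_frechet assms smooth_on_inner_Basis
        smooth_on_open[OF assms(2)])
qed (simp add: lie_basis[OF assms(2)])

lemma lie_cong:
  assumes "open U" "x \<in> U" "\<And>y. y \<in> U \<Longrightarrow> f y = g y"
  shows "lie \<xi> f x = lie \<xi> g x"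
  using frechet_derivative_cong_open[OF assms] by (simp add: lie_def)

lemma lie_const [simp]: "lie \<xi> (\<lambda>x. c) x = 0"
  by (simp add: lie_def)

lemma lie_add:
  assumes "smooth_on U f" "smooth_on U g" "x \<in> U"
  shows "lie \<xi> (\<lambda>x. f x + g x) x = lie \<xi> f x + lie \<xi> g x"
  unfolding lie_def using frechet_derivative_at[OF has_derivative_add[OF
    smooth_on_has_derivative[OF assms(1,3)] smooth_on_has_derivative[OF assms(2,3)]]] by metis

lemma lie_mult:
  assumes "smooth_on U f" "smooth_on U g" "x \<in> U"
  shows "lie \<xi> (\<lambda>x. f x * g x) x = lie \<xi> f x * g x + f x * lie \<xi> g x"
  unfolding lie_def using frechet_derivative_at[OF has_derivative_mult[OF
    smooth_on_has_derivative[OF assms(1,3)] smooth_on_has_derivative[OF assms(2,3)]]]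
  by (metis add.commute)

lemma lie_cmult:
  assumes "smooth_on U f" "x \<in> U"
  shows "lie \<xi> (\<lambda>x. c * f x) x = c * lie \<xi> f x"
  using lie_mult[of U "\<lambda>x. c" f x \<xi>] assms smooth_on_open[OF assms(1)] by simp

lemma lie_diff:
  assumes "smooth_on U f" "smooth_on U g" "x \<in> U"
  shows "lie \<xi> (\<lambda>x. f x - g x) x = lie \<xi> f x - lie \<xi> g x"
  unfolding lie_def using frechet_derivative_at[OF has_derivative_diff[OF
    smooth_on_has_derivative[OF assms(1,3)] smooth_on_has_derivative[OF assms(2,3)]]] by metis

lemma lie_sum:
  assumes "open U" "\<And>i. i \<in> A \<Longrightarrow> smooth_on U (f i)" "x \<in> U"
  shows "lie \<xi> (\<lambda>x. \<Sum>i\<in>A. f i x) x = (\<Sum>i\<in>A. lie \<xi> (f i) x)"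
  using assms(2)
proof (induction A rule: infinite_finite_induct)
  case (insert a A)
  then show ?case
    using lie_add[of U "f a" "\<lambda>x. \<Sum>i\<in>A. f i x" x \<xi>] assms(1,3) smooth_on_sum[OF assms(1), of A f] by simp
qed auto

lemma lie_power:
  assumes "smooth_on U f" "x \<in> U"
  shows "lie \<xi> (\<lambda>x. f x ^ k) x = real k * f x ^ (k - 1) * lie \<xi> f x"
proof (induction k)
  case (Suc k)
  have "lie \<xi> (\<lambda>x. f x * f x ^ k) x = lie \<xi> f x * f x ^ k + f x * (real k * f x ^ (k - 1) * lie \<xi> f x)"
    using lie_mult[OF assms(1) smooth_on_power[OF assms(1)] assms(2)] Suc by simp
  then show ?case by (cases k) (simp_all add: algebra_simps)
qed simp

text \<open>
  A change of the independent variable multiplies the derivation by a function.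
\<close>

lemma lie_scale:
  assumes "smooth_on U f" "x \<in> U"
  shows "lie (\<lambda>x. c x *\<^sub>R \<xi> x) f x = c x * lie \<xi> f x"
  using linear_frechet_derivative[OF smooth_on_differentiable_at[OF assms]]
  by (simp add: lie_def linear_cmul)

lemma lie_compose:
  fixes \<Phi> :: "'a::real_normed_vector \<Rightarrow> 'b::real_normed_vector"
  assumes "smooth_on U \<Phi>" "smooth_on V g" "\<Phi> ` U \<subseteq> V" "x \<in> U"
    "frechet_derivative \<Phi> (at x) (\<xi> x) = \<zeta> (\<Phi> x)"
  shows "lie \<xi> (\<lambda>x. g (\<Phi> x)) x = lie \<zeta> g (\<Phi> x)"
proof -
  have "g differentiable at (\<Phi> x)" using smooth_on_differentiable_at[OF assms(2)] assms(3,4) by blast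
  from frechet_derivative_compose[OF smooth_on_differentiable_at[OF assms(1,4)] this]
  show ?thesis by (simp add: lie_def o_def assms(5))
qed

lemma smooth_on_lie_iter:
  fixes f :: "'a::euclidean_space \<Rightarrow> real"
  assumes "smooth_on U \<xi>" "smooth_on U f"
  shows "smooth_on U ((lie \<xi> ^^ k) f)"
  using assms by (induction k) auto

lemma lie_iter_cong:
  assumes "open U" "x \<in> U" "\<And>y. y \<in> U \<Longrightarrow> f y = g y"
  shows "(lie \<xi> ^^ k) f x = (lie \<xi> ^^ k) g x"
  using assms(2)
proof (induction k arbitrary: x)
  case (Suc k)
  show ?case
    using lie_cong[OF assms(1) Suc.prems, of "(lie \<xi> ^^ k) f" "(lie \<xi> ^^ k) g" \<xi>, OF Suc.IH] by simp
qed (simp add: assms(3))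

lemma lie_iter_compose:
  fixes \<Phi> :: "'a::euclidean_space \<Rightarrow> 'b::euclidean_space"
  assumes "smooth_on U \<Phi>" "smooth_on V g" "\<Phi> ` U \<subseteq> V" "smooth_on V \<zeta>"
    "\<And>x. x \<in> U \<Longrightarrow> frechet_derivative \<Phi> (at x) (\<xi> x) = \<zeta> (\<Phi> x)" "x \<in> U"
  shows "(lie \<xi> ^^ k) (\<lambda>x. g (\<Phi> x)) x = (lie \<zeta> ^^ k) g (\<Phi> x)"
  using assms(6)
proof (induction k arbitrary: x)
  case (Suc k)
  have "(lie \<xi> ^^ Suc k) (\<lambda>x. g (\<Phi> x)) x = lie \<xi> (\<lambda>x. (lie \<zeta> ^^ k) g (\<Phi> x)) x"
    using lie_cong[OF smooth_on_open[OF assms(1)] Suc.prems, of "(lie \<xi> ^^ k) (\<lambda>x. g (\<Phi> x))"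
        "\<lambda>x. (lie \<zeta> ^^ k) g (\<Phi> x)" \<xi>, OF Suc.IH] by simp
  also have "\<dots> = lie \<zeta> ((lie \<zeta> ^^ k) g) (\<Phi> x)"
    by (rule lie_compose[where \<xi>=\<xi> and \<zeta>=\<zeta>, OF assms(1) smooth_on_lie_iter[OF assms(4,2)]
          assms(3) Suc.prems assms(5)[OF Suc.prems]])
  finally show ?case by simp
qed simp

text \<open>
  The second derivatives of \<open>f\<close> cancel because they are symmetric; what remains is the bracket of the
  two fields.
\<close>

theorem lie_commutator:
  fixes f :: "'a::euclidean_space \<Rightarrow> real"
  assumes f: "smooth_on U f" and v: "smooth_on U v" and w: "smooth_on U w" and x: "x \<in> U"
  shows "lie v (lie w f) x - lie w (lie v f) x =
    frechet_derivative f (at x) (frechet_derivative w (at x) (v x) - frechet_derivative v (at x) (w x))"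
proof -
  have U: "open U" using f by (rule smooth_on_open)
  define D where "D b = (\<lambda>y. frechet_derivative f (at y) b)" for b
  have D: "smooth_on U (D b)" for b unfolding D_def using f by (rule smooth_on_frechet)
  have lin: "linear (frechet_derivative f (at x))"
    by (rule linear_frechet_derivative[OF smooth_on_differentiable_at[OF f x]])
  have *: "lie v (lie w f) x = D (frechet_derivative w (at x) (v x)) x
      + (\<Sum>b\<in>Basis. \<Sum>c\<in>Basis. (w x \<bullet> b) * (v x \<bullet> c) * frechet_derivative (D b) (at x) c)"
    if w: "smooth_on U w" for v w
  proof -
    have comp: "smooth_on U (\<lambda>x. w x \<bullet> b)" if "b \<in> Basis" for b
      using smooth_on_inner_Basis[OF w that] .
    have "lie v (lie w f) x = lie v (\<lambda>x. \<Sum>b\<in>Basis. (w x \<bullet> b) * D b x) x"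
      by (rule lie_cong[OF U x]) (simp add: lie_basis[OF f] D_def)
    also have "\<dots> = (\<Sum>b\<in>Basis. lie v (\<lambda>x. (w x \<bullet> b) * D b x) x)"
      by (rule lie_sum[OF U _ x]) (intro smooth_on_mult comp D)
    also have "\<dots> = (\<Sum>b\<in>Basis. (frechet_derivative w (at x) (v x) \<bullet> b) * D b x + (w x \<bullet> b) * lie v (D b) x)"
    proof (rule sum.cong[OF refl])
      fix b :: 'a assume b: "b \<in> Basis"
      show "lie v (\<lambda>x. (w x \<bullet> b) * D b x) x =
        (frechet_derivative w (at x) (v x) \<bullet> b) * D b x + (w x \<bullet> b) * lie v (D b) x"
        using lie_mult[OF comp[OF b] D x] frechet_derivative_inner[OF smooth_on_differentiable_at[OF w x]]
        by (simp add: lie_def)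
    qed
    also have "\<dots> = D (frechet_derivative w (at x) (v x)) x
       + (\<Sum>b\<in>Basis. (w x \<bullet> b) * lie v (D b) x)"
      using frechet_derivative_basis[OF smooth_on_differentiable_at[OF f x], of "frechet_derivative w (at x) (v x)"]
      by (simp add: sum.distrib D_def)
    finally show ?thesis
      by (simp add: lie_basis[OF D x] sum_distrib_left mult.assoc)
  qed
  have "frechet_derivative (D b) (at x) c = frechet_derivative (D c) (at x) b" for b c
    unfolding D_def using mixed_partials_commute[OF f x] .
  then have "(\<Sum>b\<in>Basis. \<Sum>c\<in>Basis. (w x \<bullet> b) * (v x \<bullet> c) * frechet_derivative (D b) (at x) c)
      = (\<Sum>b\<in>Basis. \<Sum>c\<in>Basis. (v x \<bullet> b) * (w x \<bullet> c) * frechet_derivative (D b) (at x) c)"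
    by (subst sum.swap) (simp add: mult.commute)
  then have "lie v (lie w f) x - lie w (lie v f) x =
      D (frechet_derivative w (at x) (v x)) x - D (frechet_derivative v (at x) (w x)) x"
    by (simp add: *[OF w] *[OF v])
  then show ?thesis using lin by (simp add: D_def linear_diff)
qed

lemma lie_iter_cong_field:
  assumes U: "open U" and x: "x \<in> U" and f: "\<And>x. x \<in> U \<Longrightarrow> \<xi> x = \<zeta> x"
  shows "(lie \<xi> ^^ k) u x = (lie \<zeta> ^^ k) u x"
  using x
proof (induction k arbitrary: x)
  case (Suc k)
  have "lie \<xi> ((lie \<xi> ^^ k) u) x = lie \<xi> ((lie \<zeta> ^^ k) u) x"
    by (rule lie_cong[OF U Suc.prems Suc.IH])
  also have "\<dots> = lie \<zeta> ((lie \<zeta> ^^ k) u) x" using f[OF Suc.prems] by (simp add: lie_def)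
  finally show ?case by simp
qed simp

lemma lie_iter_linear_comb:
  fixes g :: "'i \<Rightarrow> 'a::euclidean_space \<Rightarrow> real"
  assumes \<xi>: "smooth_on U \<xi>" and g: "\<And>i. i \<in> A \<Longrightarrow> smooth_on U (g i)" and x: "x \<in> U"
  shows "(lie \<xi> ^^ k) (\<lambda>x. \<Sum>i\<in>A. c i * g i x) x = (\<Sum>i\<in>A. c i * (lie \<xi> ^^ k) (g i) x)"
  using x
proof (induction k arbitrary: x)
  case (Suc k)
  have U: "open U" using \<xi> by (rule smooth_on_open)
  have gk: "smooth_on U ((lie \<xi> ^^ k) (g i))" if "i \<in> A" for i by (rule smooth_on_lie_iter[OF \<xi> g[OF that]])
  have "(lie \<xi> ^^ Suc k) (\<lambda>x. \<Sum>i\<in>A. c i * g i x) x = lie \<xi> (\<lambda>x. \<Sum>i\<in>A. c i * (lie \<xi> ^^ k) (g i) x) x"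
    using lie_cong[OF U Suc.prems Suc.IH] by simp
  also have "\<dots> = (\<Sum>i\<in>A. lie \<xi> (\<lambda>x. c i * (lie \<xi> ^^ k) (g i) x) x)"
    by (rule lie_sum[OF U _ Suc.prems]) (intro smooth_on_mult smooth_on_const U gk)
  also have "\<dots> = (\<Sum>i\<in>A. c i * lie \<xi> ((lie \<xi> ^^ k) (g i)) x)"
    by (intro sum.cong refl lie_cmult[OF gk Suc.prems])
  finally show ?case by simp
qed simp

lemma lie_const_fields_commute:
  fixes f :: "'a::euclidean_space \<Rightarrow> real"
  assumes "smooth_on U f" "x \<in> U"
  shows "lie (\<lambda>_. a) ((lie (\<lambda>_. b) ^^ k) f) x = (lie (\<lambda>_. b) ^^ k) (lie (\<lambda>_. a) f) x"
  using assms(2)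
proof (induction k arbitrary: x)
  case (Suc k)
  have U: "open U" using assms(1) by (rule smooth_on_open)
  have sm: "smooth_on U ((lie (\<lambda>_. b) ^^ k) f)" by (rule smooth_on_lie_iter[OF smooth_on_const[OF U] assms(1)])
  have "lie (\<lambda>_. a) (lie (\<lambda>_. b) ((lie (\<lambda>_. b) ^^ k) f)) x = lie (\<lambda>_. b) (lie (\<lambda>_. a) ((lie (\<lambda>_. b) ^^ k) f)) x"
    using mixed_partials_commute[OF sm Suc.prems, of b a] by (simp add: lie_def[abs_def])
  also have "\<dots> = lie (\<lambda>_. b) ((lie (\<lambda>_. b) ^^ k) (lie (\<lambda>_. a) f)) x"
    by (rule lie_cong[OF U Suc.prems Suc.IH])
  finally show ?case by simp
qed simp

text \<open>
  For a function with \<open>\<xi>\<close>-derivative 1 these are the usual derivatives of a power. Such a function is a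
  parameter along the integral curves of \<open>\<xi>\<close>; its presence says in particular that \<open>\<xi>\<close> has no zeros.
\<close>

lemma lie_iter_power:
  fixes xh :: "'a::euclidean_space \<Rightarrow> real"
  assumes xh: "smooth_on U xh" "\<And>x. x \<in> U \<Longrightarrow> lie \<xi> xh x = 1" and x: "x \<in> U"
  shows "(lie \<xi> ^^ j) (\<lambda>x. (xh x - c) ^ k) x = fact j * real (k choose j) * (xh x - c) ^ (k - j)"
  using x
proof (induction j arbitrary: x)
  case (Suc j)
  have U: "open U" using xh(1) by (rule smooth_on_open)
  have sm: "smooth_on U (\<lambda>x. xh x - c)" by (intro smooth_on_diff xh smooth_on_const U)
  have "lie \<xi> (\<lambda>x. xh x - c) x = 1"
    using lie_diff[OF xh(1) smooth_on_const[OF U] Suc.prems, of \<xi> c] xh(2)[OF Suc.prems] by simp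
  note l = lie_power[OF sm Suc.prems, of \<xi> "k - j", unfolded this]
  have "(lie \<xi> ^^ Suc j) (\<lambda>x. (xh x - c) ^ k) x
     = lie \<xi> (\<lambda>x. fact j * real (k choose j) * (xh x - c) ^ (k - j)) x"
    using lie_cong[OF U Suc.prems Suc.IH] by simp
  also have "\<dots> = fact j * real (k choose j) * (real (k - j) * (xh x - c) ^ (k - j - 1))"
    using lie_cmult[OF smooth_on_power[OF sm] Suc.prems] l by simp
  also have "\<dots> = fact j * (real (k choose j) * real (k - j)) * (xh x - c) ^ (k - Suc j)" by simp
  also have "real (k choose j) * real (k - j) = real (Suc j) * real (k choose Suc j)"
    by (metis binomial_absorb_comp binomial_absorption mult.commute of_nat_mult)
  finally show ?case by (simp add: algebra_simps)
qed simp

section \<open>Symmetric powers of second-order operators\<close>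

definition lin_op :: "('a::real_normed_vector \<Rightarrow> 'a) \<Rightarrow> nat \<Rightarrow> (nat \<Rightarrow> 'a \<Rightarrow> real) \<Rightarrow> ('a \<Rightarrow> real) \<Rightarrow> 'a \<Rightarrow> real" where
  "lin_op \<xi> n f u x = (lie \<xi> ^^ n) u x - (\<Sum>i<n. f i x * (lie \<xi> ^^ i) u x)"

lemma lin_op_linear_comb:
  fixes g :: "'i \<Rightarrow> 'a::euclidean_space \<Rightarrow> real"
  assumes \<xi>: "smooth_on U \<xi>" and g: "\<And>i. i \<in> A \<Longrightarrow> smooth_on U (g i)" and x: "x \<in> U"
  shows "lin_op \<xi> n f (\<lambda>x. \<Sum>i\<in>A. c i * g i x) x = (\<Sum>i\<in>A. c i * lin_op \<xi> n f (g i) x)"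
proof -
  have "(\<Sum>j<n. f j x * (\<Sum>i\<in>A. c i * (lie \<xi> ^^ j) (g i) x)) = (\<Sum>i\<in>A. c i * (\<Sum>j<n. f j x * (lie \<xi> ^^ j) (g i) x))"
    unfolding sum_distrib_left by (subst sum.swap) (simp add: mult_ac)
  moreover have "(lie \<xi> ^^ k) (\<lambda>x. \<Sum>i\<in>A. c i * g i x) x = (\<Sum>i\<in>A. c i * (lie \<xi> ^^ k) (g i) x)" for k
    by (rule lie_iter_linear_comb[OF \<xi> _ x]) (rule g)
  ultimately show ?thesis
    by (simp add: lin_op_def right_diff_distrib sum_subtractf)
qed

text \<open>
  For \<open>u = w^m\<close> with \<open>w'' + p w' + q w = 0\<close>, the recursion gives \<open>m (m-1) \<cdots> (m-i+1) w^(m-i) (w')^i\<close> at index \<open>i\<close>,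
  hence 0 at \<open>i = m + 1\<close>. The operator with index \<open>m + 1\<close> is therefore the \<open>m\<close>-th symmetric power of the
  second-order operator. The index 1 has its own equation so that \<open>p\<close> and \<open>q\<close> enter only from index 2 on.
\<close>

fun sympow_op :: "('a::real_normed_vector \<Rightarrow> 'a) \<Rightarrow> real \<Rightarrow> ('a \<Rightarrow> real) \<Rightarrow> ('a \<Rightarrow> real) \<Rightarrow> nat \<Rightarrow> ('a \<Rightarrow> real) \<Rightarrow> 'a \<Rightarrow> real" where
  "sympow_op \<xi> m p q 0 u = u"
| "sympow_op \<xi> m p q (Suc 0) u = lie \<xi> u"
| "sympow_op \<xi> m p q (Suc (Suc i)) u = (\<lambda>x. lie \<xi> (sympow_op \<xi> m p q (Suc i) u) x
      + real (Suc i) * p x * sympow_op \<xi> m p q (Suc i) u x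
      + real (Suc i) * (m - real i) * q x * sympow_op \<xi> m p q i u x)"

text \<open>
  The same recursion as a property of a sequence of functions, in the uniform form that holds for all
  indices: the term with \<open>Q (i - 1)\<close> is multiplied by 0 when \<open>i = 0\<close>.
\<close>

definition sympow_chain :: "'a::real_normed_vector set \<Rightarrow> ('a \<Rightarrow> 'a) \<Rightarrow> real \<Rightarrow> ('a \<Rightarrow> real) \<Rightarrow> ('a \<Rightarrow> real) \<Rightarrow> (nat \<Rightarrow> 'a \<Rightarrow> real) \<Rightarrow> bool" where
  "sympow_chain U \<xi> m p q Q \<longleftrightarrow> (\<forall>i. smooth_on U (Q i)) \<and>
     (\<forall>i. \<forall>x\<in>U. Q (Suc i) x = lie \<xi> (Q i) x + real i * p x * Q i x
         + real i * (m - real i + 1) * q x * Q (i - 1) x)"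

lemma smooth_on_sympow_op:
  fixes u :: "'a::euclidean_space \<Rightarrow> real"
  assumes "smooth_on U \<xi>" "smooth_on U p" "smooth_on U q" "smooth_on U u"
  shows "smooth_on U (sympow_op \<xi> m p q i u)"
proof (induction i rule: induct_nat_012)
  case (ge2 n)
  show ?case unfolding sympow_op.simps
    by (intro smooth_on_add smooth_on_mult smooth_on_lie smooth_on_const assms ge2 smooth_on_open[OF assms(4)])
qed (auto simp: assms)

lemma sympow_chain_op:
  fixes u :: "'a::euclidean_space \<Rightarrow> real"
  assumes "smooth_on U \<xi>" "smooth_on U p" "smooth_on U q" "smooth_on U u"
  shows "sympow_chain U \<xi> m p q (\<lambda>i. sympow_op \<xi> m p q i u)"
  unfolding sympow_chain_def
proof (intro conjI allI ballI)
  fix i x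
  show "sympow_op \<xi> m p q (Suc i) u x = lie \<xi> (sympow_op \<xi> m p q i u) x + real i * p x * sympow_op \<xi> m p q i u x
         + real i * (m - real i + 1) * q x * sympow_op \<xi> m p q (i - 1) u x"
    by (cases i) (auto simp: algebra_simps)
qed (rule smooth_on_sympow_op[OF assms])

lemma sympow_chain_eq_op:
  assumes Q: "sympow_chain U \<xi> m p q Q" and u: "\<And>x. x \<in> U \<Longrightarrow> Q 0 x = u x" and U: "open U" and x: "x \<in> U"
  shows "Q i x = sympow_op \<xi> m p q i u x"
proof -
  have step: "Q (Suc i) x = lie \<xi> (Q i) x + real i * p x * Q i x
         + real i * (m - real i + 1) * q x * Q (i - 1) x" if "x \<in> U" for i x
    using Q that unfolding sympow_chain_def by blast
  have "\<forall>x\<in>U. Q i x = sympow_op \<xi> m p q i u x"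
  proof (induction i rule: induct_nat_012)
    case 0 then show ?case using u by simp
  next
    case 1
    show ?case using step[of _ 0] lie_cong[OF U, of _ "Q 0" u \<xi>] u by simp
  next
    case (ge2 n)
    have "lie \<xi> (Q (Suc n)) x = lie \<xi> (sympow_op \<xi> m p q (Suc n) u) x" if "x \<in> U" for x
      by (rule lie_cong[OF U that]) (use ge2 in blast)
    then show ?case using step[of _ "Suc n"] ge2 by (simp add: algebra_simps)
  qed
  then show ?thesis using x by blast
qed

text \<open>
  Coefficients of the symmetric power operators with respect to the powers of the derivation.
\<close>

fun sympow_coef :: "('a::real_normed_vector \<Rightarrow> 'a) \<Rightarrow> real \<Rightarrow> ('a \<Rightarrow> real) \<Rightarrow> ('a \<Rightarrow> real) \<Rightarrow> nat \<Rightarrow> nat \<Rightarrow> 'a \<Rightarrow> real" where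
  "sympow_coef \<xi> m p q 0 j = (\<lambda>x. if j = 0 then 1 else 0)"
| "sympow_coef \<xi> m p q (Suc 0) j = (\<lambda>x. if j = 1 then 1 else 0)"
| "sympow_coef \<xi> m p q (Suc (Suc i)) j = (\<lambda>x. (if j = 0 then 0 else sympow_coef \<xi> m p q (Suc i) (j - 1) x)
      + lie \<xi> (sympow_coef \<xi> m p q (Suc i) j) x
      + real (Suc i) * p x * sympow_coef \<xi> m p q (Suc i) j x
      + real (Suc i) * (m - real i) * q x * sympow_coef \<xi> m p q i j x)"

lemma smooth_on_sympow_coef:
  fixes p q :: "'a::euclidean_space \<Rightarrow> real"
  assumes "smooth_on U \<xi>" "smooth_on U p" "smooth_on U q"
  shows "smooth_on U (sympow_coef \<xi> m p q i j)"
proof (induction i arbitrary: j rule: induct_nat_012)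
  case (ge2 n)
  have "smooth_on U (\<lambda>x. if j = 0 then 0 else sympow_coef \<xi> m p q (Suc n) (j - 1) x)"
    using ge2 smooth_on_open[OF assms(2)] by (cases "j = 0") auto
  then show ?case unfolding sympow_coef.simps
    by (intro smooth_on_add smooth_on_mult smooth_on_lie smooth_on_const assms ge2 smooth_on_open[OF assms(2)])
qed (use smooth_on_open[OF assms(2)] in auto)

lemma sympow_coef_above: "i < j \<Longrightarrow> sympow_coef \<xi> m p q i j = (\<lambda>x. 0)"
  by (induction i arbitrary: j rule: induct_nat_012) auto

lemma sympow_op_expand:
  fixes u :: "'a::euclidean_space \<Rightarrow> real"
  assumes s: "smooth_on U \<xi>" "smooth_on U p" "smooth_on U q" and u: "smooth_on U u" and x: "x \<in> U"
  shows "sympow_op \<xi> m p q i u x = (\<Sum>j\<le>i. sympow_coef \<xi> m p q i j x * (lie \<xi> ^^ j) u x)"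
proof -
  have U: "open U" using u by (rule smooth_on_open)
  define D where "D j = (lie \<xi> ^^ j) u" for j
  have D: "smooth_on U (D j)" for j unfolding D_def by (rule smooth_on_lie_iter[OF s(1) u])
  have DS: "D (Suc j) = lie \<xi> (D j)" for j by (simp add: D_def)
  have "\<forall>x\<in>U. sympow_op \<xi> m p q i u x = (\<Sum>j\<le>i. sympow_coef \<xi> m p q i j x * D j x)"
  proof (induction i rule: induct_nat_012)
    case 0 then show ?case by (simp add: D_def)
  next
    case 1 then show ?case by (simp add: D_def)
  next
    case (ge2 i)
    show ?case
    proof
      fix x assume x: "x \<in> U"
      let ?a = "sympow_coef \<xi> m p q"
      have "lie \<xi> (sympow_op \<xi> m p q (Suc i) u) x = lie \<xi> (\<lambda>x. \<Sum>j\<le>Suc i. ?a (Suc i) j x * D j x) x"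
        by (rule lie_cong[OF U x]) (use ge2 in blast)
      also have "\<dots> = (\<Sum>j\<le>Suc i. lie \<xi> (\<lambda>x. ?a (Suc i) j x * D j x) x)"
        by (rule lie_sum[OF U _ x]) (intro smooth_on_mult D smooth_on_sympow_coef s)
      also have "\<dots> = (\<Sum>j\<le>Suc i. lie \<xi> (?a (Suc i) j) x * D j x + ?a (Suc i) j x * D (Suc j) x)"
        unfolding DS by (intro sum.cong refl lie_mult[OF _ _ x] D smooth_on_sympow_coef s)
      also have "\<dots> = (\<Sum>j\<le>Suc (Suc i). lie \<xi> (?a (Suc i) j) x * D j x)
          + (\<Sum>j\<le>Suc (Suc i). (if j = 0 then 0 else ?a (Suc i) (j - 1) x) * D j x)"
      proof -
        have "(\<Sum>j\<le>Suc (Suc i). (if j = 0 then 0 else ?a (Suc i) (j - 1) x) * D j x)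
          = (\<Sum>j\<le>Suc i. ?a (Suc i) j x * D (Suc j) x)"
          by (subst sum.atMost_Suc_shift) simp
        moreover have "lie \<xi> (?a (Suc i) (Suc (Suc i))) x = 0"
          by (subst sympow_coef_above) simp_all
        ultimately show ?thesis by (simp add: sum.distrib)
      qed
      finally have 1: "lie \<xi> (sympow_op \<xi> m p q (Suc i) u) x =
         (\<Sum>j\<le>Suc (Suc i). lie \<xi> (?a (Suc i) j) x * D j x)
          + (\<Sum>j\<le>Suc (Suc i). (if j = 0 then 0 else ?a (Suc i) (j - 1) x) * D j x)" .
      have 2: "sympow_op \<xi> m p q (Suc i) u x = (\<Sum>j\<le>Suc (Suc i). ?a (Suc i) j x * D j x)"
        using ge2 x by (simp add: sympow_coef_above)
      have 3: "sympow_op \<xi> m p q i u x = (\<Sum>j\<le>Suc (Suc i). ?a i j x * D j x)"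
        using ge2 x by (simp add: sympow_coef_above)
      show "sympow_op \<xi> m p q (Suc (Suc i)) u x = (\<Sum>j\<le>Suc (Suc i). ?a (Suc (Suc i)) j x * D j x)"
        unfolding sympow_op.simps sympow_coef.simps 1 2 3 sum_distrib_left sum.distrib[symmetric]
        by (rule sum.cong[OF refl]) (simp add: algebra_simps)
    qed
  qed
  then show ?thesis using x by (simp add: D_def)
qed

lemma sympow_coef_diag [simp]: "sympow_coef \<xi> m p q i i = (\<lambda>x. 1)"
  by (induction i rule: induct_nat_012) (auto simp: sympow_coef_above)

text \<open>
  The numbers \<open>triangular\<close>, \<open>q_factor\<close>, \<open>dp_factor\<close> and \<open>pp_factor\<close> are the constants in the two coefficients
  next to the leading one.
\<close>

definition triangular :: "nat \<Rightarrow> real" where "triangular i = (\<Sum>k\<le>i. real k)"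

lemma sympow_coef_subdiag:
  "sympow_coef \<xi> m p q (Suc i) i = (\<lambda>x. triangular i * p x)"
proof (induction i)
  case (Suc i)
  then show ?case by (simp add: triangular_def algebra_simps sympow_coef_above)
qed (simp add: triangular_def)

definition q_factor :: "real \<Rightarrow> nat \<Rightarrow> real" where "q_factor m i = (\<Sum>k\<le>i. real (Suc k) * (m - real k))"

definition dp_factor :: "nat \<Rightarrow> real" where "dp_factor i = (\<Sum>k\<le>i. triangular k)"

definition pp_factor :: "nat \<Rightarrow> real" where "pp_factor i = (\<Sum>k\<le>i. real (Suc k) * triangular k)"

lemma sympow_coef_subsubdiag:
  assumes "smooth_on U p" "x \<in> U"
  shows "sympow_coef \<xi> m p q (Suc (Suc i)) i x = q_factor m i * q x + dp_factor i * lie \<xi> p x + pp_factor i * (p x * p x)"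
proof (induction i)
  case 0
  then show ?case by (simp add: q_factor_def dp_factor_def pp_factor_def triangular_def)
next
  case (Suc i)
  have 1: "lie \<xi> (sympow_coef \<xi> m p q (Suc (Suc i)) (Suc i)) x = triangular (Suc i) * lie \<xi> p x"
    unfolding sympow_coef_subdiag using lie_cmult[OF assms] .
  show ?case
    unfolding sympow_coef.simps(3)[of _ _ _ _ "Suc i"] 1
    unfolding sympow_coef_subdiag sympow_coef_diag
    by (simp del: sympow_coef.simps add: Suc q_factor_def dp_factor_def pp_factor_def algebra_simps)
qed

text \<open>
  A differential operator determines its coefficients, since a function may have arbitrary derivatives
  at a point along the field.
\<close>

lemma operator_coeffs_unique:
  fixes xh :: "'a::euclidean_space \<Rightarrow> real"
  assumes xh: "smooth_on U xh" "\<And>x. x \<in> U \<Longrightarrow> lie \<xi> xh x = 1" and x: "x \<in> U"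
    and eq: "\<And>u. smooth_on U u \<Longrightarrow> (\<Sum>j\<le>n. c j * (lie \<xi> ^^ j) u x) = (\<Sum>j\<le>n. d j * (lie \<xi> ^^ j) u x)"
    and j: "j \<le> n"
  shows "c j = d j"
proof -
  \<comment> \<open>The powers of \<open>xh - xh x\<close> have prescribed derivatives at \<open>x\<close>.\<close>
  define u where "u = (\<lambda>y. (xh y - xh x) ^ j)"
  have "smooth_on U u" unfolding u_def
    by (intro smooth_on_power smooth_on_diff xh smooth_on_const smooth_on_open[OF xh(1)])
  note e = eq[OF this]
  have Xu: "(lie \<xi> ^^ i) u x = (if i = j then fact j else 0)" for i
    using lie_iter_power[OF xh x, of i "xh x" j] by (auto simp: u_def power_0_left binomial_eq_0)
  have "(\<Sum>i\<le>n. h i * (lie \<xi> ^^ i) u x) = h j * fact j" for h :: "nat \<Rightarrow> real"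
  proof -
    have "(\<Sum>i\<le>n. h i * (lie \<xi> ^^ i) u x) = (\<Sum>i\<le>n. if i = j then h j * fact j else 0)"
      by (intro sum.cong refl) (simp add: Xu)
    then show ?thesis using j by simp
  qed
  then show ?thesis using e by simp
qed

lemma lin_op_sum:
  fixes u :: "'a::real_normed_vector \<Rightarrow> real"
  shows "lin_op \<xi> n f u x = (\<Sum>j\<le>n. (if j = n then 1 else - f j x) * (lie \<xi> ^^ j) u x)"
proof -
  have "{..n} = insert n {..<n}" by auto
  then have "(\<Sum>j\<le>n. (if j = n then 1 else - f j x) * (lie \<xi> ^^ j) u x)
     = (lie \<xi> ^^ n) u x + (\<Sum>j<n. (if j = n then 1 else - f j x) * (lie \<xi> ^^ j) u x)" by simp
  also have "(\<Sum>j<n. (if j = n then 1 else - f j x) * (lie \<xi> ^^ j) u x) = - (\<Sum>j<n. f j x * (lie \<xi> ^^ j) u x)"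
    by (simp add: sum_negf[symmetric])
  finally show ?thesis by (simp add: lin_op_def)
qed

text \<open>
  The monic operator of order \<open>n\<close> with the lower coefficients \<open>- f i\<close> is a symmetric power.
\<close>

definition is_sympow :: "nat \<Rightarrow> 'a::real_normed_vector set \<Rightarrow> ('a \<Rightarrow> 'a) \<Rightarrow> (nat \<Rightarrow> 'a \<Rightarrow> real) \<Rightarrow> bool" where
  "is_sympow n U \<xi> f \<longleftrightarrow> (\<exists>p q. smooth_on U p \<and> smooth_on U q \<and>
     (\<forall>u. smooth_on U u \<longrightarrow> (\<forall>x\<in>U. sympow_op \<xi> (real (n - 1)) p q n u x = lin_op \<xi> n f u x)))"

lemma sympow_op_eq_lin_op_iff:
  fixes xh :: "'a::euclidean_space \<Rightarrow> real"
  assumes xh: "smooth_on U xh" "\<And>x. x \<in> U \<Longrightarrow> lie \<xi> xh x = 1"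
    and s: "smooth_on U \<xi>" "smooth_on U p" "smooth_on U q"
  shows "(\<forall>u. smooth_on U u \<longrightarrow> (\<forall>x\<in>U. sympow_op \<xi> m p q n u x = lin_op \<xi> n f u x)) \<longleftrightarrow>
     (\<forall>x\<in>U. \<forall>j<n. sympow_coef \<xi> m p q n j x = - f j x)" (is "?L \<longleftrightarrow> ?R")
proof
  assume L: ?L
  show ?R
  proof (intro ballI allI impI)
    fix x j assume x: "x \<in> U" and j: "j < n"
    have "sympow_coef \<xi> m p q n j x = (if j = n then 1 else - f j x)"
    proof (rule operator_coeffs_unique[OF xh x])
      fix u :: "'a \<Rightarrow> real" assume u: "smooth_on U u"
      show "(\<Sum>j\<le>n. sympow_coef \<xi> m p q n j x * (lie \<xi> ^^ j) u x)
         = (\<Sum>j\<le>n. (if j = n then 1 else - f j x) * (lie \<xi> ^^ j) u x)"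
        using L u x sympow_op_expand[OF s u x, of m n] lin_op_sum[of \<xi> n f u x] by simp
    qed (use j in auto)
    then show "sympow_coef \<xi> m p q n j x = - f j x" using j by simp
  qed
next
  assume R: ?R
  show ?L
  proof (intro allI impI ballI)
    fix u :: "'a \<Rightarrow> real" and x assume u: "smooth_on U u" and x: "x \<in> U"
    show "sympow_op \<xi> m p q n u x = lin_op \<xi> n f u x"
      unfolding sympow_op_expand[OF s u x] lin_op_sum
    proof (rule sum.cong[OF refl])
      fix j assume "j \<in> {..n}"
      then show "sympow_coef \<xi> m p q n j x * (lie \<xi> ^^ j) u x = (if j = n then 1 else - f j x) * (lie \<xi> ^^ j) u x"
        using R x by (cases "j = n") auto
    qed
  qed
qed

lemma sympow_op_zero:
  "sympow_op \<xi> m (\<lambda>_. 0) (\<lambda>_. 0) i u = (lie \<xi> ^^ i) u"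
  by (induction i rule: induct_nat_012) simp_all

lemma sympow_op_cong_field:
  assumes U: "open U" and x: "x \<in> U" and f: "\<And>x. x \<in> U \<Longrightarrow> \<xi> x = \<zeta> x"
  shows "sympow_op \<xi> m p q i u x = sympow_op \<zeta> m p q i u x"
  using x
proof (induction i arbitrary: x rule: induct_nat_012)
  case 1 then show ?case using f by (simp add: lie_def)
next
  case (ge2 i)
  have "lie \<xi> (sympow_op \<xi> m p q (Suc i) u) x = lie \<xi> (sympow_op \<zeta> m p q (Suc i) u) x"
    by (rule lie_cong[OF U ge2.prems ge2.IH(2)])
  then have "lie \<xi> (sympow_op \<xi> m p q (Suc i) u) x = lie \<zeta> (sympow_op \<zeta> m p q (Suc i) u) x"
    using f[OF ge2.prems] by (simp add: lie_def)
  then show ?case using ge2 by simp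
qed simp

lemma is_sympow_cong_field:
  assumes U: "open U" and f: "\<And>x. x \<in> U \<Longrightarrow> \<xi> x = \<zeta> x"
  shows "is_sympow n U \<xi> g \<longleftrightarrow> is_sympow n U \<zeta> g"
proof -
  have "sympow_op \<xi> m p q n u x = sympow_op \<zeta> m p q n u x" "lin_op \<xi> n g u x = lin_op \<zeta> n g u x"
    if "x \<in> U" for m p q u x
    using sympow_op_cong_field[OF U that f] lie_iter_cong_field[OF U that f] by (simp_all add: lin_op_def)
  then show ?thesis by (simp add: is_sympow_def)
qed

section \<open>Change of parameter and multiplication of the solutions\<close>

definition falling_fact :: "real \<Rightarrow> nat \<Rightarrow> real" where "falling_fact a k = (\<Prod>l<k. a - real l)"

lemma falling_fact_0 [simp]: "falling_fact a 0 = 1" by (simp add: falling_fact_def)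

lemma falling_fact_Suc: "falling_fact a (Suc k) = falling_fact a k * (a - real k)" by (simp add: falling_fact_def)

lemma falling_fact_Suc': "falling_fact a (Suc k) = a * falling_fact (a - 1) k"
  by (simp add: falling_fact_def prod.lessThan_Suc_shift algebra_simps del: prod.lessThan_Suc)

text \<open>
  If \<open>w\<close> is replaced by \<open>\<tau> w\<close>, then \<open>w'\<close> is replaced by \<open>\<tau> (w' + \<theta> w)\<close> with \<open>\<theta> = \<tau>' / \<tau>\<close>. These are the
  coefficients of the expansion of \<open>m \<cdots> (m-i+1) w^(m-i) (w' + \<theta> w)^i\<close> in terms of the monomials
  \<open>m \<cdots> (m-j+1) w^(m-j) (w')^j\<close>, without the power \<open>\<theta>^(i-j)\<close>.
\<close>

definition gauge_coef :: "real \<Rightarrow> nat \<Rightarrow> nat \<Rightarrow> real" where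
  "gauge_coef m i j = real (i choose j) * falling_fact (m - real j) (i - j)"

lemma gauge_coef_above: "i < j \<Longrightarrow> gauge_coef m i j = 0"
  by (simp add: gauge_coef_def binomial_eq_0)

lemma gauge_coef_diag [simp]: "gauge_coef m i i = 1"
  by (simp add: gauge_coef_def)

lemma gauge_coef_row:
  assumes "j \<le> r"
  shows "gauge_coef m (Suc r) j * real (Suc r - j) = real (Suc r) * (m - real r) * gauge_coef m r j"
proof -
  have b: "real (Suc r choose j) * real (Suc r - j) = real (Suc r) * real (r choose j)"
    using binomial_absorb_comp[of "Suc r" j] by (metis diff_Suc_1 mult.commute of_nat_mult)
  have f: "falling_fact (m - real j) (Suc r - j) = falling_fact (m - real j) (r - j) * (m - real r)"
    using assms falling_fact_Suc[of "m - real j" "r - j"] by (simp add: Suc_diff_le of_nat_diff)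
  have "gauge_coef m (Suc r) j * real (Suc r - j)
     = (real (Suc r choose j) * real (Suc r - j)) * (falling_fact (m - real j) (r - j) * (m - real r))"
    unfolding gauge_coef_def f by (simp only: mult_ac)
  also have "\<dots> = real (Suc r) * (m - real r) * gauge_coef m r j"
    unfolding b gauge_coef_def by (simp only: mult_ac)
  finally show ?thesis .
qed

lemma gauge_coef_diagonal:
  assumes "j \<le> r"
  shows "gauge_coef m (Suc r) (Suc j) * (real (Suc j) * (m - real j)) = real (Suc r) * (m - real r) * gauge_coef m r j"
proof -
  have b: "real (Suc r choose Suc j) * real (Suc j) = real (Suc r) * real (r choose j)"
    using Suc_times_binomial[of j r] by (metis mult.commute of_nat_mult)
  have f: "falling_fact (m - real (Suc j)) (r - j) * (m - real j) = falling_fact (m - real j) (r - j) * (m - real r)"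
    using assms falling_fact_Suc[of "m - real j" "r - j"] falling_fact_Suc'[of "m - real j" "r - j"]
    by (simp add: of_nat_diff algebra_simps)
  have "gauge_coef m (Suc r) (Suc j) * (real (Suc j) * (m - real j))
     = (real (Suc r choose Suc j) * real (Suc j)) * (falling_fact (m - real (Suc j)) (r - j) * (m - real j))"
    by (simp add: gauge_coef_def)
  also have "\<dots> = real (Suc r) * (m - real r) * gauge_coef m r j"
    unfolding b f gauge_coef_def by simp
  finally show ?thesis .
qed

lemma gauge_coef_pascal:
  "gauge_coef m (Suc i) j = (if j = 0 then 0 else gauge_coef m i (j - 1)) + (m - real i - real j) * gauge_coef m i j"
proof -
  consider "j = 0" | "j = Suc i" | "Suc i < j" | "0 < j" "j \<le> i" by linarith
  then show ?thesis
  proof cases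
    case 1 then show ?thesis by (simp add: gauge_coef_def falling_fact_Suc)
  next
    case 2 then show ?thesis by (simp add: gauge_coef_above)
  next
    case 3 then show ?thesis by (simp add: gauge_coef_above)
  next
    case 4
    then obtain k where k: "j = Suc k" by (cases j) auto
    define G where "G = falling_fact (m - real j) (i - j)"
    have f1: "falling_fact (m - real j) (Suc i - j) = G * (m - real i)"
      using 4 falling_fact_Suc[of "m - real j" "i - j"] by (simp add: Suc_diff_le of_nat_diff G_def)
    have ik: "i - k = Suc (i - j)" using 4 k by simp
    have f2: "falling_fact (m - real k) (i - k) = (m - real k) * G"
      unfolding ik falling_fact_Suc' G_def by (simp add: k algebra_simps)
    have b: "real (Suc k) * real (i choose Suc k) = (real i - real k) * real (i choose k)"
    proof -
      have "(i - k) * (i choose k) = Suc k * (i choose Suc k)"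
        using binomial_absorb_comp[of i k] binomial_absorption[of k i] by simp
      then have "real (i - k) * real (i choose k) = real (Suc k) * real (i choose Suc k)"
        by (metis of_nat_mult)
      then show ?thesis using 4 k by (simp add: of_nat_diff)
    qed
    have "gauge_coef m (Suc i) j = (real (i choose k) + real (i choose Suc k)) * (G * (m - real i))"
      unfolding gauge_coef_def f1 by (simp add: k)
    also have "\<dots> = real (i choose k) * ((m - real k) * G) + (m - real i - real j) * (real (i choose Suc k) * G)"
    proof -
      have "real (i choose k) * (m - real i) + real (i choose Suc k) * (m - real i)
        - real (i choose k) * (m - real k) - (m - real i - real (Suc k)) * real (i choose Suc k)
        = real (Suc k) * real (i choose Suc k) - (real i - real k) * real (i choose k)"
        by (simp add: algebra_simps)
      then have "real (i choose k) * (m - real i) + real (i choose Suc k) * (m - real i)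
        = real (i choose k) * (m - real k) + (m - real i - real j) * real (i choose Suc k)"
        using b k by simp
      from arg_cong[OF this, of "\<lambda>z. z * G"] show ?thesis by (simp only: distrib_right distrib_left mult_ac)
    qed
    also have "\<dots> = gauge_coef m i k + (m - real i - real j) * gauge_coef m i j"
      using f2 by (simp add: gauge_coef_def k G_def)
    finally show ?thesis using k by simp
  qed
qed

text \<open>
  The recursion at one point, for the expansion with the coefficients \<open>gauge_coef\<close>: \<open>T\<close> satisfies the
  recursion with \<open>p - 2 \<theta>\<close> and \<open>q - \<theta>' + \<theta>\<^sup>2 - p \<theta>\<close>, up to the term \<open>m \<theta> T\<close> which comes from the
  factor \<open>\<mu>\<close>. It follows by comparing coefficients: \<open>row\<close> and \<open>diag\<close> account for the terms
  with \<open>\<theta>'\<close> and \<open>q\<close>, \<open>row'\<close> for those with \<open>p\<close>, and the Pascal rule for the rest.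
\<close>

lemma gauge_identity:
  fixes Q dQ :: "nat \<Rightarrow> real" and \<theta> \<theta>' p q m :: real
  defines "T \<equiv> \<lambda>i. \<Sum>j\<le>i. gauge_coef m i j * \<theta> ^ (i - j) * Q j"
  assumes dQ: "\<And>j. dQ j = Q (Suc j) - real j * p * Q j - real j * (m - real j + 1) * q * Q (j - 1)"
  shows "T (Suc (Suc r)) =
    (\<Sum>j\<le>Suc r. gauge_coef m (Suc r) j * (real (Suc r - j) * \<theta> ^ (Suc r - j - 1) * \<theta>' * Q j + \<theta> ^ (Suc r - j) * dQ j))
    + m * \<theta> * T (Suc r) + real (Suc r) * (p - 2 * \<theta>) * T (Suc r)
    + real (Suc r) * (m - real r) * (q - \<theta>' + \<theta> * \<theta> - p * \<theta>) * T r"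
proof -
  define K where "K = real (Suc r) * (m - real r)"
  define A where "A = (\<Sum>j\<le>Suc r. gauge_coef m (Suc r) j * \<theta> ^ (Suc r - j) * Q (Suc j))"
  have row: "(\<Sum>j\<le>Suc r. gauge_coef m (Suc r) j * real (Suc r - j) * \<theta> ^ (Suc r - j - 1) * Q j) = K * T r"
  proof -
    have "(\<Sum>j\<le>Suc r. gauge_coef m (Suc r) j * real (Suc r - j) * \<theta> ^ (Suc r - j - 1) * Q j)
       = (\<Sum>j\<le>r. gauge_coef m (Suc r) j * real (Suc r - j) * \<theta> ^ (Suc r - j - 1) * Q j)" by simp
    also have "\<dots> = (\<Sum>j\<le>r. K * (gauge_coef m r j * \<theta> ^ (r - j) * Q j))"
    proof (rule sum.cong[OF refl])
      fix j assume "j \<in> {..r}"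
      then have j: "j \<le> r" by simp
      show "gauge_coef m (Suc r) j * real (Suc r - j) * \<theta> ^ (Suc r - j - 1) * Q j = K * (gauge_coef m r j * \<theta> ^ (r - j) * Q j)"
        unfolding gauge_coef_row[OF j] K_def by simp
    qed
    finally show ?thesis by (simp add: T_def sum_distrib_left)
  qed
  have diag: "(\<Sum>j\<le>Suc r. gauge_coef m (Suc r) j * \<theta> ^ (Suc r - j) * (real j * (m - real j + 1) * Q (j - 1))) = K * T r"
  proof -
    have "(\<Sum>j\<le>Suc r. gauge_coef m (Suc r) j * \<theta> ^ (Suc r - j) * (real j * (m - real j + 1) * Q (j - 1)))
      = (\<Sum>j\<le>r. gauge_coef m (Suc r) (Suc j) * \<theta> ^ (r - j) * (real (Suc j) * (m - real j) * Q j))"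
      by (subst sum.atMost_Suc_shift) simp
    also have "\<dots> = (\<Sum>j\<le>r. K * (gauge_coef m r j * \<theta> ^ (r - j) * Q j))"
    proof (rule sum.cong[OF refl])
      fix j assume "j \<in> {..r}"
      then have j: "j \<le> r" by simp
      have "gauge_coef m (Suc r) (Suc j) * \<theta> ^ (r - j) * (real (Suc j) * (m - real j) * Q j)
        = (gauge_coef m (Suc r) (Suc j) * (real (Suc j) * (m - real j))) * (\<theta> ^ (r - j) * Q j)" by simp
      then show "gauge_coef m (Suc r) (Suc j) * \<theta> ^ (r - j) * (real (Suc j) * (m - real j) * Q j)
        = K * (gauge_coef m r j * \<theta> ^ (r - j) * Q j)"
        unfolding gauge_coef_diagonal[OF j] K_def by simp
    qed
    finally show ?thesis by (simp add: T_def sum_distrib_left)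
  qed
  have row': "(\<Sum>j\<le>Suc r. real j * (gauge_coef m (Suc r) j * \<theta> ^ (Suc r - j) * Q j)) = real (Suc r) * T (Suc r) - \<theta> * K * T r"
  proof -
    have "\<theta> * (K * T r) = (\<Sum>j\<le>Suc r. \<theta> * (gauge_coef m (Suc r) j * real (Suc r - j) * \<theta> ^ (Suc r - j - 1) * Q j))"
      unfolding row[symmetric] sum_distrib_left ..
    also have "\<dots> = (\<Sum>j\<le>Suc r. real (Suc r) * (gauge_coef m (Suc r) j * \<theta> ^ (Suc r - j) * Q j)
        - real j * (gauge_coef m (Suc r) j * \<theta> ^ (Suc r - j) * Q j))"
    proof (rule sum.cong[OF refl])
      fix j assume "j \<in> {..Suc r}"
      then have j: "j \<le> Suc r" by simp
      show "\<theta> * (gauge_coef m (Suc r) j * real (Suc r - j) * \<theta> ^ (Suc r - j - 1) * Q j) =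
        real (Suc r) * (gauge_coef m (Suc r) j * \<theta> ^ (Suc r - j) * Q j) - real j * (gauge_coef m (Suc r) j * \<theta> ^ (Suc r - j) * Q j)"
      proof (cases "j = Suc r")
        case False
        then have "Suc r - j = Suc (r - j)" using j by simp
        then have P: "\<theta> * \<theta> ^ (Suc r - j - 1) = \<theta> ^ (Suc r - j)" by simp
        have R: "real (Suc r - j) = real (Suc r) - real j" using j by (simp add: of_nat_diff)
        have "\<theta> * (gauge_coef m (Suc r) j * real (Suc r - j) * \<theta> ^ (Suc r - j - 1) * Q j)
          = real (Suc r - j) * (gauge_coef m (Suc r) j * (\<theta> * \<theta> ^ (Suc r - j - 1)) * Q j)"
          by (simp only: mult_ac)
        then show ?thesis unfolding P R by (simp only: left_diff_distrib)
      qed simp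
    qed
    also have "\<dots> = real (Suc r) * T (Suc r) - (\<Sum>j\<le>Suc r. real j * (gauge_coef m (Suc r) j * \<theta> ^ (Suc r - j) * Q j))"
      by (simp only: sum_subtractf sum_distrib_left T_def)
    finally show ?thesis unfolding mult.assoc by linarith
  qed
  have T2: "T (Suc (Suc r)) = A + m * \<theta> * T (Suc r) - 2 * real (Suc r) * \<theta> * T (Suc r) + \<theta> * \<theta> * K * T r"
  proof -
    have "T (Suc (Suc r)) = (\<Sum>j\<le>Suc (Suc r). (if j = 0 then 0 else gauge_coef m (Suc r) (j - 1)) * \<theta> ^ (Suc (Suc r) - j) * Q j)
      + (\<Sum>j\<le>Suc (Suc r). (m - real (Suc r) - real j) * gauge_coef m (Suc r) j * \<theta> ^ (Suc (Suc r) - j) * Q j)"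
      unfolding T_def gauge_coef_pascal[of m "Suc r"] sum.distrib[symmetric]
      by (rule sum.cong[OF refl]) (simp only: distrib_right)
    also have "(\<Sum>j\<le>Suc (Suc r). (if j = 0 then 0 else gauge_coef m (Suc r) (j - 1)) * \<theta> ^ (Suc (Suc r) - j) * Q j) = A"
      unfolding A_def by (subst sum.atMost_Suc_shift) simp
    also have "(\<Sum>j\<le>Suc (Suc r). (m - real (Suc r) - real j) * gauge_coef m (Suc r) j * \<theta> ^ (Suc (Suc r) - j) * Q j)
      = (\<Sum>j\<le>Suc r. (m - real (Suc r) - real j) * gauge_coef m (Suc r) j * \<theta> ^ (Suc (Suc r) - j) * Q j)"
      by (simp add: gauge_coef_above)
    also have "\<dots> = (\<Sum>j\<le>Suc r. \<theta> * (m - real (Suc r)) * (gauge_coef m (Suc r) j * \<theta> ^ (Suc r - j) * Q j)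
        - \<theta> * (real j * (gauge_coef m (Suc r) j * \<theta> ^ (Suc r - j) * Q j)))"
    proof (rule sum.cong[OF refl])
      fix j assume "j \<in> {..Suc r}"
      then have "\<theta> ^ (Suc (Suc r) - j) = \<theta> * \<theta> ^ (Suc r - j)" by (simp add: Suc_diff_le)
      then show "(m - real (Suc r) - real j) * gauge_coef m (Suc r) j * \<theta> ^ (Suc (Suc r) - j) * Q j =
        \<theta> * (m - real (Suc r)) * (gauge_coef m (Suc r) j * \<theta> ^ (Suc r - j) * Q j)
        - \<theta> * (real j * (gauge_coef m (Suc r) j * \<theta> ^ (Suc r - j) * Q j))" by (simp add: algebra_simps)
    qed
    also have "\<dots> = \<theta> * (m - real (Suc r)) * T (Suc r) - \<theta> * (real (Suc r) * T (Suc r) - \<theta> * K * T r)"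
      unfolding sum_subtractf sum_distrib_left[symmetric] row' by (simp add: T_def del: sum.atMost_Suc)
    finally show ?thesis by (simp add: algebra_simps)
  qed
  have "(\<Sum>j\<le>Suc r. gauge_coef m (Suc r) j * (real (Suc r - j) * \<theta> ^ (Suc r - j - 1) * \<theta>' * Q j + \<theta> ^ (Suc r - j) * dQ j))
     = (\<Sum>j\<le>Suc r. \<theta>' * (gauge_coef m (Suc r) j * real (Suc r - j) * \<theta> ^ (Suc r - j - 1) * Q j)
        + gauge_coef m (Suc r) j * \<theta> ^ (Suc r - j) * Q (Suc j)
        - p * (real j * (gauge_coef m (Suc r) j * \<theta> ^ (Suc r - j) * Q j))
        - q * (gauge_coef m (Suc r) j * \<theta> ^ (Suc r - j) * (real j * (m - real j + 1) * Q (j - 1))))"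
    unfolding dQ by (rule sum.cong[OF refl]) (simp add: algebra_simps)
  also have "\<dots> = \<theta>' * (K * T r) + A - p * (real (Suc r) * T (Suc r) - \<theta> * K * T r) - q * (K * T r)"
    unfolding sum_subtractf sum.distrib sum_distrib_left[symmetric] row diag row' A_def by simp
  finally show ?thesis unfolding T2 K_def by (simp add: algebra_simps)
qed

text \<open>
  Multiplication of \<open>u = w^m\<close> by \<open>\<mu> = \<tau>^m\<close> multiplies \<open>w\<close> by \<open>\<tau>\<close>; the hypothesis on \<open>\<mu>\<close> says that \<open>\<theta>\<close> is
  the logarithmic derivative of \<open>\<tau>\<close>.
\<close>

lemma sympow_chain_mult:
  fixes Q :: "nat \<Rightarrow> 'a::euclidean_space \<Rightarrow> real"
  assumes Q: "sympow_chain U \<xi> m p q Q" and \<theta>: "smooth_on U \<theta>" and \<mu>: "smooth_on U \<mu>" "\<And>x. x \<in> U \<Longrightarrow> lie \<xi> \<mu> x = m * \<theta> x * \<mu> x"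
  shows "sympow_chain U \<xi> m (\<lambda>x. p x - 2 * \<theta> x) (\<lambda>x. q x - lie \<xi> \<theta> x + \<theta> x * \<theta> x - p x * \<theta> x)
     (\<lambda>i x. \<mu> x * (\<Sum>j\<le>i. gauge_coef m i j * \<theta> x ^ (i - j) * Q j x))"
proof -
  have U: "open U" using \<theta> by (rule smooth_on_open)
  have Qs: "smooth_on U (Q i)" for i using Q by (simp add: sympow_chain_def)
  define T where "T i x = (\<Sum>j\<le>i. gauge_coef m i j * \<theta> x ^ (i - j) * Q j x)" for i x
  have Ts: "smooth_on U (T i)" for i unfolding T_def
    by (intro smooth_on_sum smooth_on_mult smooth_on_power smooth_on_const \<theta> Qs U)
  have dQ: "lie \<xi> (Q j) x = Q (Suc j) x - real j * p x * Q j x - real j * (m - real j + 1) * q x * Q (j - 1) x"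
    if "x \<in> U" for j x
  proof -
    have "Q (Suc j) x = lie \<xi> (Q j) x + real j * p x * Q j x + real j * (m - real j + 1) * q x * Q (j - 1) x"
      using Q that unfolding sympow_chain_def by blast
    then show ?thesis by linarith
  qed
  have lieT: "lie \<xi> (T i) x = (\<Sum>j\<le>i. gauge_coef m i j * (real (i - j) * \<theta> x ^ (i - j - 1) * lie \<xi> \<theta> x * Q j x + \<theta> x ^ (i - j) * lie \<xi> (Q j) x))"
    if x: "x \<in> U" for i x
  proof -
    have "lie \<xi> (T i) x = lie \<xi> (\<lambda>x. \<Sum>j\<le>i. gauge_coef m i j * (\<theta> x ^ (i - j) * Q j x)) x"
      by (rule lie_cong[OF U x]) (simp add: T_def mult.assoc)
    also have "\<dots> = (\<Sum>j\<le>i. lie \<xi> (\<lambda>x. gauge_coef m i j * (\<theta> x ^ (i - j) * Q j x)) x)"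
      by (rule lie_sum[OF U _ x]) (intro smooth_on_mult smooth_on_power smooth_on_const \<theta> Qs U)
    also have "\<dots> = (\<Sum>j\<le>i. gauge_coef m i j * (real (i - j) * \<theta> x ^ (i - j - 1) * lie \<xi> \<theta> x * Q j x + \<theta> x ^ (i - j) * lie \<xi> (Q j) x))"
      by (intro sum.cong refl)
        (simp add: lie_cmult[OF smooth_on_mult[OF smooth_on_power[OF \<theta>] Qs] x]
          lie_mult[OF smooth_on_power[OF \<theta>] Qs x] lie_power[OF \<theta> x])
    finally show ?thesis .
  qed
  show ?thesis unfolding sympow_chain_def T_def[symmetric]
  proof (intro conjI allI ballI)
    show "smooth_on U (\<lambda>x. \<mu> x * T i x)" for i by (intro smooth_on_mult \<mu> Ts)
    fix i x assume x: "x \<in> U"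
    have l: "lie \<xi> (\<lambda>x. \<mu> x * T i x) x = m * \<theta> x * \<mu> x * T i x + \<mu> x * lie \<xi> (T i) x"
      using lie_mult[OF \<mu>(1) Ts x] \<mu>(2)[OF x] by simp
    show "\<mu> x * T (Suc i) x = lie \<xi> (\<lambda>x. \<mu> x * T i x) x + real i * (p x - 2 * \<theta> x) * (\<mu> x * T i x) +
      real i * (m - real i + 1) * (q x - lie \<xi> \<theta> x + \<theta> x * \<theta> x - p x * \<theta> x) * (\<mu> x * T (i - 1) x)"
    proof (cases i)
      case 0
      have T0: "T 0 = Q 0" by (rule ext) (simp add: T_def)
      have "gauge_coef m (Suc 0) 0 = m" by (simp add: gauge_coef_def falling_fact_Suc)
      then have "T (Suc 0) x = m * \<theta> x * Q 0 x + Q (Suc 0) x" by (simp add: T_def)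
      also have "Q (Suc 0) x = lie \<xi> (Q 0) x" using dQ[OF x, of 0] by simp
      finally show ?thesis using l unfolding 0 T0 by (simp add: algebra_simps)
    next
      case (Suc r)
      have "T (Suc (Suc r)) x = lie \<xi> (T (Suc r)) x
        + m * \<theta> x * T (Suc r) x + real (Suc r) * (p x - 2 * \<theta> x) * T (Suc r) x
        + real (Suc r) * (m - real r) * (q x - lie \<xi> \<theta> x + \<theta> x * \<theta> x - p x * \<theta> x) * T r x"
        unfolding lieT[OF x] unfolding T_def by (rule gauge_identity) (rule dQ[OF x])
      from arg_cong[OF this, of "\<lambda>z. \<mu> x * z"] show ?thesis
        using l unfolding Suc by (simp add: algebra_simps)
    qed
  qed
qed

text \<open>
  At index \<open>m + 1\<close> the expansion reduces to a single term, because each other coefficient contains the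
  factor 0 of the falling factorial. Hence the symmetric power is only multiplied by a function.
\<close>

lemma gauge_coef_top: "j < Suc k \<Longrightarrow> gauge_coef (real k) (Suc k) j = 0"
  unfolding gauge_coef_def falling_fact_def
  by (auto intro!: prod_zero bexI[of _ "k - j"] simp: of_nat_diff)

text \<open>
  In the chain for \<open>w^m\<close> the index counts the factors \<open>w'\<close>, and each of them is divided by \<open>\<sigma>\<close>.
\<close>

lemma sympow_chain_scale:
  fixes Q :: "nat \<Rightarrow> 'a::euclidean_space \<Rightarrow> real"
  assumes Q: "sympow_chain U \<xi> m p q Q" and \<sigma>: "smooth_on U \<sigma>" "\<And>x. x \<in> U \<Longrightarrow> \<sigma> x \<noteq> 0"
  shows "sympow_chain U (\<lambda>x. inverse (\<sigma> x) *\<^sub>R \<xi> x) m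
     (\<lambda>x. inverse (\<sigma> x) * (p x + inverse (\<sigma> x) * lie \<xi> \<sigma> x)) (\<lambda>x. inverse (\<sigma> x) ^ 2 * q x)
     (\<lambda>i x. inverse (\<sigma> x) ^ i * Q i x)"
  unfolding sympow_chain_def
proof (intro conjI allI ballI)
  have Qs: "smooth_on U (Q i)" for i using Q by (simp add: sympow_chain_def)
  define \<kappa> where "\<kappa> = (\<lambda>x. inverse (\<sigma> x))"
  have \<kappa>: "smooth_on U \<kappa>" unfolding \<kappa>_def using \<sigma> by (rule smooth_on_inverse)
  fix i
  have sm: "smooth_on U (\<lambda>x. \<kappa> x ^ i * Q i x)" by (intro smooth_on_mult smooth_on_power \<kappa> Qs)
  then show "smooth_on U (\<lambda>x. inverse (\<sigma> x) ^ i * Q i x)" by (simp add: \<kappa>_def)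
  fix x assume x: "x \<in> U"
  have U: "open U" using \<kappa> by (rule smooth_on_open)
  have "lie \<xi> (\<lambda>x. \<sigma> x * \<kappa> x) x = lie \<xi> (\<lambda>x. 1) x"
    by (rule lie_cong[OF U x]) (simp add: \<kappa>_def \<sigma>)
  then have "lie \<xi> \<sigma> x * \<kappa> x + \<sigma> x * lie \<xi> \<kappa> x = 0"
    using lie_mult[OF \<sigma>(1) \<kappa> x] by simp
  then have "\<kappa> x * (lie \<xi> \<sigma> x * \<kappa> x) + (\<kappa> x * \<sigma> x) * lie \<xi> \<kappa> x = 0"
    by (metis distrib_left mult.assoc mult_zero_right)
  then have k': "lie \<xi> \<kappa> x = - (\<kappa> x * \<kappa> x * lie \<xi> \<sigma> x)"
    using \<sigma>(2)[OF x] by (simp add: \<kappa>_def algebra_simps)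
  have "lie \<xi> (\<lambda>x. \<kappa> x ^ i * Q i x) x
    = real i * \<kappa> x ^ (i - 1) * lie \<xi> \<kappa> x * Q i x + \<kappa> x ^ i * lie \<xi> (Q i) x"
    using lie_mult[OF smooth_on_power[OF \<kappa>] Qs x, of \<xi> i i] lie_power[OF \<kappa> x, of \<xi> i] by simp
  also have "\<dots> = - real i * \<kappa> x ^ Suc i * lie \<xi> \<sigma> x * Q i x + \<kappa> x ^ i * lie \<xi> (Q i) x"
    by (cases i) (simp_all add: k' algebra_simps)
  finally have "lie \<xi> (\<lambda>x. \<kappa> x ^ i * Q i x) x
    = - real i * \<kappa> x ^ Suc i * lie \<xi> \<sigma> x * Q i x + \<kappa> x ^ i * lie \<xi> (Q i) x" .
  then have l: "lie (\<lambda>x. \<kappa> x *\<^sub>R \<xi> x) (\<lambda>x. \<kappa> x ^ i * Q i x) x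
    = \<kappa> x * (- real i * \<kappa> x ^ Suc i * lie \<xi> \<sigma> x * Q i x + \<kappa> x ^ i * lie \<xi> (Q i) x)"
    using lie_scale[OF sm x] by simp
  have e: "Q (Suc i) x = lie \<xi> (Q i) x + real i * p x * Q i x + real i * (m - real i + 1) * q x * Q (i - 1) x"
    using Q x unfolding sympow_chain_def by blast
  have "\<kappa> x ^ Suc i * Q (Suc i) x = lie (\<lambda>x. \<kappa> x *\<^sub>R \<xi> x) (\<lambda>x. \<kappa> x ^ i * Q i x) x
     + real i * (\<kappa> x * (p x + \<kappa> x * lie \<xi> \<sigma> x)) * (\<kappa> x ^ i * Q i x)
     + real i * (m - real i + 1) * (\<kappa> x ^ 2 * q x) * (\<kappa> x ^ (i - 1) * Q (i - 1) x)"
    unfolding l e by (cases i) (simp_all add: algebra_simps power2_eq_square)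
  then show "inverse (\<sigma> x) ^ Suc i * Q (Suc i) x =
       lie (\<lambda>x. inverse (\<sigma> x) *\<^sub>R \<xi> x) (\<lambda>x. inverse (\<sigma> x) ^ i * Q i x) x +
       real i * (inverse (\<sigma> x) * (p x + inverse (\<sigma> x) * lie \<xi> \<sigma> x)) * (inverse (\<sigma> x) ^ i * Q i x) +
       real i * (m - real i + 1) * (inverse (\<sigma> x) ^ 2 * q x) * (inverse (\<sigma> x) ^ (i - 1) * Q (i - 1) x)"
    by (simp add: \<kappa>_def)
qed

text \<open>
  The class of symmetric powers does not depend on the choice of the parameter, nor on a factor of the
  solutions.
\<close>

theorem sympow_op_gauge:
  fixes \<xi> :: "'a::euclidean_space \<Rightarrow> 'a"
  assumes s: "smooth_on U \<xi>" "smooth_on U p" "smooth_on U q"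
    and \<mu>: "smooth_on U \<mu>" "\<And>x. x \<in> U \<Longrightarrow> \<mu> x \<noteq> 0"
    and \<sigma>: "smooth_on U \<sigma>" "\<And>x. x \<in> U \<Longrightarrow> \<sigma> x \<noteq> 0"
    and n: "2 \<le> n"
  obtains p' q' where "smooth_on U p'" "smooth_on U q'"
    "\<And>u x. smooth_on U u \<Longrightarrow> x \<in> U \<Longrightarrow>
       sympow_op (\<lambda>x. inverse (\<sigma> x) *\<^sub>R \<xi> x) (real (n - 1)) p' q' n (\<lambda>x. \<mu> x * u x) x
         = \<mu> x * inverse (\<sigma> x) ^ n * sympow_op \<xi> (real (n - 1)) p q n u x"
proof -
  define m where "m = real (n - 1)"
  have m: "m > 0" using n by (simp add: m_def)
  have U: "open U" using \<mu>(1) by (rule smooth_on_open)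
  \<comment> \<open>If \<open>\<mu> = \<tau>^m\<close> for a function \<open>\<tau>\<close>, then \<open>\<theta> = \<tau>' / \<tau>\<close>; this form avoids extracting the root.\<close>
  define \<theta> where "\<theta> = (\<lambda>x. lie \<xi> \<mu> x / (m * \<mu> x))"
  have \<theta>: "smooth_on U \<theta>" unfolding \<theta>_def
    using m \<mu> by (intro smooth_on_divide smooth_on_lie smooth_on_mult smooth_on_const U s) auto
  have \<mu>': "lie \<xi> \<mu> x = m * \<theta> x * \<mu> x" if "x \<in> U" for x
    using m \<mu>(2)[OF that] by (simp add: \<theta>_def)
  define p1 where "p1 = (\<lambda>x. p x - 2 * \<theta> x)"
  define q1 where "q1 = (\<lambda>x. q x - lie \<xi> \<theta> x + \<theta> x * \<theta> x - p x * \<theta> x)"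
  define p2 where "p2 = (\<lambda>x. inverse (\<sigma> x) * (p1 x + inverse (\<sigma> x) * lie \<xi> \<sigma> x))"
  define q2 where "q2 = (\<lambda>x. inverse (\<sigma> x) ^ 2 * q1 x)"
  have 1: "smooth_on U p1" "smooth_on U q1" unfolding p1_def q1_def
    by (intro smooth_on_add smooth_on_diff smooth_on_mult smooth_on_lie smooth_on_const U s \<theta>)+
  have 2: "smooth_on U p2" "smooth_on U q2" unfolding p2_def q2_def
    by (intro smooth_on_add smooth_on_mult smooth_on_lie smooth_on_power smooth_on_inverse s 1 \<sigma>; assumption)+
  show ?thesis
  proof (rule that[OF 2])
    fix u :: "'a \<Rightarrow> real" and x assume u: "smooth_on U u" and x: "x \<in> U"
    define Q where "Q = (\<lambda>i. sympow_op \<xi> m p q i u)"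
    define R where "R = (\<lambda>i x. inverse (\<sigma> x) ^ i * (\<mu> x * (\<Sum>j\<le>i. gauge_coef m i j * \<theta> x ^ (i - j) * Q j x)))"
    have "sympow_chain U \<xi> m p q Q" unfolding Q_def by (rule sympow_chain_op[OF s u])
    from sympow_chain_mult[OF this \<theta> \<mu>(1) \<mu>']
    have "sympow_chain U \<xi> m p1 q1 (\<lambda>i x. \<mu> x * (\<Sum>j\<le>i. gauge_coef m i j * \<theta> x ^ (i - j) * Q j x))"
      unfolding p1_def q1_def by simp
    from sympow_chain_scale[OF this \<sigma>]
    have R: "sympow_chain U (\<lambda>x. inverse (\<sigma> x) *\<^sub>R \<xi> x) m p2 q2 R"
      unfolding p2_def q2_def R_def by simp
    have "R n x = sympow_op (\<lambda>x. inverse (\<sigma> x) *\<^sub>R \<xi> x) m p2 q2 n (\<lambda>x. \<mu> x * u x) x"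
      by (rule sympow_chain_eq_op[OF R _ U x]) (simp add: R_def Q_def)
    moreover have "(\<Sum>j\<le>n. gauge_coef m n j * \<theta> x ^ (n - j) * Q j x) = Q n x"
    proof -
      have "(\<Sum>j\<le>n. gauge_coef m n j * \<theta> x ^ (n - j) * Q j x) = (\<Sum>j\<le>n. if j = n then Q n x else 0)"
      proof (rule sum.cong[OF refl])
        fix j assume "j \<in> {..n}"
        then have "j = n \<or> j < Suc (n - 1)" by auto
        moreover have "Suc (n - 1) = n" using n by simp
        ultimately show "gauge_coef m n j * \<theta> x ^ (n - j) * Q j x = (if j = n then Q n x else 0)"
          using gauge_coef_top[of j "n - 1"] by (auto simp: m_def)
      qed
      then show ?thesis by simp
    qed
    ultimately show "sympow_op (\<lambda>x. inverse (\<sigma> x) *\<^sub>R \<xi> x) (real (n - 1)) p2 q2 n (\<lambda>x. \<mu> x * u x) x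
         = \<mu> x * inverse (\<sigma> x) ^ n * sympow_op \<xi> (real (n - 1)) p q n u x"
      by (simp add: R_def Q_def m_def mult_ac)
  qed
qed

text \<open>
  An intertwining relation between the two given operators suffices: the symmetric power obtained from
  \<open>sympow_op_gauge\<close> agrees with the second operator up to a factor, which the leading coefficients fix.
\<close>

lemma is_sympow_transfer:
  fixes \<xi> :: "'a::euclidean_space \<Rightarrow> 'a"
  assumes s: "smooth_on U \<xi>"
    and \<mu>: "smooth_on U \<mu>" "\<And>x. x \<in> U \<Longrightarrow> \<mu> x \<noteq> 0"
    and \<sigma>: "smooth_on U \<sigma>" "\<And>x. x \<in> U \<Longrightarrow> \<sigma> x \<noteq> 0"
    and n: "2 \<le> n"
    and xh: "smooth_on U xh" "\<And>x. x \<in> U \<Longrightarrow> lie (\<lambda>x. inverse (\<sigma> x) *\<^sub>R \<xi> x) xh x = 1"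
    and L: "\<And>u x. smooth_on U u \<Longrightarrow> x \<in> U \<Longrightarrow>
       lin_op (\<lambda>x. inverse (\<sigma> x) *\<^sub>R \<xi> x) n f' (\<lambda>x. \<mu> x * u x) x = \<nu> x * lin_op \<xi> n f u x"
    and rep: "is_sympow n U \<xi> f"
  shows "is_sympow n U (\<lambda>x. inverse (\<sigma> x) *\<^sub>R \<xi> x) f'"
proof -
  let ?\<zeta> = "\<lambda>x. inverse (\<sigma> x) *\<^sub>R \<xi> x"
  have U: "open U" using \<mu>(1) by (rule smooth_on_open)
  obtain p q where pq: "smooth_on U p" "smooth_on U q"
    "\<And>u x. smooth_on U u \<Longrightarrow> x \<in> U \<Longrightarrow> sympow_op \<xi> (real (n - 1)) p q n u x = lin_op \<xi> n f u x"
    using rep unfolding is_sympow_def by blast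
  have \<zeta>: "smooth_on U ?\<zeta>"
    by (rule smooth_on_scaleR[OF smooth_on_inverse[OF \<sigma>] s])
  obtain p' q' where pq': "smooth_on U p'" "smooth_on U q'"
    "\<And>u x. smooth_on U u \<Longrightarrow> x \<in> U \<Longrightarrow>
       sympow_op ?\<zeta> (real (n - 1)) p' q' n (\<lambda>x. \<mu> x * u x) x
         = \<mu> x * inverse (\<sigma> x) ^ n * sympow_op \<xi> (real (n - 1)) p q n u x"
    using sympow_op_gauge[OF s pq(1,2) \<mu> \<sigma> n] by blast
  have key: "sympow_op ?\<zeta> (real (n - 1)) p' q' n v x = \<mu> x * inverse (\<sigma> x) ^ n * lin_op \<xi> n f (\<lambda>x. v x / \<mu> x) x"
    "lin_op ?\<zeta> n f' v x = \<nu> x * lin_op \<xi> n f (\<lambda>x. v x / \<mu> x) x"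
    if v: "smooth_on U v" and x: "x \<in> U" for v x
  proof -
    have u: "smooth_on U (\<lambda>x. v x / \<mu> x)" by (intro smooth_on_divide v \<mu>)
    have vu: "v y = \<mu> y * (v y / \<mu> y)" if "y \<in> U" for y using \<mu>(2)[OF that] by simp
    have D: "(lie ?\<zeta> ^^ i) v x = (lie ?\<zeta> ^^ i) (\<lambda>x. \<mu> x * (v x / \<mu> x)) x" for i
      by (rule lie_iter_cong[OF U x vu])
    have "smooth_on U (\<lambda>x. \<mu> x * (v x / \<mu> x))" by (intro smooth_on_mult \<mu> u)
    then have "sympow_op ?\<zeta> (real (n - 1)) p' q' n v x = sympow_op ?\<zeta> (real (n - 1)) p' q' n (\<lambda>x. \<mu> x * (v x / \<mu> x)) x"
      by (simp add: sympow_op_expand[OF \<zeta> pq'(1,2) _ x] v D)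
    then show "sympow_op ?\<zeta> (real (n - 1)) p' q' n v x = \<mu> x * inverse (\<sigma> x) ^ n * lin_op \<xi> n f (\<lambda>x. v x / \<mu> x) x"
      using pq'(3)[OF u x] pq(3)[OF u x] by simp
    have "lin_op ?\<zeta> n f' v x = lin_op ?\<zeta> n f' (\<lambda>x. \<mu> x * (v x / \<mu> x)) x"
      by (simp add: lin_op_def D)
    then show "lin_op ?\<zeta> n f' v x = \<nu> x * lin_op \<xi> n f (\<lambda>x. v x / \<mu> x) x"
      using L[OF u x] by simp
  qed
  \<comment> \<open>Both operators have leading coefficient 1, so \<open>\<nu>\<close> is found by testing on a function that vanishes to order \<open>n\<close>.\<close>
  have "\<nu> x = \<mu> x * inverse (\<sigma> x) ^ n" if x: "x \<in> U" for x
  proof -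
    define v where "v = (\<lambda>y. (xh y - xh x) ^ n)"
    have v: "smooth_on U v" unfolding v_def
      by (intro smooth_on_power smooth_on_diff xh smooth_on_const U)
    have X: "(lie ?\<zeta> ^^ i) v x = (if i = n then fact n else 0)" for i
      using lie_iter_power[OF xh x, of i "xh x" n] by (auto simp: v_def power_0_left binomial_eq_0)
    have 1: "lin_op ?\<zeta> n f' v x = fact n" by (simp add: lin_op_def X)
    have "sympow_op ?\<zeta> (real (n - 1)) p' q' n v x = (\<Sum>j\<le>n. if j = n then fact n else 0)"
      unfolding sympow_op_expand[OF \<zeta> pq'(1,2) v x] by (intro sum.cong refl) (simp add: X)
    then have 2: "sympow_op ?\<zeta> (real (n - 1)) p' q' n v x = fact n" by simp
    show ?thesis using key[OF v x] unfolding 1 2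
      by (metis fact_nonzero mult_cancel_right mult_eq_0_iff)
  qed
  then have "sympow_op ?\<zeta> (real (n - 1)) p' q' n v x = lin_op ?\<zeta> n f' v x" if "smooth_on U v" "x \<in> U" for v x
    using key[OF that] that by simp
  then show ?thesis unfolding is_sympow_def using pq' by blast
qed

text \<open>
  The converse direction is the same statement for the inverse change, with factors \<open>1 / \<sigma>\<close>, \<open>1 / \<mu>\<close>, \<open>1 / \<nu>\<close>.
\<close>

theorem is_sympow_invariant:
  fixes \<xi> :: "'a::euclidean_space \<Rightarrow> 'a"
  assumes s: "smooth_on U \<xi>"
    and \<mu>: "smooth_on U \<mu>" "\<And>x. x \<in> U \<Longrightarrow> \<mu> x \<noteq> 0"
    and \<sigma>: "smooth_on U \<sigma>" "\<And>x. x \<in> U \<Longrightarrow> \<sigma> x \<noteq> 0"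
    and n: "2 \<le> n"
    and xh: "smooth_on U xh" "\<And>x. x \<in> U \<Longrightarrow> lie \<xi> xh x = 1"
    and yh: "smooth_on U yh" "\<And>x. x \<in> U \<Longrightarrow> lie (\<lambda>x. inverse (\<sigma> x) *\<^sub>R \<xi> x) yh x = 1"
    and L: "\<And>u x. smooth_on U u \<Longrightarrow> x \<in> U \<Longrightarrow>
       lin_op (\<lambda>x. inverse (\<sigma> x) *\<^sub>R \<xi> x) n f' (\<lambda>x. \<mu> x * u x) x = \<nu> x * lin_op \<xi> n f u x"
  shows "is_sympow n U (\<lambda>x. inverse (\<sigma> x) *\<^sub>R \<xi> x) f' \<longleftrightarrow> is_sympow n U \<xi> f"
proof
  assume rep: "is_sympow n U \<xi> f"
  show "is_sympow n U (\<lambda>x. inverse (\<sigma> x) *\<^sub>R \<xi> x) f'"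
    by (rule is_sympow_transfer[where \<mu> = \<mu> and \<nu> = \<nu> and f = f, OF s \<mu> \<sigma> n yh _ rep]) (assumption | rule L)+
next
  let ?\<zeta> = "\<lambda>x. inverse (\<sigma> x) *\<^sub>R \<xi> x"
  assume rep: "is_sympow n U ?\<zeta> f'"
  have U: "open U" using \<mu>(1) by (rule smooth_on_open)
  have \<zeta>: "smooth_on U ?\<zeta>"
    by (rule smooth_on_scaleR[OF smooth_on_inverse[OF \<sigma>] s])
  have undo: "inverse (inverse (\<sigma> x)) *\<^sub>R ?\<zeta> x = \<xi> x" if "x \<in> U" for x
    using \<sigma>(2)[OF that] by simp
  have i\<mu>: "smooth_on U (\<lambda>x. inverse (\<mu> x))" using \<mu> by (rule smooth_on_inverse)
  have i\<sigma>: "smooth_on U (\<lambda>x. inverse (\<sigma> x))" using \<sigma> by (rule smooth_on_inverse)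
  have "is_sympow n U (\<lambda>x. inverse (inverse (\<sigma> x)) *\<^sub>R ?\<zeta> x) f"
  proof (rule is_sympow_transfer[OF \<zeta> i\<mu> _ i\<sigma> _ n xh(1) _ _ rep, where \<nu> = "\<lambda>x. inverse (\<nu> x)"])
    show "inverse (\<mu> x) \<noteq> 0" "inverse (\<sigma> x) \<noteq> 0" if "x \<in> U" for x using \<mu>(2)[OF that] \<sigma>(2)[OF that] by auto
    show "lie (\<lambda>x. inverse (inverse (\<sigma> x)) *\<^sub>R ?\<zeta> x) xh x = 1" if "x \<in> U" for x
      using xh(2)[OF that] undo[OF that] by (simp add: lie_def)
    fix v :: "'a \<Rightarrow> real" and x assume v: "smooth_on U v" and x: "x \<in> U"
    have L': "lin_op ?\<zeta> n f' w x = \<nu> x * lin_op \<xi> n f (\<lambda>x. inverse (\<mu> x) * w x) x" if w: "smooth_on U w" for w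
    proof -
      have "(lie ?\<zeta> ^^ k) w x = (lie ?\<zeta> ^^ k) (\<lambda>x. \<mu> x * (inverse (\<mu> x) * w x)) x" for k
        by (rule lie_iter_cong[OF U x]) (simp add: \<mu>)
      then have "lin_op ?\<zeta> n f' w x = lin_op ?\<zeta> n f' (\<lambda>x. \<mu> x * (inverse (\<mu> x) * w x)) x"
        by (simp add: lin_op_def)
      then show ?thesis using L[OF smooth_on_mult[OF i\<mu> w] x] by simp
    qed
    \<comment> \<open>A function vanishing to order \<open>n\<close> at \<open>x\<close> shows that \<open>\<nu>\<close> has no zeros.\<close>
    define w where "w = (\<lambda>y. (yh y - yh x) ^ n)"
    have w: "smooth_on U w" unfolding w_def by (intro smooth_on_power smooth_on_diff yh smooth_on_const U)
    have "(lie ?\<zeta> ^^ i) w x = (if i = n then fact n else 0)" for i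
      using lie_iter_power[OF yh x, of i "yh x" n] by (auto simp: w_def power_0_left binomial_eq_0)
    then have "lin_op ?\<zeta> n f' w x = fact n" by (simp add: lin_op_def)
    then have \<nu>: "\<nu> x \<noteq> 0" using L'[OF w] by auto
    have "lin_op (\<lambda>x. inverse (inverse (\<sigma> x)) *\<^sub>R ?\<zeta> x) n f (\<lambda>x. inverse (\<mu> x) * v x) x
      = lin_op \<xi> n f (\<lambda>x. inverse (\<mu> x) * v x) x"
      using lie_iter_cong_field[OF U x undo] by (simp add: lin_op_def)
    then show "lin_op (\<lambda>x. inverse (inverse (\<sigma> x)) *\<^sub>R ?\<zeta> x) n f (\<lambda>x. inverse (\<mu> x) * v x) x
      = inverse (\<nu> x) * lin_op ?\<zeta> n f' v x"
      using L'[OF v] \<nu> by simp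
  qed
  then show "is_sympow n U \<xi> f"
    using is_sympow_cong_field[where \<xi> = "\<lambda>x. inverse (inverse (\<sigma> x)) *\<^sub>R ?\<zeta> x" and \<zeta> = \<xi>, OF U undo]
    by simp
qed

section \<open>The conditions as differential polynomials\<close>

definition monomial_eval :: "(nat \<times> nat \<Rightarrow> real) \<Rightarrow> ((nat \<times> nat) \<Rightarrow>\<^sub>0 nat) \<Rightarrow> real" where
  "monomial_eval v m = (\<Prod>ij \<in> Poly_Mapping.keys m. v ij ^ Poly_Mapping.lookup m ij)"

lemma monomial_eval_superset:
  assumes "finite S" "Poly_Mapping.keys m \<subseteq> S"
  shows "monomial_eval v m = (\<Prod>ij \<in> S. v ij ^ Poly_Mapping.lookup m ij)"
  unfolding monomial_eval_def using assms
  by (intro prod.mono_neutral_left) (auto simp: in_keys_iff)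

lemma monomial_eval_add: "monomial_eval v (a + b) = monomial_eval v a * monomial_eval v b"
proof -
  let ?S = "Poly_Mapping.keys a \<union> Poly_Mapping.keys b"
  have S: "finite ?S" "Poly_Mapping.keys a \<subseteq> ?S" "Poly_Mapping.keys b \<subseteq> ?S" "Poly_Mapping.keys (a + b) \<subseteq> ?S"
    using keys_add[of a b] by auto
  show ?thesis
    by (simp add: monomial_eval_superset[OF S(1,2)] monomial_eval_superset[OF S(1,3)]
        monomial_eval_superset[OF S(1,4)] lookup_add power_add prod.distrib)
qed

lemma dpoly_eval_alt: "dpoly_eval v P = (\<Sum>m \<in> Poly_Mapping.keys P. Poly_Mapping.lookup P m * monomial_eval v m)"
  by (simp add: dpoly_eval_def monomial_eval_def)

lemma dpoly_eval_add: "dpoly_eval v (P + Q) = dpoly_eval v P + dpoly_eval v Q"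
  unfolding dpoly_eval_alt by (rule setsum_keys_plus_distrib) (simp_all add: distrib_right)

lemma dpoly_eval_sum: "dpoly_eval v (\<Sum>i\<in>A. f i) = (\<Sum>i\<in>A. dpoly_eval v (f i))"
proof (induction A rule: infinite_finite_induct)
  case (insert a A) then show ?case by (simp add: dpoly_eval_add)
qed (simp_all add: dpoly_eval_def)

lemma dpoly_eval_single: "dpoly_eval v (Poly_Mapping.single m c) = c * monomial_eval v m"
  by (simp add: dpoly_eval_alt)

lemma dpoly_sum_singles:
  fixes P :: dpoly
  shows "P = (\<Sum>m\<in>Poly_Mapping.keys P. Poly_Mapping.single m (Poly_Mapping.lookup P m))"
proof (rule poly_mapping_eqI)
  fix k
  have "(\<Sum>m\<in>Poly_Mapping.keys P. Poly_Mapping.lookup (Poly_Mapping.single m (Poly_Mapping.lookup P m)) k)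
    = (\<Sum>m\<in>Poly_Mapping.keys P. if m = k then Poly_Mapping.lookup P k else 0)"
    by (intro sum.cong refl) (simp add: lookup_single when_def)
  also have "\<dots> = Poly_Mapping.lookup P k" by (simp add: in_keys_iff)
  finally show "Poly_Mapping.lookup P k = Poly_Mapping.lookup (\<Sum>m\<in>Poly_Mapping.keys P. Poly_Mapping.single m (Poly_Mapping.lookup P m)) k"
    by (simp add: lookup_sum)
qed

text \<open>
  A product of polynomial mappings is a convolution, which is awkward to evaluate; writing both factors
  as sums of monomials reduces the claim to products of monomials.
\<close>

lemma dpoly_eval_mult: "dpoly_eval v (P * Q) = dpoly_eval v P * dpoly_eval v Q"
proof -
  let ?s = "\<lambda>P m. Poly_Mapping.single m (Poly_Mapping.lookup P m) :: dpoly"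
  have "P * Q = (\<Sum>a\<in>Poly_Mapping.keys P. ?s P a) * (\<Sum>b\<in>Poly_Mapping.keys Q. ?s Q b)"
    using dpoly_sum_singles[of P] dpoly_sum_singles[of Q] by simp
  also have "\<dots> = (\<Sum>a\<in>Poly_Mapping.keys P. \<Sum>b\<in>Poly_Mapping.keys Q.
     Poly_Mapping.single (a + b) (Poly_Mapping.lookup P a * Poly_Mapping.lookup Q b))"
    by (simp add: sum_product mult_single)
  finally have "dpoly_eval v (P * Q) = (\<Sum>a\<in>Poly_Mapping.keys P. \<Sum>b\<in>Poly_Mapping.keys Q.
     (Poly_Mapping.lookup P a * Poly_Mapping.lookup Q b) * monomial_eval v (a + b))"
    by (simp only: dpoly_eval_sum dpoly_eval_single)
  then show ?thesis
    by (simp add: monomial_eval_add dpoly_eval_alt[of v P] dpoly_eval_alt[of v Q] sum_product mult_ac)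
qed

lemma dpoly_vars_add: "dpoly_vars (P + Q) \<subseteq> dpoly_vars P \<union> dpoly_vars Q"
  using keys_add[of P Q] unfolding dpoly_vars_def by blast

lemma dpoly_vars_mult: "dpoly_vars (P * Q) \<subseteq> dpoly_vars P \<union> dpoly_vars Q"
proof
  fix ij assume "ij \<in> dpoly_vars (P * Q)"
  then obtain m where m: "m \<in> Poly_Mapping.keys (P * Q)" "ij \<in> Poly_Mapping.keys m"
    unfolding dpoly_vars_def by blast
  obtain a b where "m = a + b" "a \<in> Poly_Mapping.keys P" "b \<in> Poly_Mapping.keys Q"
    using m(1) keys_mult[of P Q] by blast
  then show "ij \<in> dpoly_vars P \<union> dpoly_vars Q"
    using m(2) keys_add[of a b] unfolding dpoly_vars_def by blast
qed

text \<open>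
  Syntax trees for polynomials in the indeterminates \<open>d^j F\<^sub>i / dx^j\<close>. The total derivative is
  defined on them by recursion, which makes the conditions independent of \<open>F\<close>.
\<close>

datatype dexp = DConst real | DVar nat nat | DAdd dexp dexp | DMul dexp dexp

primrec deval :: "(nat \<times> nat \<Rightarrow> real) \<Rightarrow> dexp \<Rightarrow> real" where
  "deval v (DConst c) = c"
| "deval v (DVar i j) = v (i, j)"
| "deval v (DAdd a b) = deval v a + deval v b"
| "deval v (DMul a b) = deval v a * deval v b"

primrec dvars :: "dexp \<Rightarrow> (nat \<times> nat) set" where
  "dvars (DConst c) = {}"
| "dvars (DVar i j) = {(i, j)}"
| "dvars (DAdd a b) = dvars a \<union> dvars b"
| "dvars (DMul a b) = dvars a \<union> dvars b"

primrec ddiff :: "dexp \<Rightarrow> dexp" where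
  "ddiff (DConst c) = DConst 0"
| "ddiff (DVar i j) = DVar i (Suc j)"
| "ddiff (DAdd a b) = DAdd (ddiff a) (ddiff b)"
| "ddiff (DMul a b) = DAdd (DMul (ddiff a) b) (DMul a (ddiff b))"

primrec dpoly_of :: "dexp \<Rightarrow> dpoly" where
  "dpoly_of (DConst c) = Poly_Mapping.single 0 c"
| "dpoly_of (DVar i j) = Poly_Mapping.single (Poly_Mapping.single (i, j) 1) 1"
| "dpoly_of (DAdd a b) = dpoly_of a + dpoly_of b"
| "dpoly_of (DMul a b) = dpoly_of a * dpoly_of b"

lemma dpoly_eval_of: "dpoly_eval v (dpoly_of e) = deval v e"
  by (induction e) (simp_all add: dpoly_eval_add dpoly_eval_mult dpoly_eval_single monomial_eval_def)

lemma dpoly_vars_of: "dpoly_vars (dpoly_of e) \<subseteq> dvars e"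
proof (induction e)
  case (DAdd a b) then show ?case using dpoly_vars_add[of "dpoly_of a" "dpoly_of b"] by auto
next
  case (DMul a b) then show ?case using dpoly_vars_mult[of "dpoly_of a" "dpoly_of b"] by auto
qed (simp_all add: dpoly_vars_def)

text \<open>
  The values of the indeterminates, for the coefficients \<open>f\<close> and the derivation along \<open>\<xi>\<close>.
\<close>

definition coef_derivs :: "('a::real_normed_vector \<Rightarrow> 'a) \<Rightarrow> (nat \<Rightarrow> 'a \<Rightarrow> real) \<Rightarrow> 'a \<Rightarrow> nat \<times> nat \<Rightarrow> real" where
  "coef_derivs \<xi> f x = (\<lambda>(i, j). (lie \<xi> ^^ j) (f i) x)"

lemma smooth_on_deval:
  fixes f :: "nat \<Rightarrow> 'a::euclidean_space \<Rightarrow> real"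
  assumes "smooth_on U \<xi>" "\<And>i. smooth_on U (f i)"
  shows "smooth_on U (\<lambda>x. deval (coef_derivs \<xi> f x) e)"
proof (induction e)
  case (DVar i j)
  then show ?case using smooth_on_lie_iter[OF assms, of j i] by (simp add: coef_derivs_def)
qed (auto intro!: smooth_on_add smooth_on_mult smooth_on_const smooth_on_open[OF assms(1)])

lemma lie_deval:
  fixes f :: "nat \<Rightarrow> 'a::euclidean_space \<Rightarrow> real"
  assumes "smooth_on U \<xi>" "\<And>i. smooth_on U (f i)" "x \<in> U"
  shows "lie \<xi> (\<lambda>x. deval (coef_derivs \<xi> f x) e) x = deval (coef_derivs \<xi> f x) (ddiff e)"
proof (induction e)
  case (DVar i j)
  then show ?case by (simp add: coef_derivs_def)
next
  case (DAdd a b)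
  then show ?case using lie_add[OF smooth_on_deval[OF assms(1,2)] smooth_on_deval[OF assms(1,2)] assms(3)]
    by simp
next
  case (DMul a b)
  then show ?case using lie_mult[OF smooth_on_deval[OF assms(1,2)] smooth_on_deval[OF assms(1,2)] assms(3)]
    by simp
qed simp

fun sympow_coef_exp :: "real \<Rightarrow> dexp \<Rightarrow> dexp \<Rightarrow> nat \<Rightarrow> nat \<Rightarrow> dexp" where
  "sympow_coef_exp m p q 0 j = DConst (if j = 0 then 1 else 0)"
| "sympow_coef_exp m p q (Suc 0) j = DConst (if j = 1 then 1 else 0)"
| "sympow_coef_exp m p q (Suc (Suc i)) j = DAdd (DAdd (DAdd (if j = 0 then DConst 0 else sympow_coef_exp m p q (Suc i) (j - 1))
      (ddiff (sympow_coef_exp m p q (Suc i) j)))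
      (DMul (DMul (DConst (real (Suc i))) p) (sympow_coef_exp m p q (Suc i) j)))
      (DMul (DMul (DConst (real (Suc i) * (m - real i))) q) (sympow_coef_exp m p q i j))"

lemma deval_sympow_coef_exp:
  fixes f :: "nat \<Rightarrow> 'a::euclidean_space \<Rightarrow> real"
  assumes s: "smooth_on U \<xi>" "\<And>i. smooth_on U (f i)" and x: "x \<in> U"
    and p: "\<And>x. x \<in> U \<Longrightarrow> deval (coef_derivs \<xi> f x) P = p x"
    and q: "\<And>x. x \<in> U \<Longrightarrow> deval (coef_derivs \<xi> f x) Q = q x"
  shows "deval (coef_derivs \<xi> f x) (sympow_coef_exp m P Q i j) = sympow_coef \<xi> m p q i j x"
  using x
proof (induction i arbitrary: j x rule: induct_nat_012)
  case (ge2 i)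
  have "lie \<xi> (sympow_coef \<xi> m p q (Suc i) j) x = lie \<xi> (\<lambda>x. deval (coef_derivs \<xi> f x) (sympow_coef_exp m P Q (Suc i) j)) x"
    by (rule lie_cong[OF smooth_on_open[OF s(1)] ge2.prems]) (simp add: ge2.IH)
  then show ?case
    using ge2.prems by (simp add: ge2.IH p q lie_deval[OF s ge2.prems])
qed simp_all

text \<open>
  The indeterminates of weight at most \<open>w\<close>, where \<open>F\<^sub>n\<^sub>-\<^sub>1\<close> has weight 1, \<open>F\<^sub>n\<^sub>-\<^sub>2\<close> has weight 2 and each
  differentiation adds 1. The coefficients of the symmetric power of index \<open>i\<close> have weight at most \<open>i\<close>;
  this bounds the order of differentiation by \<open>n - 1\<close>.
\<close>

definition weighted_vars :: "nat \<Rightarrow> nat \<Rightarrow> (nat \<times> nat) set" where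
  "weighted_vars n w = {(n - 1, k) |k. k + 1 \<le> w} \<union> {(n - 2, k) |k. k + 2 \<le> w}"

lemma dvars_ddiff_bound:
  "dvars e \<subseteq> weighted_vars n w \<Longrightarrow> dvars (ddiff e) \<subseteq> weighted_vars n (Suc w)"
  by (induction e) (auto simp: weighted_vars_def)

lemma weighted_vars_mono: "v \<le> w \<Longrightarrow> weighted_vars n v \<subseteq> weighted_vars n w"
  by (auto simp: weighted_vars_def)

lemma dvars_sympow_coef_exp:
  assumes "dvars p \<subseteq> weighted_vars n 1" "dvars q \<subseteq> weighted_vars n 2"
  shows "dvars (sympow_coef_exp m p q i j) \<subseteq> weighted_vars n i"
proof (induction i arbitrary: j rule: induct_nat_012)
  case (ge2 i)
  have 1: "dvars p \<subseteq> weighted_vars n (Suc (Suc i))" "dvars q \<subseteq> weighted_vars n (Suc (Suc i))"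
    using assms weighted_vars_mono[of 1 "Suc (Suc i)" n] weighted_vars_mono[of 2 "Suc (Suc i)" n] by auto
  have 2: "dvars (sympow_coef_exp m p q (Suc i) j) \<subseteq> weighted_vars n (Suc (Suc i))" for j
    using ge2(2)[of j] weighted_vars_mono[of "Suc i" "Suc (Suc i)" n] by auto
  have 3: "dvars (sympow_coef_exp m p q i j) \<subseteq> weighted_vars n (Suc (Suc i))" for j
    using ge2(1)[of j] weighted_vars_mono[of i "Suc (Suc i)" n] by auto
  have 4: "dvars (ddiff (sympow_coef_exp m p q (Suc i) j)) \<subseteq> weighted_vars n (Suc (Suc i))" for j
    by (rule dvars_ddiff_bound[OF ge2(2)])
  show ?case using 1 2 3 4 by simp
qed simp_all

text \<open>
  The solution of the equation \<open>triangular (n - 1) p = - F\<^sub>n\<^sub>-\<^sub>1\<close> for the coefficient of order \<open>n - 1\<close>.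
\<close>

definition p_exp :: "nat \<Rightarrow> dexp" where
  "p_exp n = DMul (DConst (- 1 / triangular (n - 1))) (DVar (n - 1) 0)"

text \<open>
  The solution for \<open>q\<close> of the equation for the coefficient of order \<open>n - 2\<close>.
\<close>

definition q_exp :: "nat \<Rightarrow> dexp" where
  "q_exp n = DMul (DConst (- 1 / q_factor (real (n - 1)) (n - 2)))
     (DAdd (DVar (n - 2) 0) (DAdd (DMul (DConst (dp_factor (n - 2))) (ddiff (p_exp n)))
        (DMul (DConst (pp_factor (n - 2))) (DMul (p_exp n) (p_exp n)))))"

text \<open>
  The coefficient of order \<open>k - 1\<close> of the symmetric power minus the corresponding coefficient \<open>- F\<^sub>k\<^sub>-\<^sub>1\<close> of
  the linearised operator.
\<close>

definition cond_exp :: "nat \<Rightarrow> nat \<Rightarrow> dexp" where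
  "cond_exp n k = DAdd (sympow_coef_exp (real (n - 1)) (p_exp n) (q_exp n) n (k - 1)) (DVar (k - 1) 0)"

lemma dvars_cond_exp:
  assumes "2 \<le> n" "k \<in> {1..n - 2}"
  shows "dvars (cond_exp n k) \<subseteq> {0..n - 1} \<times> {0..n - 1}"
proof -
  have "dvars (p_exp n) \<subseteq> weighted_vars n 1" "dvars (q_exp n) \<subseteq> weighted_vars n 2"
    by (auto simp: p_exp_def q_exp_def weighted_vars_def)
  from dvars_sympow_coef_exp[OF this] have "dvars (sympow_coef_exp (real (n - 1)) (p_exp n) (q_exp n) n (k - 1)) \<subseteq> weighted_vars n n" .
  moreover have "weighted_vars n n \<subseteq> {0..n - 1} \<times> {0..n - 1}"
    using assms by (auto simp: weighted_vars_def)
  ultimately show ?thesis using assms by (auto simp: cond_exp_def)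
qed

lemma triangular_pos: "0 < i \<Longrightarrow> 0 < triangular i"
  unfolding triangular_def by (intro sum_pos2[of _ i]) auto

lemma q_factor_pos: "real i < m \<Longrightarrow> 0 < q_factor m i"
  unfolding q_factor_def by (intro sum_pos) auto

text \<open>
  The functions \<open>p\<close> and \<open>q\<close> which the two highest coefficients force.
\<close>

definition canon_p :: "('a::real_normed_vector \<Rightarrow> 'a) \<Rightarrow> nat \<Rightarrow> (nat \<Rightarrow> 'a \<Rightarrow> real) \<Rightarrow> 'a \<Rightarrow> real" where
  "canon_p \<xi> n f x = deval (coef_derivs \<xi> f x) (p_exp n)"

definition canon_q :: "('a::real_normed_vector \<Rightarrow> 'a) \<Rightarrow> nat \<Rightarrow> (nat \<Rightarrow> 'a \<Rightarrow> real) \<Rightarrow> 'a \<Rightarrow> real" where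
  "canon_q \<xi> n f x = deval (coef_derivs \<xi> f x) (q_exp n)"

lemma smooth_on_canon:
  fixes f :: "nat \<Rightarrow> 'a::euclidean_space \<Rightarrow> real"
  assumes s: "smooth_on U \<xi>" "\<And>i. smooth_on U (f i)"
  shows "smooth_on U (canon_p \<xi> n f)" "smooth_on U (canon_q \<xi> n f)"
  unfolding canon_p_def[abs_def] canon_q_def[abs_def] by (rule smooth_on_deval[OF s])+

lemma sympow_coef_canonical:
  fixes f :: "nat \<Rightarrow> 'a::euclidean_space \<Rightarrow> real"
  assumes s: "smooth_on U \<xi>" "\<And>i. smooth_on U (f i)" and x: "x \<in> U"
  shows "sympow_coef \<xi> m (canon_p \<xi> n f) (canon_q \<xi> n f) i j x = deval (coef_derivs \<xi> f x) (sympow_coef_exp m (p_exp n) (q_exp n) i j)"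
  by (rule sym, rule deval_sympow_coef_exp[where U = U and f = f, OF s x]) (simp_all add: canon_p_def canon_q_def)

lemma top_coefs:
  fixes p :: "'a::euclidean_space \<Rightarrow> real"
  assumes n: "2 \<le> n" and p: "smooth_on U p" and x: "x \<in> U"
  shows "sympow_coef \<xi> m p q n (n - 1) x = triangular (n - 1) * p x"
    "sympow_coef \<xi> m p q n (n - 2) x = q_factor m (n - 2) * q x + dp_factor (n - 2) * lie \<xi> p x + pp_factor (n - 2) * (p x * p x)"
proof -
  have nn: "Suc (n - 1) = n" "Suc (Suc (n - 2)) = n" using n by auto
  show "sympow_coef \<xi> m p q n (n - 1) x = triangular (n - 1) * p x"
    using sympow_coef_subdiag[of \<xi> m p q "n - 1"] nn by simp
  show "sympow_coef \<xi> m p q n (n - 2) x = q_factor m (n - 2) * q x + dp_factor (n - 2) * lie \<xi> p x + pp_factor (n - 2) * (p x * p x)"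
    using sympow_coef_subsubdiag[OF p x, of \<xi> m q "n - 2"] nn by simp
qed

lemma top_coefs_canonical:
  fixes f :: "nat \<Rightarrow> 'a::euclidean_space \<Rightarrow> real"
  assumes n: "2 \<le> n" and s: "smooth_on U \<xi>" "\<And>i. smooth_on U (f i)" and x: "x \<in> U"
  shows "sympow_coef \<xi> (real (n - 1)) (canon_p \<xi> n f) (canon_q \<xi> n f) n (n - 1) x = - f (n - 1) x"
    "sympow_coef \<xi> (real (n - 1)) (canon_p \<xi> n f) (canon_q \<xi> n f) n (n - 2) x = - f (n - 2) x"
proof -
  let ?P = "canon_p \<xi> n f" and ?Q = "canon_q \<xi> n f" and ?m = "real (n - 1)"
  have t: "triangular (n - 1) > 0" using n by (intro triangular_pos) simp
  have e: "q_factor ?m (n - 2) > 0" using n by (intro q_factor_pos) simp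
  have "lie \<xi> ?P x = deval (coef_derivs \<xi> f x) (ddiff (p_exp n))"
    unfolding canon_p_def[abs_def] by (rule lie_deval[OF s x])
  then have "q_factor ?m (n - 2) * ?Q x + dp_factor (n - 2) * lie \<xi> ?P x + pp_factor (n - 2) * (?P x * ?P x) = - f (n - 2) x"
    using e by (simp add: canon_q_def q_exp_def coef_derivs_def canon_p_def field_simps)
  then show "sympow_coef \<xi> ?m ?P ?Q n (n - 2) x = - f (n - 2) x"
    using top_coefs(2)[OF n smooth_on_canon(1)[OF s] x] by simp
  show "sympow_coef \<xi> ?m ?P ?Q n (n - 1) x = - f (n - 1) x"
    using t top_coefs(1)[OF n smooth_on_canon(1)[OF s] x] by (simp add: canon_p_def p_exp_def coef_derivs_def)
qed

lemma conditions_iff_sympow_coef: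
  fixes f :: "nat \<Rightarrow> 'a::euclidean_space \<Rightarrow> real"
  assumes n: "2 \<le> n" and s: "smooth_on U \<xi>" "\<And>i. smooth_on U (f i)"
  shows "(\<forall>k\<in>{1..n - 2}. \<forall>x\<in>U. deval (coef_derivs \<xi> f x) (cond_exp n k) = 0) \<longleftrightarrow>
     (\<forall>x\<in>U. \<forall>j<n. sympow_coef \<xi> (real (n - 1)) (canon_p \<xi> n f) (canon_q \<xi> n f) n j x = - f j x)"
    (is "?C \<longleftrightarrow> ?A")
proof -
  let ?a = "sympow_coef \<xi> (real (n - 1)) (canon_p \<xi> n f) (canon_q \<xi> n f) n"
  have c: "deval (coef_derivs \<xi> f x) (cond_exp n k) = ?a (k - 1) x + f (k - 1) x" if "x \<in> U" for k x
    using sympow_coef_canonical[where f = f, OF s that] by (simp add: cond_exp_def coef_derivs_def)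
  show ?thesis
  proof
    assume C: ?C
    show ?A
    proof (intro ballI allI impI)
      fix x j assume x: "x \<in> U" and j: "j < n"
      consider "j = n - 1" | "j = n - 2" | "Suc j \<in> {1..n - 2}" using j by force
      then show "?a j x = - f j x"
      proof cases
        case 1 then show ?thesis using top_coefs_canonical(1)[where f = f, OF n s x] by simp
      next
        case 2 then show ?thesis using top_coefs_canonical(2)[where f = f, OF n s x] by simp
      next
        case 3 then show ?thesis using C x c[OF x, of "Suc j"] by fastforce
      qed
    qed
  next
    assume A: ?A
    show ?C
    proof (intro ballI)
      fix k x assume k: "k \<in> {1..n - 2}" and x: "x \<in> U"
      have "k - 1 < n" using k by auto
      then show "deval (coef_derivs \<xi> f x) (cond_exp n k) = 0" using A x c[OF x, of k] by auto
    qed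
  qed
qed

text \<open>
  If the operator is the symmetric power for some \<open>p\<close> and \<open>q\<close>, then its two highest coefficients force
  these to be the functions chosen in \<open>p_exp\<close> and \<open>q_exp\<close>, and the conditions say that the other
  coefficients agree too.
\<close>

theorem conditions_iff_is_sympow:
  fixes f :: "nat \<Rightarrow> 'a::euclidean_space \<Rightarrow> real"
  assumes n: "2 \<le> n" and s: "smooth_on U \<xi>" "\<And>i. smooth_on U (f i)"
    and xh: "smooth_on U xh" "\<And>x. x \<in> U \<Longrightarrow> lie \<xi> xh x = 1"
  shows "(\<forall>k\<in>{1..n - 2}. \<forall>x\<in>U. deval (coef_derivs \<xi> f x) (cond_exp n k) = 0) \<longleftrightarrow> is_sympow n U \<xi> f"
  unfolding conditions_iff_sympow_coef[where f = f, OF n s]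
proof
  let ?P = "canon_p \<xi> n f" and ?Q = "canon_q \<xi> n f" and ?m = "real (n - 1)"
  note PQ = smooth_on_canon[where f = f and n = n, OF s]
  {
    assume "\<forall>x\<in>U. \<forall>j<n. sympow_coef \<xi> ?m ?P ?Q n j x = - f j x"
    then have "\<forall>u. smooth_on U u \<longrightarrow> (\<forall>x\<in>U. sympow_op \<xi> ?m ?P ?Q n u x = lin_op \<xi> n f u x)"
      using sympow_op_eq_lin_op_iff[OF xh s(1) PQ, of ?m n f] by blast
    then show "is_sympow n U \<xi> f" unfolding is_sympow_def using PQ by blast
  next
    assume "is_sympow n U \<xi> f"
    then obtain p q where pq: "smooth_on U p" "smooth_on U q"
      "\<forall>u. smooth_on U u \<longrightarrow> (\<forall>x\<in>U. sympow_op \<xi> ?m p q n u x = lin_op \<xi> n f u x)"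
      unfolding is_sympow_def by blast
    have A: "sympow_coef \<xi> ?m p q n j x = - f j x" if "x \<in> U" "j < n" for x j
      using sympow_op_eq_lin_op_iff[OF xh s(1) pq(1,2), of ?m n f] pq(3) that by blast
    have t: "triangular (n - 1) > 0" using n by (intro triangular_pos) simp
    have e: "q_factor ?m (n - 2) > 0" using n by (intro q_factor_pos) simp
    have nn: "n - 1 < n" "n - 2 < n" using n by auto
    have pP: "p x = ?P x" if x: "x \<in> U" for x
      using A[OF x nn(1)] top_coefs_canonical(1)[where f = f, OF n s x] t
      unfolding top_coefs(1)[OF n pq(1) x] top_coefs(1)[OF n PQ(1) x] by (metis less_irrefl mult_left_cancel)
    have lpP: "lie \<xi> p x = lie \<xi> ?P x" if "x \<in> U" for x
      by (rule lie_cong[OF smooth_on_open[OF s(1)] that pP])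
    have qQ: "q x = ?Q x" if x: "x \<in> U" for x
    proof -
      have "q_factor ?m (n - 2) * q x = q_factor ?m (n - 2) * ?Q x"
        using A[OF x nn(2)] top_coefs_canonical(2)[where f = f, OF n s x]
        unfolding top_coefs(2)[OF n pq(1) x] top_coefs(2)[OF n PQ(1) x] pP[OF x] lpP[OF x] by linarith
      then show ?thesis using e by simp
    qed
    have eq: "sympow_coef \<xi> ?m ?P ?Q n j x = sympow_coef \<xi> ?m p q n j x" if x: "x \<in> U" for j x
      unfolding sympow_coef_canonical[where f = f, OF s x]
      by (rule deval_sympow_coef_exp[where U = U and f = f, OF s x])
        (simp_all add: pP qQ canon_p_def[symmetric] canon_q_def[symmetric])
    show "\<forall>x\<in>U. \<forall>j<n. sympow_coef \<xi> ?m ?P ?Q n j x = - f j x"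
    proof (intro ballI allI impI)
      fix x j assume "x \<in> U" "j < n"
      then show "sympow_coef \<xi> ?m ?P ?Q n j x = - f j x" using eq[of x j] A[of x j] by metis
    qed
  }
qed

section \<open>The total derivative on jet space\<close>

lemma pos_less: "pos (i :: 'n::finite) < CARD('n)"
  using to_nat_on_finite[of "UNIV :: 'n set"] by (auto dest: bij_betwE)

lemma idx_pos [simp]: "idx (pos i) = (i :: 'n::finite)"
  by (simp add: countable_finite)

lemma pos_idx [simp]: "k < CARD('n::finite) \<Longrightarrow> pos (idx k :: 'n) = k"
  by (rule to_nat_on_from_nat_into) (use to_nat_on_finite[of "UNIV :: 'n set"] in \<open>simp add: bij_betw_def\<close>)

lemma idx_eq_iff: "k < CARD('n) \<Longrightarrow> l < CARD('n) \<Longrightarrow> (idx k :: 'n::finite) = idx l \<longleftrightarrow> k = l"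
  by (metis pos_idx)

lemma sum_idx: "(\<Sum>i\<in>(UNIV::'n::finite set). g (pos i)) = (\<Sum>k<CARD('n). g k)"
  by (rule sum.reindex_bij_betw) (rule to_nat_on_finite, simp)

text \<open>
  The total derivative as a vector field on jet space. Its integral curves are the jets of solutions.
\<close>

definition total_field :: "('n::finite jet \<Rightarrow> real) \<Rightarrow> 'n jet \<Rightarrow> 'n jet" where
  "total_field F p = (1, \<chi> i. if pos i < CARD('n) - 1 then snd p $ idx (Suc (pos i)) else F p)"

lemma frechet_derivative_linear_comp:
  assumes "bounded_linear L" "f differentiable (at x)"
  shows "frechet_derivative (\<lambda>x. L (f x)) (at x) v = L (frechet_derivative f (at x) v)"
proof -
  have "((\<lambda>x. L (f x)) has_derivative (\<lambda>v. L (frechet_derivative f (at x) v))) (at x)"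
    by (rule bounded_linear.has_derivative[OF assms(1) assms(2)[unfolded frechet_derivative_works]])
  from frechet_derivative_at[OF this] show ?thesis by metis
qed

lemma bounded_linear_snd_nth: "bounded_linear (\<lambda>z :: 'a::real_normed_vector \<times> (real ^ 'n). snd z $ i)"
  using bounded_linear_compose[OF bounded_linear_vec_nth[of i] bounded_linear_snd] by simp

lemma frechet_derivative_jet:
  fixes f :: "'a::real_normed_vector \<Rightarrow> 'n::finite jet"
  assumes "f differentiable (at x)"
  shows "frechet_derivative f (at x) v =
    (frechet_derivative (\<lambda>x. fst (f x)) (at x) v, \<chi> i. frechet_derivative (\<lambda>x. snd (f x) $ i) (at x) v)"
  using frechet_derivative_linear_comp[OF bounded_linear_fst assms, of v]
    frechet_derivative_linear_comp[OF bounded_linear_snd_nth assms, of _ v]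
  by (simp add: prod_eq_iff vec_eq_iff)

lemma smooth_on_jet:
  fixes f :: "'a::real_normed_vector \<Rightarrow> 'n::finite jet"
  assumes "smooth_on U (\<lambda>x. fst (f x))" "\<And>i. smooth_on U (\<lambda>x. snd (f x) $ i)"
  shows "smooth_on U f"
  using smooth_on_Pair[OF assms(1) smooth_on_vec[OF smooth_on_open[OF assms(1)], of "\<lambda>x. snd (f x)", OF assms(2)]]
  by simp

lemma smooth_on_fst [simp]: "open U \<Longrightarrow> smooth_on U (fst :: 'n::finite jet \<Rightarrow> real)"
  by (intro smooth_on_bounded_linear bounded_linear_fst)

lemma smooth_on_snd_nth [simp]: "open U \<Longrightarrow> smooth_on U (\<lambda>p :: 'n::finite jet. snd p $ i)"
  by (intro smooth_on_bounded_linear bounded_linear_snd_nth)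

lemma smooth_on_total_field: "smooth_on U F \<Longrightarrow> smooth_on U (total_field F)"
  unfolding total_field_def[abs_def]
proof (rule smooth_on_jet)
  assume F: "smooth_on U F"
  note U = smooth_on_open[OF F]
  show "smooth_on U (\<lambda>x. fst (1, \<chi> i. if pos i < CARD('a) - 1 then snd x $ idx (Suc (pos i)) else F x))"
    using U by simp
  show "smooth_on U (\<lambda>x. snd (1, \<chi> i. if pos i < CARD('a) - 1 then snd x $ idx (Suc (pos i)) else F x) $ i)" for i :: 'a
    using U F by (cases "pos i < CARD('a) - 1") simp_all
qed

lemma smooth_on_pd_y: "smooth_on U F \<Longrightarrow> smooth_on U (pd_y i F)"
  unfolding pd_y_def[abs_def] by (rule smooth_on_frechet)

lemma frechet_derivative_jet_expand:
  fixes G :: "'n::finite jet \<Rightarrow> real"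
  assumes "G differentiable (at p)"
  shows "frechet_derivative G (at p) (a, v) = a * pd_x G p + (\<Sum>k<CARD('n). v $ idx k * pd_y k G p)"
proof -
  have lin: "linear (frechet_derivative G (at p))" using assms by (rule linear_frechet_derivative)
  have v: "v = (\<Sum>i\<in>UNIV. v $ i *\<^sub>R axis i 1)"
    by (simp add: vec_eq_iff axis_def if_distrib cong: if_cong)
  have "(a, v) = a *\<^sub>R (1, 0) + (\<Sum>i\<in>UNIV. v $ i *\<^sub>R (0, axis i 1))"
    using v by (simp add: prod_eq_iff fst_sum snd_sum)
  then have "frechet_derivative G (at p) (a, v) = a *\<^sub>R frechet_derivative G (at p) (1, 0)
     + (\<Sum>i\<in>UNIV. v $ i *\<^sub>R frechet_derivative G (at p) (0, axis i 1))"
    by (simp only: linear_add[OF lin] linear_sum[OF lin] linear_cmul[OF lin])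
  also have "(\<Sum>i\<in>UNIV. v $ i *\<^sub>R frechet_derivative G (at p) (0, axis i 1))
     = (\<Sum>i\<in>(UNIV::'n set). v $ idx (pos i) *\<^sub>R frechet_derivative G (at p) (0, axis (idx (pos i)) 1))" by simp
  also have "\<dots> = (\<Sum>k<CARD('n). v $ idx k *\<^sub>R frechet_derivative G (at p) (0, axis (idx k) 1))"
    by (rule sum_idx)
  finally show ?thesis by (simp add: pd_x_def pd_y_def)
qed

lemma total_deriv_eq_lie:
  fixes G :: "'n::finite jet \<Rightarrow> real"
  assumes "G differentiable (at p)"
  shows "total_deriv F G p = lie (total_field F) G p"
proof -
  let ?n = "CARD('n)"
  have n: "?n > 0" by simp
  then obtain m where m: "?n = Suc m" using gr0_implies_Suc by blast
  have "lie (total_field F) G p = pd_x G p + (\<Sum>k<?n. (if k < ?n - 1 then snd p $ idx (Suc k) else F p) * pd_y k G p)"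
    unfolding lie_def total_field_def frechet_derivative_jet_expand[OF assms]
    by (auto intro!: sum.cong)
  also have "(\<Sum>k<?n. (if k < ?n - 1 then snd p $ idx (Suc k) else F p) * pd_y k G p)
     = (\<Sum>k<m. snd p $ idx (Suc k) * pd_y k G p) + F p * pd_y m G p"
    by (simp add: m)
  also have "(\<Sum>k<m. snd p $ idx (Suc k) * pd_y k G p) = (\<Sum>k=1..m. ycoord k p * pd_y (k - 1) G p)"
    unfolding ycoord_def by (rule sum.reindex_bij_witness[of _ "\<lambda>k. k - 1" Suc]) auto
  finally show ?thesis by (simp add: total_deriv_def m)
qed

lemma total_deriv_cong:
  assumes "open U" "p \<in> U" "\<And>y. y \<in> U \<Longrightarrow> f y = g y"
  shows "total_deriv F f p = total_deriv F g p"
  using frechet_derivative_cong_open[OF assms] by (simp add: total_deriv_def pd_x_def pd_y_def)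

lemma total_deriv_iter_eq_lie:
  fixes G :: "'n::finite jet \<Rightarrow> real"
  assumes F: "smooth_on U F" and G: "smooth_on U G" and p: "p \<in> U"
  shows "(total_deriv F ^^ k) G p = (lie (total_field F) ^^ k) G p"
  using p
proof (induction k arbitrary: p)
  case (Suc k)
  have "total_deriv F ((total_deriv F ^^ k) G) p = total_deriv F ((lie (total_field F) ^^ k) G) p"
    by (rule total_deriv_cong[OF smooth_on_open[OF F] Suc.prems Suc.IH])
  also have "\<dots> = lie (total_field F) ((lie (total_field F) ^^ k) G) p"
    by (rule total_deriv_eq_lie[OF smooth_on_differentiable_at[OF smooth_on_lie_iter[OF smooth_on_total_field[OF F] G] Suc.prems]])
  finally show ?case by simp
qed simp

lemma F_derivs_eq_coef_derivs:
  assumes F: "smooth_on U F" and p: "p \<in> U"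
  shows "F_derivs F p = coef_derivs (total_field F) (\<lambda>i. pd_y i F) p"
  using total_deriv_iter_eq_lie[OF F smooth_on_pd_y[OF F] p] by (auto simp: F_derivs_def coef_derivs_def)

lemma lie_total_field_fst: "lie (total_field F) fst p = 1"
  unfolding lie_def total_field_def
    frechet_derivative_at[OF bounded_linear_imp_has_derivative[OF bounded_linear_fst], symmetric] by simp

definition condition_poly :: "nat \<Rightarrow> nat \<Rightarrow> dpoly" where
  "condition_poly n k = dpoly_of (cond_exp n k)"

lemma satisfies_conditions_iff:
  fixes F :: "'n::finite jet \<Rightarrow> real"
  assumes F: "smooth_on U F"
  shows "satisfies_conditions (condition_poly CARD('n)) F U \<longleftrightarrow>
     (\<forall>k\<in>{1..CARD('n) - 2}. \<forall>p\<in>U. deval (coef_derivs (total_field F) (\<lambda>i. pd_y i F) p) (cond_exp CARD('n) k) = 0)"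
  using F_derivs_eq_coef_derivs[OF F] by (auto simp: satisfies_conditions_def condition_poly_def dpoly_eval_of)

lemma satisfies_conditions_iff_is_sympow:
  fixes F :: "'n::finite jet \<Rightarrow> real"
  assumes n: "2 \<le> CARD('n)" and F: "smooth_on U F"
  shows "satisfies_conditions (condition_poly CARD('n)) F U \<longleftrightarrow> is_sympow CARD('n) U (total_field F) (\<lambda>i. pd_y i F)"
  unfolding satisfies_conditions_iff[OF F]
  by (rule conditions_iff_is_sympow[OF n smooth_on_total_field[OF F] smooth_on_pd_y[OF F], of fst])
    (simp_all add: smooth_on_open[OF F] lie_total_field_fst)

text \<open>
  The conditions can be pulled back along a map which relates two vector fields.
\<close>

lemma coef_derivs_related:
  fixes \<Phi> :: "'a::euclidean_space \<Rightarrow> 'b::euclidean_space"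
  assumes "smooth_on U \<Phi>" "\<Phi> ` U \<subseteq> V" "smooth_on V \<zeta>" "\<And>i. smooth_on V (f i)"
    "\<And>x. x \<in> U \<Longrightarrow> frechet_derivative \<Phi> (at x) (\<xi> x) = \<zeta> (\<Phi> x)" "x \<in> U"
  shows "coef_derivs \<xi> (\<lambda>i x. f i (\<Phi> x)) x = coef_derivs \<zeta> f (\<Phi> x)"
proof -
  have "(lie \<xi> ^^ j) (\<lambda>x. f i (\<Phi> x)) x = (lie \<zeta> ^^ j) (f i) (\<Phi> x)" for i j
    by (rule lie_iter_compose[where U = U and V = V]) (use assms in auto)
  then show ?thesis by (auto simp: coef_derivs_def)
qed

section \<open>Point transformations\<close>

lemma lie_vertical:
  fixes G :: "'n::finite jet \<Rightarrow> real"
  assumes "G differentiable (at p)"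
  shows "lie (\<lambda>p. (0, \<chi> i. h (pos i) p)) G p = (\<Sum>k<CARD('n). h k p * pd_y k G p)"
  unfolding lie_def frechet_derivative_jet_expand[OF assms] by (auto intro!: sum.cong)

text \<open>
  The infinitesimal change of jets induced by the change \<open>\<eta>\<close> of \<open>y\<close> at fixed \<open>x\<close>.
\<close>

definition prolonged_vertical :: "('n::finite jet \<Rightarrow> real) \<Rightarrow> ('n jet \<Rightarrow> real) \<Rightarrow> 'n jet \<Rightarrow> 'n jet" where
  "prolonged_vertical F \<eta> p = (0, \<chi> i. (lie (total_field F) ^^ pos i) \<eta> p)"

lemma smooth_on_prolonged_vertical:
  assumes F: "smooth_on U F" and \<eta>: "smooth_on U \<eta>"
  shows "smooth_on U (prolonged_vertical F \<eta>)"
  unfolding prolonged_vertical_def[abs_def]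
  by (rule smooth_on_jet) (simp_all add: smooth_on_open[OF F] smooth_on_lie_iter[OF smooth_on_total_field[OF F] \<eta>])

text \<open>
  By construction, the components of the bracket vanish except for the last one. There the
  \<open>n\<close>-th derivative of \<open>\<eta>\<close> meets the derivative of \<open>F\<close> along the vertical field, and their difference is
  the linearised operator applied to \<open>\<eta>\<close>.
\<close>

lemma commutator_prolonged_vertical:
  fixes F :: "'n::finite jet \<Rightarrow> real"
  assumes F: "smooth_on U F" and \<eta>: "smooth_on U \<eta>" and g: "smooth_on U g" and p: "p \<in> U"
  shows "lie (total_field F) (lie (prolonged_vertical F \<eta>) g) p - lie (prolonged_vertical F \<eta>) (lie (total_field F) g) p
    = lin_op (total_field F) CARD('n) (\<lambda>i. pd_y i F) \<eta> p * pd_y (CARD('n) - 1) g p"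
proof -
  let ?X = "total_field F" and ?V = "prolonged_vertical F \<eta>" and ?n = "CARD('n)"
  have n: "?n > 0" by simp
  have X: "smooth_on U ?X" using F by (rule smooth_on_total_field)
  have V: "smooth_on U ?V" using F \<eta> by (rule smooth_on_prolonged_vertical)
  have dV: "frechet_derivative ?V (at p) (?X p) = (0, \<chi> i. (lie ?X ^^ Suc (pos i)) \<eta> p)"
    unfolding frechet_derivative_jet[OF smooth_on_differentiable_at[OF V p]]
    by (simp add: prolonged_vertical_def lie_def)
  have VF: "frechet_derivative F (at p) (?V p) = (\<Sum>k<?n. (lie ?X ^^ k) \<eta> p * pd_y k F p)"
    using lie_vertical[OF smooth_on_differentiable_at[OF F p], of "\<lambda>k. (lie ?X ^^ k) \<eta>"]
    by (simp add: lie_def prolonged_vertical_def)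
  have dX: "frechet_derivative ?X (at p) (?V p) =
    (0, \<chi> i. if pos i < ?n - 1 then (lie ?X ^^ Suc (pos i)) \<eta> p else frechet_derivative F (at p) (?V p))"
  proof -
    have "frechet_derivative (\<lambda>x. snd (?X x) $ i) (at p) (?V p) =
       (if pos i < ?n - 1 then (lie ?X ^^ Suc (pos i)) \<eta> p else frechet_derivative F (at p) (?V p))" for i
    proof (cases "pos i < ?n - 1")
      case True
      have "frechet_derivative (\<lambda>x :: 'n jet. snd x $ idx (Suc (pos i))) (at p) = (\<lambda>x. snd x $ idx (Suc (pos i)))"
        using frechet_derivative_at[OF bounded_linear_imp_has_derivative[OF bounded_linear_snd_nth]] by metis
      then show ?thesis using True by (simp add: total_field_def prolonged_vertical_def)
    next
      case False
      then show ?thesis by (simp add: total_field_def)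
    qed
    moreover have "frechet_derivative (\<lambda>x. fst (?X x)) (at p) (?V p) = 0" by (simp add: total_field_def)
    ultimately show ?thesis
      unfolding frechet_derivative_jet[OF smooth_on_differentiable_at[OF X p]] by simp
  qed
  have L: "lin_op ?X ?n (\<lambda>i. pd_y i F) \<eta> p = (lie ?X ^^ ?n) \<eta> p - frechet_derivative F (at p) (?V p)"
    unfolding lin_op_def VF by (simp add: mult.commute)
  have "frechet_derivative ?V (at p) (?X p) - frechet_derivative ?X (at p) (?V p)
     = (0, \<chi> i. if pos i = ?n - 1 then lin_op ?X ?n (\<lambda>i. pd_y i F) \<eta> p else 0)"
  proof -
    have "Suc (?n - 1) = ?n" using n by simp
    moreover have "pos i = ?n - 1" if "\<not> pos i < ?n - 1" for i :: 'n
      using pos_less[of i] that by linarith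
    ultimately show ?thesis unfolding dV dX L
      by (auto simp: prod_eq_iff vec_eq_iff simp del: funpow.simps)
  qed
  then have "lie ?X (lie ?V g) p - lie ?V (lie ?X g) p
    = (\<Sum>k<?n. (if k = ?n - 1 then lin_op ?X ?n (\<lambda>i. pd_y i F) \<eta> p else 0) * pd_y k g p)"
    unfolding lie_commutator[OF g X V p]
    by (simp add: frechet_derivative_jet_expand[OF smooth_on_differentiable_at[OF g p]] cong: sum.cong_simp)
  also have "\<dots> = lin_op ?X ?n (\<lambda>i. pd_y i F) \<eta> p * pd_y (?n - 1) g p"
  proof -
    have "(\<Sum>k<?n. (if k = ?n - 1 then lin_op ?X ?n (\<lambda>i. pd_y i F) \<eta> p else 0) * pd_y k g p)
      = (\<Sum>k<?n. if k = ?n - 1 then lin_op ?X ?n (\<lambda>i. pd_y i F) \<eta> p * pd_y (?n - 1) g p else 0)"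
      by (intro sum.cong) auto
    then show ?thesis using n by simp
  qed
  finally show ?thesis .
qed

text \<open>
  On \<open>U\<close> the function depends, infinitesimally, only on \<open>x, y, \<dots>, y^(k)\<close>.
\<close>

definition jet_order :: "'n::finite jet set \<Rightarrow> nat \<Rightarrow> ('n jet \<Rightarrow> real) \<Rightarrow> bool" where
  "jet_order U k g \<longleftrightarrow> (\<forall>p\<in>U. \<forall>j. k < j \<and> j < CARD('n) \<longrightarrow> pd_y j g p = 0)"

lemma pd_y_eq_lie: "pd_y j g = lie (\<lambda>p. (0, axis (idx j) 1)) g"
  by (rule ext) (simp add: pd_y_def lie_def)

text \<open>
  The bracket of the coordinate field of \<open>y^(j)\<close> with the total derivative contains the preceding
  coordinate field, since \<open>y^(j)\<close> is the coefficient there, and a multiple of the last one.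
\<close>

lemma pd_y_lie_total_field:
  fixes F :: "'n::finite jet \<Rightarrow> real"
  assumes F: "smooth_on U F" and g: "smooth_on U g" and p: "p \<in> U" and j: "1 \<le> j" "j < CARD('n)"
  shows "pd_y j (lie (total_field F) g) p
    = lie (total_field F) (pd_y j g) p + pd_y (j - 1) g p + pd_y j F p * pd_y (CARD('n) - 1) g p"
proof -
  let ?X = "total_field F" and ?n = "CARD('n)" and ?E = "\<lambda>p :: 'n jet. (0, axis (idx j) 1) :: 'n jet"
  have U: "open U" using F by (rule smooth_on_open)
  have X: "smooth_on U ?X" using F by (rule smooth_on_total_field)
  have E: "smooth_on U ?E" using U by simp
  have gd: "g differentiable (at p)" using g p by (rule smooth_on_differentiable_at)
  have dX: "frechet_derivative ?X (at p) (0, axis (idx j) 1) =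
    (0, \<chi> i. (if pos i = j - 1 then 1 else 0) + (if pos i = ?n - 1 then pd_y j F p else 0))"
  proof -
    have "frechet_derivative (\<lambda>x. snd (?X x) $ i) (at p) (0, axis (idx j) 1) =
       (if pos i = j - 1 then 1 else 0) + (if pos i = ?n - 1 then pd_y j F p else 0)" for i :: 'n
    proof (cases "pos i < ?n - 1")
      case True
      have "frechet_derivative (\<lambda>x :: 'n jet. snd x $ idx (Suc (pos i))) (at p) = (\<lambda>x. snd x $ idx (Suc (pos i)))"
        using frechet_derivative_at[OF bounded_linear_imp_has_derivative[OF bounded_linear_snd_nth]] by metis
      moreover have "(idx (Suc (pos i)) :: 'n) = idx j \<longleftrightarrow> pos i = j - 1"
        using True j by (subst idx_eq_iff) auto
      ultimately show ?thesis using True by (auto simp: total_field_def axis_def)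
    next
      case False
      then have "pos i = ?n - 1" "pos i \<noteq> j - 1" using pos_less[of i] j by auto
      then show ?thesis using False by (simp add: total_field_def pd_y_def)
    qed
    moreover have "frechet_derivative (\<lambda>x. fst (?X x)) (at p) (0, axis (idx j) 1) = 0" by (simp add: total_field_def)
    ultimately show ?thesis
      unfolding frechet_derivative_jet[OF smooth_on_differentiable_at[OF X p]] by simp
  qed
  have "frechet_derivative ?X (at p) (?E p) - frechet_derivative ?E (at p) (?X p) = frechet_derivative ?X (at p) (?E p)"
    by simp
  then have "lie ?E (lie ?X g) p - lie ?X (lie ?E g) p = frechet_derivative g (at p) (frechet_derivative ?X (at p) (?E p))"
    using lie_commutator[OF g E X p] by simp
  also have "\<dots> = (\<Sum>k<?n. ((if k = j - 1 then 1 else 0) + (if k = ?n - 1 then pd_y j F p else 0)) * pd_y k g p)"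
    unfolding dX frechet_derivative_jet_expand[OF gd] by (auto intro!: sum.cong)
  also have "\<dots> = (\<Sum>k<?n. (if k = j - 1 then pd_y k g p else 0)) + (\<Sum>k<?n. (if k = ?n - 1 then pd_y j F p * pd_y k g p else 0))"
    unfolding sum.distrib[symmetric] by (intro sum.cong) (auto simp: algebra_simps)
  also have "\<dots> = pd_y (j - 1) g p + pd_y j F p * pd_y (?n - 1) g p"
    using j by simp
  finally show ?thesis by (simp add: pd_y_eq_lie[of j g] pd_y_eq_lie[of j "lie (total_field F) g"])
qed

lemma jet_order_lie_total_field:
  fixes F :: "'n::finite jet \<Rightarrow> real"
  assumes F: "smooth_on U F" and g: "smooth_on U g" "jet_order U k g"
  shows "jet_order U (Suc k) (lie (total_field F) g)"
  unfolding jet_order_def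
proof (intro ballI allI impI)
  fix p j assume p: "p \<in> U" and j: "Suc k < j \<and> j < CARD('n)"
  have 0: "pd_y i g p = 0" if "p \<in> U" "k < i" "i < CARD('n)" for p i
    using g(2) that unfolding jet_order_def by blast
  have "lie (total_field F) (pd_y j g) p = lie (total_field F) (\<lambda>p. 0) p"
    by (rule lie_cong[OF smooth_on_open[OF F] p]) (use 0 j in auto)
  moreover have "1 \<le> j" "j < CARD('n)" "k < j - 1" "j - 1 < CARD('n)" "k < CARD('n) - 1" "CARD('n) - 1 < CARD('n)"
    using j by auto
  ultimately show "pd_y j (lie (total_field F) g) p = 0"
    using pd_y_lie_total_field[OF F g(1) p, of j] 0[OF p, of "j - 1"] 0[OF p, of "CARD('n) - 1"] j by simp
qed

lemma jet_order_divide: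
  fixes g h :: "'n::finite jet \<Rightarrow> real"
  assumes g: "smooth_on U g" "jet_order U k g" and h: "smooth_on U h" "jet_order U k h"
    "\<And>p. p \<in> U \<Longrightarrow> h p \<noteq> 0"
  shows "jet_order U k (\<lambda>p. g p / h p)"
  unfolding jet_order_def
proof (intro ballI allI impI)
  fix p j assume p: "p \<in> U" and j: "k < j \<and> j < CARD('n)"
  have s: "smooth_on U (\<lambda>p. g p / h p)" using g h by (intro smooth_on_divide)
  have "pd_y j g p = pd_y j (\<lambda>p. g p / h p * h p) p"
    unfolding pd_y_eq_lie by (rule lie_cong[OF smooth_on_open[OF g(1)] p]) (simp add: h(3))
  also have "\<dots> = pd_y j (\<lambda>p. g p / h p) p * h p + g p / h p * pd_y j h p"
    unfolding pd_y_eq_lie by (rule lie_mult[OF s h(1) p])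
  finally have "pd_y j (\<lambda>p. g p / h p) p * h p = 0"
    using g(2) h(2) p j unfolding jet_order_def by simp
  then show "pd_y j (\<lambda>p. g p / h p) p = 0" using h(3)[OF p] by simp
qed

lemma jet_order_mono: "jet_order U k g \<Longrightarrow> k \<le> l \<Longrightarrow> jet_order U l g"
  unfolding jet_order_def by auto

lemma jet_order_cong:
  assumes "open U" "jet_order U k g" "\<And>p. p \<in> U \<Longrightarrow> g p = h p"
  shows "jet_order U k h"
  unfolding jet_order_def
proof (intro ballI allI impI)
  fix p j assume p: "p \<in> U" and j: "k < j \<and> j < CARD('a)"
  have "pd_y j h p = pd_y j g p"
    unfolding pd_y_eq_lie by (rule lie_cong[OF assms(1) p]) (simp add: assms(3))
  then show "pd_y j h p = 0" using assms(2) p j by (simp add: jet_order_def)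
qed

lemma bounded_linear_jet_base: "bounded_linear (jet_base :: 'n::finite jet \<Rightarrow> real \<times> real)"
  unfolding jet_base_def[abs_def] ycoord_def
  by (intro bounded_linear_Pair bounded_linear_fst bounded_linear_snd_nth)

lemma jet_order_base:
  fixes h :: "real \<times> real \<Rightarrow> real"
  assumes h: "smooth_on W h" and U: "open U" "jet_base ` U \<subseteq> W"
  shows "smooth_on U (\<lambda>p :: 'n::finite jet. h (jet_base p))" "jet_order U 0 (\<lambda>p :: 'n jet. h (jet_base p))"
proof -
  have jb: "smooth_on U (jet_base :: 'n jet \<Rightarrow> _)" by (rule smooth_on_bounded_linear[OF bounded_linear_jet_base U(1)])
  show "smooth_on U (\<lambda>p :: 'n jet. h (jet_base p))" by (rule smooth_on_compose[OF jb h U(2)])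
  have D: "frechet_derivative (jet_base :: 'n jet \<Rightarrow> _) (at p) = jet_base" for p
    using frechet_derivative_at[OF bounded_linear_imp_has_derivative[OF bounded_linear_jet_base]] by metis
  show "jet_order U 0 (\<lambda>p :: 'n jet. h (jet_base p))"
    unfolding jet_order_def
  proof (intro ballI allI impI)
    fix p :: "'n jet" and j assume p: "p \<in> U" and j: "0 < j \<and> j < CARD('n)"
    have hd: "h differentiable (at (jet_base p))" using smooth_on_differentiable_at[OF h] U(2) p by blast
    have "(idx 0 :: 'n) \<noteq> idx j" using j by (subst idx_eq_iff) auto
    then have "jet_base (0, axis (idx j) 1 :: real ^ 'n) = 0"
      by (simp add: jet_base_def ycoord_def axis_def zero_prod_def)
    then have "pd_y j (\<lambda>p. h (jet_base p)) p = frechet_derivative h (at (jet_base p)) 0"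
      using frechet_derivative_compose[OF smooth_on_differentiable_at[OF jb p] hd] by (simp add: pd_y_def o_def D)
    then show "pd_y j (\<lambda>p. h (jet_base p)) p = 0"
      using linear_0[OF linear_frechet_derivative[OF hd]] by simp
  qed
qed

lemma diffeomorphism_injective_derivative:
  fixes \<psi> :: "'a::euclidean_space \<Rightarrow> 'b::euclidean_space"
  assumes \<psi>: "diffeomorphism W W' \<psi>" and x: "x \<in> W" and v: "frechet_derivative \<psi> (at x) v = 0"
  shows "v = 0"
proof -
  let ?i = "inv_into W \<psi>"
  have b: "bij_betw \<psi> W W'" and s: "smooth_on W \<psi>" "smooth_on W' ?i" using \<psi> by (auto simp: diffeomorphism_def)
  have y: "\<psi> x \<in> W'" using b x by (auto dest: bij_betwE)
  have d: "\<psi> differentiable (at x)" "?i differentiable (at (\<psi> x))"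
    using smooth_on_differentiable_at[OF s(1) x] smooth_on_differentiable_at[OF s(2) y] by auto
  have "v = frechet_derivative (\<lambda>y. y) (at x) v" by simp
  also have "\<dots> = frechet_derivative (\<lambda>y. ?i (\<psi> y)) (at x) v"
  proof -
    have "frechet_derivative (\<lambda>y. y) (at x) = frechet_derivative (\<lambda>y. ?i (\<psi> y)) (at x)"
      by (rule frechet_derivative_cong_open[OF smooth_on_open[OF s(1)] x])
        (simp add: bij_betw_inv_into_left[OF b])
    then show ?thesis by (rule fun_cong)
  qed
  also have "\<dots> = frechet_derivative ?i (at (\<psi> x)) (frechet_derivative \<psi> (at x) v)"
    using frechet_derivative_compose[OF d] by (simp add: o_def)
  also have "\<dots> = 0" unfolding v by (rule linear_0[OF linear_frechet_derivative[OF d(2)]])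
  finally show ?thesis .
qed

text \<open>
  Functions and fields that belong to the transformed equation are pulled back to \<open>U\<close> along the
  prolongation, so that the two equations are compared on \<open>U\<close>.
\<close>

locale point_transformation =
  fixes F F' :: "'n::finite jet \<Rightarrow> real" and U U' and \<psi> and W W' :: "(real \<times> real) set"
  assumes order: "2 \<le> CARD('n)" and F: "smooth_on U F" and F': "smooth_on U' F'"
    and \<psi>: "diffeomorphism W W' \<psi>" and base: "jet_base ` U \<subseteq> W"
    and parameter: "\<And>p. p \<in> U \<Longrightarrow> total_deriv F (\<lambda>p. fst (\<psi> (jet_base p))) p \<noteq> 0"
    and image: "U' = prolong F \<psi> ` U"
    and F'_prolong: "\<And>p. p \<in> U \<Longrightarrow> F' (prolong F \<psi> p) = prolonged_deriv F \<psi> CARD('n) p"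
begin

definition new_x :: "'n jet \<Rightarrow> real" where "new_x p = fst (\<psi> (jet_base p))"

definition new_y :: "nat \<Rightarrow> 'n jet \<Rightarrow> real" where "new_y = prolonged_deriv F \<psi>"

definition dilation :: "'n jet \<Rightarrow> real" where "dilation = lie (total_field F) new_x"

definition new_field :: "'n jet \<Rightarrow> 'n jet" where
  "new_field p = inverse (dilation p) *\<^sub>R total_field F p"

definition new_coef :: "nat \<Rightarrow> 'n jet \<Rightarrow> real" where
  "new_coef k p = pd_y k F' (prolong F \<psi> p)"

text \<open>
  A variation \<open>\<eta>\<close> of \<open>y\<close> at fixed \<open>x\<close> becomes the variation \<open>multiplier * \<eta>\<close> of the new dependent variable
  at a fixed value of the new independent variable.
\<close>

definition multiplier :: "'n jet \<Rightarrow> real" where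
  "multiplier p = pd_y 0 (new_y 0) p - pd_y 0 new_x p * new_y 1 p"

text \<open>
  The prolonged vertical field, corrected by a multiple of the new total derivative such that the new
  independent variable becomes constant along it.
\<close>

definition vertical_part :: "('n jet \<Rightarrow> real) \<Rightarrow> ('n jet \<Rightarrow> real) \<Rightarrow> 'n jet \<Rightarrow> real" where
  "vertical_part \<eta> g p = lie (prolonged_vertical F \<eta>) g p
     - lie (prolonged_vertical F \<eta>) new_x p * lie new_field g p"

lemma U: "open U"
  using F by (rule smooth_on_open)

lemma total_field_smooth: "smooth_on U (total_field F)"
  using F by (rule smooth_on_total_field)

lemma new_x: "smooth_on U new_x" "jet_order U 0 new_x"
  and new_y_0: "smooth_on U (new_y 0)" "jet_order U 0 (new_y 0)"
proof -
  have \<psi>s: "smooth_on W \<psi>" using \<psi> by (simp add: diffeomorphism_def)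
  have "smooth_on W (\<lambda>z. fst (\<psi> z))" "smooth_on W (\<lambda>z. snd (\<psi> z))"
    using smooth_on_compose[OF \<psi>s smooth_on_bounded_linear[OF bounded_linear_fst open_UNIV]]
      smooth_on_compose[OF \<psi>s smooth_on_bounded_linear[OF bounded_linear_snd open_UNIV]] by auto
  then show "smooth_on U new_x" "jet_order U 0 new_x" "smooth_on U (new_y 0)" "jet_order U 0 (new_y 0)"
    unfolding new_x_def[abs_def] new_y_def using jet_order_base[OF _ U base] by auto
qed

lemma dilation: "smooth_on U dilation" "jet_order U (Suc 0) dilation"
  unfolding dilation_def
  using smooth_on_lie[OF total_field_smooth new_x(1)] jet_order_lie_total_field[OF F new_x] by auto

lemma total_deriv_new_x: "p \<in> U \<Longrightarrow> total_deriv F (\<lambda>p. fst (\<psi> (jet_base p))) p = dilation p"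
  using total_deriv_eq_lie[OF smooth_on_differentiable_at[OF new_x(1)], of p F]
  by (simp add: dilation_def new_x_def[abs_def])

lemma dilation_nonzero: "p \<in> U \<Longrightarrow> dilation p \<noteq> 0"
  using parameter total_deriv_new_x by simp

lemma new_y_Suc:
  assumes "smooth_on U (new_y k)" "p \<in> U"
  shows "new_y (Suc k) p = lie (total_field F) (new_y k) p / dilation p"
  using total_deriv_eq_lie[OF smooth_on_differentiable_at[OF assms], of F] total_deriv_new_x[OF assms(2)]
  by (simp add: new_y_def)

lemma new_y: "smooth_on U (new_y k) \<and> jet_order U k (new_y k)"
proof (induction k)
  case (Suc k)
  let ?q = "\<lambda>p. lie (total_field F) (new_y k) p / dilation p"
  have l: "smooth_on U (lie (total_field F) (new_y k))" "jet_order U (Suc k) (lie (total_field F) (new_y k))"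
    using Suc smooth_on_lie[OF total_field_smooth, of "new_y k"] jet_order_lie_total_field[OF F, of "new_y k" k]
    by simp_all
  have "smooth_on U ?q"
    by (rule smooth_on_divide[OF l(1) dilation(1) dilation_nonzero], assumption)
  moreover have "jet_order U (Suc k) ?q"
    by (rule jet_order_divide[OF l dilation(1) jet_order_mono[OF dilation(2)] dilation_nonzero]) simp_all
  moreover have "?q p = new_y (Suc k) p" if "p \<in> U" for p
    using new_y_Suc[OF _ that, of k] Suc by simp
  ultimately show ?case
    using smooth_on_cong[of U ?q "new_y (Suc k)"] jet_order_cong[OF U, of "Suc k" ?q "new_y (Suc k)"] by blast
qed (use new_y_0 in simp)

lemma new_y_smooth: "smooth_on U (new_y k)"
  using new_y by blast

lemma lie_new_field:
  assumes "smooth_on U g" "p \<in> U"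
  shows "lie new_field g p = inverse (dilation p) * lie (total_field F) g p"
  unfolding new_field_def[abs_def] by (rule lie_scale[OF assms])

lemma new_field_smooth: "smooth_on U new_field"
  unfolding new_field_def[abs_def]
  using smooth_on_inverse[OF dilation(1) dilation_nonzero] total_field_smooth by (rule smooth_on_scaleR)

lemma lie_new_field_new_x: "p \<in> U \<Longrightarrow> lie new_field new_x p = 1"
  using lie_new_field[OF new_x(1)] dilation_nonzero by (simp add: dilation_def)

lemma lie_new_field_new_y: "p \<in> U \<Longrightarrow> lie new_field (new_y k) p = new_y (Suc k) p"
  using lie_new_field[OF new_y_smooth] new_y_Suc[OF new_y_smooth] by (simp add: divide_inverse mult.commute)

lemma prolong_eq: "prolong F \<psi> p = (new_x p, \<chi> i. new_y (pos i) p)"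
  by (simp add: prolong_def new_x_def new_y_def)

lemma prolong_smooth: "smooth_on U (prolong F \<psi>)"
  by (rule smooth_on_jet) (simp_all add: prolong_eq new_x new_y_smooth)

lemma prolong_into: "prolong F \<psi> ` U \<subseteq> U'"
  by (simp add: image)

lemma frechet_derivative_prolong:
  assumes "p \<in> U"
  shows "frechet_derivative (prolong F \<psi>) (at p) v
    = (frechet_derivative new_x (at p) v, \<chi> i. frechet_derivative (new_y (pos i)) (at p) v)"
  using frechet_derivative_jet[OF smooth_on_differentiable_at[OF prolong_smooth assms], of v]
  by (simp add: prolong_eq)

lemma new_y_top: "p \<in> U \<Longrightarrow> new_y CARD('n) p = F' (prolong F \<psi> p)"
  using F'_prolong by (simp add: new_y_def)

lemma prolong_related:
  assumes p: "p \<in> U"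
  shows "frechet_derivative (prolong F \<psi>) (at p) (new_field p) = total_field F' (prolong F \<psi> p)"
proof -
  let ?q = "prolong F \<psi> p" and ?n = "CARD('n)"
  have "new_y (Suc (pos i)) p = (if pos i < ?n - 1 then snd ?q $ idx (Suc (pos i)) else F' ?q)" for i :: 'n
  proof (cases "pos i < ?n - 1")
    case False
    then have "Suc (pos i) = ?n" using pos_less[of i] by linarith
    then show ?thesis using False new_y_top[OF p] by simp
  qed (simp add: prolong_eq)
  then show ?thesis
    unfolding frechet_derivative_prolong[OF p] total_field_def
    using lie_new_field_new_x[OF p] lie_new_field_new_y[OF p] by (simp add: lie_def)
qed

lemma new_coef_smooth: "smooth_on U (new_coef k)"
  unfolding new_coef_def[abs_def]
  by (rule smooth_on_compose[OF prolong_smooth smooth_on_pd_y[OF F'] prolong_into])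

lemma multiplier_smooth: "smooth_on U multiplier"
  unfolding multiplier_def[abs_def]
  by (intro smooth_on_diff smooth_on_mult smooth_on_pd_y new_y_smooth new_x)

text \<open>
  Multiplied by the dilation, it is the Jacobian determinant of \<open>\<psi>\<close>, written in the basis of the
  total derivative and the vertical direction at the base point.
\<close>

lemma multiplier_nonzero:
  assumes p: "p \<in> U"
  shows "multiplier p \<noteq> 0"
proof
  assume \<mu>: "multiplier p = 0"
  let ?D = "frechet_derivative \<psi> (at (jet_base p))"
  have jp: "jet_base p \<in> W" using base p by blast
  have \<psi>d: "\<psi> differentiable (at (jet_base p))"
    using \<psi> jp smooth_on_differentiable_at by (auto simp: diffeomorphism_def)
  have lin: "linear ?D" using \<psi>d by (rule linear_frechet_derivative)
  have jbd: "(jet_base :: 'n jet \<Rightarrow> _) differentiable (at p)"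
    by (rule bounded_linear_imp_differentiable[OF bounded_linear_jet_base])
  have Djb: "frechet_derivative (jet_base :: 'n jet \<Rightarrow> _) (at p) = jet_base"
    using frechet_derivative_at[OF bounded_linear_imp_has_derivative[OF bounded_linear_jet_base]] by metis
  have cd: "(\<lambda>p :: 'n jet. \<psi> (jet_base p)) differentiable (at p)"
    using differentiable_chain_at[OF jbd \<psi>d] by (simp add: o_def)
  have D: "frechet_derivative new_x (at p) v = fst (?D (jet_base v))"
    "frechet_derivative (new_y 0) (at p) v = snd (?D (jet_base v))" for v
    using frechet_derivative_compose[OF jbd \<psi>d]
      frechet_derivative_linear_comp[OF bounded_linear_fst cd, of v]
      frechet_derivative_linear_comp[OF bounded_linear_snd cd, of v]
    by (simp_all add: new_x_def[abs_def] new_y_def o_def Djb)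
  define a where "a = jet_base (total_field F p)"
  define b where "b = jet_base (0, axis (idx 0) 1 :: real ^ 'n)"
  have a1: "fst a = 1" by (simp add: a_def jet_base_def total_field_def)
  have b1: "fst b = 0" "b \<noteq> 0" by (auto simp: b_def jet_base_def ycoord_def axis_def zero_prod_def)
  have Da: "?D a = (dilation p, lie (total_field F) (new_y 0) p)"
    by (simp add: prod_eq_iff a_def dilation_def lie_def D)
  have Db: "?D b = (pd_y 0 new_x p, pd_y 0 (new_y 0) p)"
    by (simp add: prod_eq_iff b_def pd_y_def D)
  have y1: "dilation p * new_y 1 p = lie (total_field F) (new_y 0) p"
    using new_y_Suc[OF new_y_smooth p, of 0] dilation_nonzero[OF p] by simp
  have "?D (dilation p *\<^sub>R b - pd_y 0 new_x p *\<^sub>R a) = dilation p *\<^sub>R ?D b - pd_y 0 new_x p *\<^sub>R ?D a"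
    by (simp add: linear_diff[OF lin] linear_cmul[OF lin])
  also have "\<dots> = (0, dilation p * multiplier p)"
    unfolding Da Db by (simp add: multiplier_def y1[symmetric] algebra_simps)
  also have "\<dots> = 0" using \<mu> by (simp add: zero_prod_def)
  finally have z: "dilation p *\<^sub>R b - pd_y 0 new_x p *\<^sub>R a = 0"
    by (rule diffeomorphism_injective_derivative[OF \<psi> jp])
  from arg_cong[OF z, of fst] have "pd_y 0 new_x p = 0" using a1 b1 by simp
  then show False using z b1 dilation_nonzero[OF p] by simp
qed

text \<open>
  The corrected field commutes with the new total derivative up to the bracket of the original fields;
  the terms with the derivative of the dilation cancel because the new independent variable depends
  only on the base point.
\<close>

lemma lie_new_field_vertical_part:
  assumes \<eta>: "smooth_on U \<eta>" and g: "smooth_on U g" and p: "p \<in> U"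
  shows "lie new_field (vertical_part \<eta> g) p = vertical_part \<eta> (lie new_field g) p
    + inverse (dilation p) * lin_op (total_field F) CARD('n) (\<lambda>i. pd_y i F) \<eta> p * pd_y (CARD('n) - 1) g p"
proof -
  let ?X = "total_field F" and ?V = "prolonged_vertical F \<eta>" and ?n = "CARD('n)"
  define L where "L = lin_op ?X ?n (\<lambda>i. pd_y i F) \<eta>"
  have V: "smooth_on U ?V" using F \<eta> by (rule smooth_on_prolonged_vertical)
  have gs: "smooth_on U (lie new_field g)" using new_field_smooth g by (rule smooth_on_lie)
  have sV: "smooth_on U (lie ?V new_x)" "smooth_on U (lie ?V g)" using V new_x g by auto
  have 1: "lie new_field (vertical_part \<eta> g) p = inverse (dilation p) * lie ?X (lie ?V g) p
    - (inverse (dilation p) * lie ?X (lie ?V new_x) p * lie new_field g p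
       + lie ?V new_x p * lie new_field (lie new_field g) p)"
    unfolding vertical_part_def[abs_def]
    using lie_diff[OF sV(2) smooth_on_mult[OF sV(1) gs] p, of new_field] lie_mult[OF sV(1) gs p, of new_field]
      lie_new_field[OF sV(1) p] lie_new_field[OF sV(2) p] by simp
  have c1: "lie ?X (lie ?V g) p = lie ?V (lie ?X g) p + L p * pd_y (?n - 1) g p"
    using commutator_prolonged_vertical[OF F \<eta> g p] by (simp add: L_def)
  have "pd_y (?n - 1) new_x p = 0" using new_x(2) order p unfolding jet_order_def by auto
  then have c2: "lie ?X (lie ?V new_x) p = lie ?V dilation p"
    using commutator_prolonged_vertical[OF F \<eta> new_x(1) p] by (simp add: dilation_def)
  have "lie ?V (lie ?X g) p = lie ?V (\<lambda>p. dilation p * lie new_field g p) p"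
    by (rule lie_cong[OF U p]) (simp add: lie_new_field[OF g] dilation_nonzero)
  also have "\<dots> = lie ?V dilation p * lie new_field g p + dilation p * lie ?V (lie new_field g) p"
    by (rule lie_mult[OF dilation(1) gs p])
  finally have c3: "lie ?V (lie ?X g) p
    = lie ?V dilation p * lie new_field g p + dilation p * lie ?V (lie new_field g) p" .
  have 2: "vertical_part \<eta> (lie new_field g) p
    = lie ?V (lie new_field g) p - lie ?V new_x p * lie new_field (lie new_field g) p"
    by (simp add: vertical_part_def)
  show ?thesis
    unfolding 1 2 c1 c2 c3 L_def[symmetric] using dilation_nonzero[OF p] by (simp add: field_simps)
qed

lemma vertical_part_cong:
  assumes "p \<in> U" "\<And>q. q \<in> U \<Longrightarrow> g q = h q"
  shows "vertical_part \<eta> g p = vertical_part \<eta> h p"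
  unfolding vertical_part_def using lie_cong[OF U assms] by simp

text \<open>
  Thus the corrected field is, in the new jet coordinates, again a prolonged vertical field.
\<close>

lemma vertical_part_new_y:
  assumes \<eta>: "smooth_on U \<eta>" and k: "k < CARD('n)" and p: "p \<in> U"
  shows "vertical_part \<eta> (new_y k) p = (lie new_field ^^ k) (\<lambda>p. multiplier p * \<eta> p) p"
  using k p
proof (induction k arbitrary: p)
  case 0
  let ?X = "total_field F" and ?V = "prolonged_vertical F \<eta>" and ?n = "CARD('n)"
  have V0: "lie ?V g p = \<eta> p * pd_y 0 g p" if g: "smooth_on U g" "jet_order U 0 g" for g
  proof -
    have "lie ?V g p = (\<Sum>k<?n. (lie ?X ^^ k) \<eta> p * pd_y k g p)"
      using lie_vertical[OF smooth_on_differentiable_at[OF g(1) 0(2)], of "\<lambda>k. (lie ?X ^^ k) \<eta>"]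
      by (simp add: prolonged_vertical_def[abs_def])
    also have "\<dots> = (\<Sum>k<?n. if k = 0 then \<eta> p * pd_y 0 g p else 0)"
      using g(2) 0(2) unfolding jet_order_def by (intro sum.cong) auto
    finally show ?thesis using order by simp
  qed
  show ?case
    using V0[OF new_y_0] V0[OF new_x] lie_new_field_new_y[OF 0(2), of 0]
    by (simp add: vertical_part_def multiplier_def algebra_simps)
next
  case (Suc k)
  have "pd_y (CARD('n) - 1) (new_y k) p = 0" using new_y[of k] Suc.prems unfolding jet_order_def by auto
  then have "lie new_field (vertical_part \<eta> (new_y k)) p = vertical_part \<eta> (lie new_field (new_y k)) p"
    using lie_new_field_vertical_part[OF \<eta> new_y_smooth Suc.prems(2), of k] by simp
  also have "\<dots> = vertical_part \<eta> (new_y (Suc k)) p"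
    by (rule vertical_part_cong[OF Suc.prems(2) lie_new_field_new_y])
  finally have "vertical_part \<eta> (new_y (Suc k)) p = lie new_field (vertical_part \<eta> (new_y k)) p" by simp
  also have "\<dots> = lie new_field ((lie new_field ^^ k) (\<lambda>p. multiplier p * \<eta> p)) p"
    by (rule lie_cong[OF U Suc.prems(2)]) (use Suc in auto)
  finally show ?case by simp
qed

lemma vertical_part_new_F:
  assumes \<eta>: "smooth_on U \<eta>" and p: "p \<in> U"
  shows "vertical_part \<eta> (\<lambda>p. F' (prolong F \<psi> p)) p
    = (\<Sum>k<CARD('n). new_coef k p * (lie new_field ^^ k) (\<lambda>p. multiplier p * \<eta> p) p)"
proof -
  let ?V = "prolonged_vertical F \<eta>" and ?q = "prolong F \<psi> p" and ?n = "CARD('n)"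
  have Fd: "F' differentiable (at ?q)" using smooth_on_differentiable_at[OF F'] prolong_into p by blast
  have lin: "linear (frechet_derivative F' (at ?q))" using Fd by (rule linear_frechet_derivative)
  have c: "lie v (\<lambda>p. F' (prolong F \<psi> p)) p
      = frechet_derivative F' (at ?q) (lie v new_x p, \<chi> i. lie v (new_y (pos i)) p)" for v
    using frechet_derivative_compose[OF smooth_on_differentiable_at[OF prolong_smooth p] Fd]
      frechet_derivative_prolong[OF p] by (simp add: lie_def o_def)
  have "vertical_part \<eta> (\<lambda>p. F' (prolong F \<psi> p)) p = frechet_derivative F' (at ?q)
     ((lie ?V new_x p, \<chi> i. lie ?V (new_y (pos i)) p)
      - lie ?V new_x p *\<^sub>R (lie new_field new_x p, \<chi> i. lie new_field (new_y (pos i)) p))"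
    unfolding vertical_part_def c linear_diff[OF lin] linear_cmul[OF lin] by simp
  also have "(lie ?V new_x p, \<chi> i. lie ?V (new_y (pos i)) p)
      - lie ?V new_x p *\<^sub>R (lie new_field new_x p, \<chi> i. lie new_field (new_y (pos i)) p)
     = (0, \<chi> i. vertical_part \<eta> (new_y (pos i)) p)"
    using lie_new_field_new_x[OF p] by (simp add: vertical_part_def prod_eq_iff vec_eq_iff)
  also have "frechet_derivative F' (at ?q) \<dots> = (\<Sum>k<?n. vertical_part \<eta> (new_y k) p * new_coef k p)"
    unfolding frechet_derivative_jet_expand[OF Fd] new_coef_def by (auto intro!: sum.cong)
  finally show ?thesis
    using vertical_part_new_y[OF \<eta> _ p] by (auto simp: mult.commute intro!: sum.cong)
qed

text \<open>
  The recursion of \<open>vertical_part_new_y\<close>, carried one step further. There the derivative of the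
  highest new coordinate is the new right-hand side, and the commutator contributes the linearised
  operator of the original equation.
\<close>

lemma linearisation_intertwined:
  assumes \<eta>: "smooth_on U \<eta>" and p: "p \<in> U"
  shows "lin_op new_field CARD('n) new_coef (\<lambda>p. multiplier p * \<eta> p) p
    = (inverse (dilation p) * pd_y (CARD('n) - 1) (new_y (CARD('n) - 1)) p)
      * lin_op (total_field F) CARD('n) (\<lambda>i. pd_y i F) \<eta> p"
proof -
  let ?n = "CARD('n)" and ?L = "lin_op (total_field F) CARD('n) (\<lambda>i. pd_y i F) \<eta>"
  obtain r where r: "?n = Suc r" using order by (cases ?n) auto
  have "(lie new_field ^^ ?n) (\<lambda>p. multiplier p * \<eta> p) p
    = lie new_field ((lie new_field ^^ r) (\<lambda>p. multiplier p * \<eta> p)) p" by (simp add: r)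
  also have "\<dots> = lie new_field (vertical_part \<eta> (new_y r)) p"
    by (rule lie_cong[OF U p]) (use vertical_part_new_y[OF \<eta>] r in auto)
  also have "\<dots> = vertical_part \<eta> (lie new_field (new_y r)) p
      + inverse (dilation p) * ?L p * pd_y (?n - 1) (new_y r) p"
    by (rule lie_new_field_vertical_part[OF \<eta> new_y_smooth p])
  also have "vertical_part \<eta> (lie new_field (new_y r)) p = vertical_part \<eta> (\<lambda>p. F' (prolong F \<psi> p)) p"
    by (rule vertical_part_cong[OF p]) (use lie_new_field_new_y new_y_top r in auto)
  finally show ?thesis
    unfolding lin_op_def[of new_field] vertical_part_new_F[OF \<eta> p] by (simp add: r)
qed

theorem conditions_invariant:
  "satisfies_conditions (condition_poly CARD('n)) F U \<longleftrightarrow> satisfies_conditions (condition_poly CARD('n)) F' U'"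
proof -
  let ?n = "CARD('n)" and ?X = "total_field F"
  have "satisfies_conditions (condition_poly ?n) F U \<longleftrightarrow> is_sympow ?n U ?X (\<lambda>i. pd_y i F)"
    by (rule satisfies_conditions_iff_is_sympow[OF order F])
  also have "\<dots> \<longleftrightarrow> is_sympow ?n U new_field new_coef"
  proof (rule sym)
    have nf: "new_field = (\<lambda>p. inverse (dilation p) *\<^sub>R ?X p)" by (rule ext) (rule new_field_def)
    show "is_sympow ?n U new_field new_coef \<longleftrightarrow> is_sympow ?n U ?X (\<lambda>i. pd_y i F)"
      unfolding nf
    proof (rule is_sympow_invariant[OF total_field_smooth multiplier_smooth multiplier_nonzero dilation(1)
          dilation_nonzero order smooth_on_fst[OF U] lie_total_field_fst new_x(1)])
      show "lie (\<lambda>p. inverse (dilation p) *\<^sub>R ?X p) new_x p = 1" if "p \<in> U" for p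
        using lie_new_field_new_x[OF that] by (simp add: nf)
      show "lin_op (\<lambda>p. inverse (dilation p) *\<^sub>R ?X p) ?n new_coef (\<lambda>p. multiplier p * u p) p
        = (inverse (dilation p) * pd_y (?n - 1) (new_y (?n - 1)) p) * lin_op ?X ?n (\<lambda>i. pd_y i F) u p"
        if "smooth_on U u" "p \<in> U" for u p
        using linearisation_intertwined[OF that] by (simp add: nf)
    qed
  qed
  also have "\<dots> \<longleftrightarrow> (\<forall>k\<in>{1..?n - 2}. \<forall>p\<in>U. deval (coef_derivs new_field new_coef p) (cond_exp ?n k) = 0)"
    by (rule sym, rule conditions_iff_is_sympow[where f = new_coef, OF order new_field_smooth new_coef_smooth
          new_x(1) lie_new_field_new_x])
  also have "\<dots> \<longleftrightarrow> (\<forall>k\<in>{1..?n - 2}. \<forall>p\<in>U.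
      deval (coef_derivs (total_field F') (\<lambda>i. pd_y i F') (prolong F \<psi> p)) (cond_exp ?n k) = 0)"
  proof -
    have "coef_derivs new_field new_coef p = coef_derivs (total_field F') (\<lambda>i. pd_y i F') (prolong F \<psi> p)"
      if "p \<in> U" for p
      unfolding new_coef_def[abs_def]
      by (rule coef_derivs_related[OF prolong_smooth prolong_into smooth_on_total_field[OF F'] smooth_on_pd_y[OF F']
            prolong_related that])
    then show ?thesis by simp
  qed
  also have "\<dots> \<longleftrightarrow> satisfies_conditions (condition_poly ?n) F' U'"
    unfolding satisfies_conditions_iff[OF F'] unfolding image by blast
  finally show ?thesis .
qed

end

section \<open>The linearised equation along a solution\<close>

lemma slice_first:
  fixes g :: "real \<times> 'b::euclidean_space \<Rightarrow> real"
  assumes g: "smooth_on (I \<times> M) g" and I: "open I" and M: "open M" and t: "t \<in> M"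
  shows "smooth_on I (\<lambda>x. g (x, t))"
    "x \<in> I \<Longrightarrow> (lie (\<lambda>_. 1) ^^ k) (\<lambda>x. g (x, t)) x = (lie (\<lambda>_. (1, 0)) ^^ k) g (x, t)"
proof -
  have d: "((\<lambda>x :: real. (x, t)) has_derivative (\<lambda>h. (h, 0))) (at x)" for x
    by (auto intro!: derivative_eq_intros)
  have \<Phi>: "smooth_on I (\<lambda>x :: real. (x, t))"
    using I by (intro smooth_on_Pair smooth_on_bounded_linear[OF bounded_linear_ident]) simp_all
  have IM: "(\<lambda>x. (x, t)) ` I \<subseteq> I \<times> M" using t by auto
  show "smooth_on I (\<lambda>x. g (x, t))" by (rule smooth_on_compose[OF \<Phi> g IM])
  assume x: "x \<in> I"
  show "(lie (\<lambda>_. 1) ^^ k) (\<lambda>x. g (x, t)) x = (lie (\<lambda>_. (1, 0)) ^^ k) g (x, t)"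
    by (rule lie_iter_compose[where \<Phi> = "\<lambda>x. (x, t)" and \<zeta> = "\<lambda>_. (1, 0)", OF \<Phi> g IM _ _ x])
      (simp_all add: I M open_Times flip: frechet_derivative_at[OF d])
qed

lemma slice_second:
  fixes g :: "real \<times> 'b::euclidean_space \<Rightarrow> real"
  assumes g: "smooth_on (I \<times> M) g" and M: "open M" and x: "x \<in> I"
  shows "smooth_on M (\<lambda>t. g (x, t))"
    "t \<in> M \<Longrightarrow> frechet_derivative (\<lambda>t. g (x, t)) (at t) v = lie (\<lambda>_. (0, v)) g (x, t)"
proof -
  have d: "((\<lambda>t :: 'b. (x, t)) has_derivative (\<lambda>h. (0, h))) (at t)" for t
    by (auto intro!: derivative_eq_intros)
  have \<Phi>: "smooth_on M (\<lambda>t :: 'b. (x, t))"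
    using M by (intro smooth_on_Pair smooth_on_bounded_linear[OF bounded_linear_ident]) simp_all
  have IM: "(\<lambda>t. (x, t)) ` M \<subseteq> I \<times> M" using x by auto
  show "smooth_on M (\<lambda>t. g (x, t))" by (rule smooth_on_compose[OF \<Phi> g IM])
  assume t: "t \<in> M"
  have gd: "g differentiable (at (x, t))" using smooth_on_differentiable_at[OF g] x t by simp
  show "frechet_derivative (\<lambda>t. g (x, t)) (at t) v = lie (\<lambda>_. (0, v)) g (x, t)"
    using frechet_derivative_compose[OF smooth_on_differentiable_at[OF \<Phi> t] gd]
    by (simp add: lie_def o_def flip: frechet_derivative_at[OF d])
qed

text \<open>
  For a general solution, the variations \<open>\<partial>Z/\<partial>t(v)\<close> are considered as functions of \<open>x\<close> at fixed \<open>t\<close>.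
\<close>

locale family_of_solutions =
  fixes F :: "'n::finite jet \<Rightarrow> real" and U I M and Z :: "real \<Rightarrow> real ^ 'n \<Rightarrow> real"
  assumes F: "smooth_on U F" and gs: "general_solution F U I M Z"

begin

definition Z_joint :: "real \<times> (real ^ 'n) \<Rightarrow> real" where "Z_joint = (\<lambda>(x, t). Z x t)"

definition Z_deriv :: "nat \<Rightarrow> real \<times> (real ^ 'n) \<Rightarrow> real" where "Z_deriv k = (lie (\<lambda>_. (1, 0)) ^^ k) Z_joint"

definition variation :: "real ^ 'n \<Rightarrow> real ^ 'n \<Rightarrow> real \<Rightarrow> real" where
  "variation t v x = frechet_derivative (Z x) (at t) v"

definition F_along :: "real ^ 'n \<Rightarrow> nat \<Rightarrow> real \<Rightarrow> real" where
  "F_along t k x = pd_y k F (solution_jet Z x t)"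

lemma I: "open I" "is_interval I" and M: "open M" and Zs: "smooth_on (I \<times> M) Z_joint"
  using gs by (auto simp: general_solution_def Z_joint_def)

lemma jets_in: "x \<in> I \<Longrightarrow> t \<in> M \<Longrightarrow> solution_jet Z x t \<in> U"
  and jets_onto: "U = (\<lambda>(x, t). solution_jet Z x t) ` (I \<times> M)"
  using gs by (auto simp: general_solution_def bij_betw_def)

lemma Z_deriv_smooth: "smooth_on (I \<times> M) (Z_deriv k)"
  unfolding Z_deriv_def by (rule smooth_on_lie_iter[OF smooth_on_const Zs]) (simp add: I M open_Times)

lemma x_deriv_eq: "x \<in> I \<Longrightarrow> t \<in> M \<Longrightarrow> x_deriv k Z x t = Z_deriv k (x, t)"
proof (induction k arbitrary: x)
  case 0 then show ?case by (simp add: x_deriv_def Z_deriv_def Z_joint_def)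
next
  case (Suc k)
  have "x_deriv (Suc k) Z x t = deriv (\<lambda>s. x_deriv k Z s t) x" by (simp add: x_deriv_def[abs_def])
  also have "\<dots> = deriv (\<lambda>s. Z_deriv k (s, t)) x"
  proof (rule deriv_cong_ev[OF _ refl])
    show "\<forall>\<^sub>F s in nhds x. x_deriv k Z s t = Z_deriv k (s, t)"
      using Suc.IH Suc.prems I(1) by (intro eventually_nhds[THEN iffD2]) blast
  qed
  also have "\<dots> = frechet_derivative (Z_deriv k) (at (x, t)) (1, 0)"
    using DERIV_along_line[OF Z_deriv_smooth[of k], of "(0, t)" x "(1, 0)"] Suc.prems
    by (intro DERIV_imp_deriv) simp
  finally show ?case by (simp add: Z_deriv_def lie_def)
qed

lemma solution_jet_eq: "x \<in> I \<Longrightarrow> t \<in> M \<Longrightarrow> solution_jet Z x t = (x, \<chi> i. Z_deriv (pos i) (x, t))"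
  by (simp add: solution_jet_def x_deriv_eq)

lemma ode_along: "x \<in> I \<Longrightarrow> t \<in> M \<Longrightarrow> Z_deriv CARD('n) (x, t) = F (solution_jet Z x t)"
  using gs x_deriv_eq by (simp add: general_solution_def)

lemma solution_jet_smooth_x: "t \<in> M \<Longrightarrow> smooth_on I (\<lambda>x. solution_jet Z x t)"
proof -
  assume t: "t \<in> M"
  have "smooth_on I (\<lambda>x. (x, \<chi> i. Z_deriv (pos i) (x, t)) :: 'n jet)"
    using I smooth_on_bounded_linear[OF bounded_linear_ident, of I] slice_first(1)[OF Z_deriv_smooth I(1) M t]
    by (intro smooth_on_jet) simp_all
  then show ?thesis by (rule smooth_on_cong) (simp add: solution_jet_eq t)
qed

lemma solution_jet_smooth_t: "x \<in> I \<Longrightarrow> smooth_on M (\<lambda>t. solution_jet Z x t)"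
proof -
  assume x: "x \<in> I"
  have "smooth_on M (\<lambda>t. (x, \<chi> i. Z_deriv (pos i) (x, t)) :: 'n jet)"
    using M slice_second(1)[OF Z_deriv_smooth M x] by (intro smooth_on_jet) simp_all
  then show ?thesis by (rule smooth_on_cong) (simp add: solution_jet_eq x)
qed

lemma solution_jet_derivative:
  assumes x: "x \<in> I" and t: "t \<in> M"
  shows "frechet_derivative (\<lambda>x. solution_jet Z x t) (at x) 1 = total_field F (solution_jet Z x t)"
proof -
  let ?n = "CARD('n)"
  have D: "lie (\<lambda>_. 1) (\<lambda>x. Z_deriv k (x, t)) x = Z_deriv (Suc k) (x, t)" for k
  proof -
    have "(lie (\<lambda>_. 1) ^^ 1) (\<lambda>x. Z_deriv k (x, t)) x = (lie (\<lambda>_. (1, 0)) ^^ 1) (Z_deriv k) (x, t)"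
      by (rule slice_first(2)[OF Z_deriv_smooth I(1) M t x])
    then show ?thesis by (simp add: Z_deriv_def)
  qed
  have "frechet_derivative (\<lambda>x. solution_jet Z x t) (at x) = frechet_derivative (\<lambda>x. (x, \<chi> i. Z_deriv (pos i) (x, t))) (at x)"
    by (rule frechet_derivative_cong_open[OF I(1) x]) (simp add: solution_jet_eq t)
  moreover have sm: "smooth_on I (\<lambda>x. (x, \<chi> i. Z_deriv (pos i) (x, t)) :: 'n jet)"
    by (rule smooth_on_cong[OF solution_jet_smooth_x[OF t]]) (simp add: solution_jet_eq t)
  ultimately have "frechet_derivative (\<lambda>x. solution_jet Z x t) (at x) 1 = (1, \<chi> i. Z_deriv (Suc (pos i)) (x, t))"
    using frechet_derivative_jet[OF smooth_on_differentiable_at[OF sm x], of 1] D by (simp add: lie_def)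
  moreover have "Z_deriv (Suc (pos i)) (x, t) = (if pos i < ?n - 1 then snd (solution_jet Z x t) $ idx (Suc (pos i)) else F (solution_jet Z x t))" for i :: 'n
  proof (cases "pos i < ?n - 1")
    case False
    then have "Suc (pos i) = ?n" using pos_less[of i] by linarith
    then show ?thesis using False ode_along[OF x t] by simp
  qed (simp add: solution_jet_eq[OF x t])
  ultimately show ?thesis unfolding total_field_def by simp
qed

lemma F_along_smooth: "t \<in> M \<Longrightarrow> smooth_on I (F_along t k)"
  unfolding F_along_def[abs_def]
  by (rule smooth_on_compose[OF solution_jet_smooth_x smooth_on_pd_y[OF F]]) (use jets_in in auto)

lemma variation_eq:
  assumes "x \<in> I" "t \<in> M"
  shows "variation t v x = lie (\<lambda>_. (0, v)) Z_joint (x, t)"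
  using slice_second(2)[OF Zs M assms, of v] by (simp add: variation_def Z_joint_def)

lemma dZ_smooth: "smooth_on (I \<times> M) (lie (\<lambda>_. (0, v)) Z_joint)"
  by (rule smooth_on_lie[OF smooth_on_const Zs]) (simp add: I M open_Times)

lemma variation_smooth:
  assumes t: "t \<in> M" shows "smooth_on I (variation t v)"
  using smooth_on_cong[OF slice_first(1)[OF dZ_smooth I(1) M t, of v]] variation_eq[OF _ t] by simp

text \<open>
  Differentiation with respect to \<open>x\<close> and to \<open>t\<close> commute.
\<close>

lemma variation_deriv:
  assumes x: "x \<in> I" and t: "t \<in> M"
  shows "(lie (\<lambda>_. 1) ^^ k) (variation t v) x = lie (\<lambda>_. (0, v)) (Z_deriv k) (x, t)"
proof -
  have "(lie (\<lambda>_. 1) ^^ k) (variation t v) x = (lie (\<lambda>_. 1) ^^ k) (\<lambda>x. lie (\<lambda>_. (0, v)) Z_joint (x, t)) x"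
    by (rule lie_iter_cong[OF I(1) x]) (rule variation_eq[OF _ t])
  also have "\<dots> = (lie (\<lambda>_. (1, 0)) ^^ k) (lie (\<lambda>_. (0, v)) Z_joint) (x, t)"
    by (rule slice_first(2)[OF dZ_smooth I(1) M t x])
  also have "\<dots> = lie (\<lambda>_. (0, v)) (Z_deriv k) (x, t)"
    unfolding Z_deriv_def using lie_const_fields_commute[OF Zs, of "(x, t)"] x t by simp
  finally show ?thesis .
qed

lemma variation_deriv_frechet:
  assumes x: "x \<in> I" and t: "t \<in> M"
  shows "(lie (\<lambda>_. 1) ^^ k) (variation t v) x = frechet_derivative (x_deriv k Z x) (at t) v"
proof -
  have "frechet_derivative (x_deriv k Z x) (at t) = frechet_derivative (\<lambda>t. Z_deriv k (x, t)) (at t)"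
    by (rule frechet_derivative_cong_open[OF M t]) (rule x_deriv_eq[OF x])
  then show ?thesis using slice_second(2)[OF Z_deriv_smooth M x t] variation_deriv[OF x t] by simp
qed

lemma variation_deriv_smooth_t:
  assumes x: "x \<in> I"
  shows "smooth_on M (\<lambda>t. (lie (\<lambda>_. 1) ^^ k) (variation t v) x)"
proof (rule smooth_on_cong)
  have "smooth_on (I \<times> M) (lie (\<lambda>_. (0, v)) (Z_deriv k))"
    by (rule smooth_on_lie[OF smooth_on_const Z_deriv_smooth]) (simp add: I M open_Times)
  then show "smooth_on M (\<lambda>t. lie (\<lambda>_. (0, v)) (Z_deriv k) (x, t))" by (rule slice_second(1)[OF _ M x])
qed (simp add: variation_deriv[OF x])

lemma variation_independent:
  assumes "x \<in> I" "t \<in> M" "\<And>v. (\<Sum>k<CARD('n). c k * (lie (\<lambda>_. 1) ^^ k) (variation t v) x) = 0" "k < CARD('n)"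
  shows "c k = 0"
  using gs assms unfolding general_solution_def variation_deriv_frechet[OF assms(1,2)] by blast

text \<open>
  Differentiate the equation \<open>Z^(n) = F(x, Z, \<dots>, Z^(n-1))\<close> with respect to \<open>t\<close>.
\<close>

theorem linearised_equation:
  assumes x: "x \<in> I" and t: "t \<in> M"
  shows "lin_op (\<lambda>_. 1) CARD('n) (F_along t) (variation t v) x = 0"
proof -
  let ?n = "CARD('n)" and ?J = "\<lambda>z :: real \<times> (real ^ 'n). (fst z, \<chi> i. Z_deriv (pos i) z) :: 'n jet"
  have xt: "(x, t) \<in> I \<times> M" using x t by simp
  have IM: "open (I \<times> M)" using I M by (simp add: open_Times)
  have J: "smooth_on (I \<times> M) ?J"
    using smooth_on_bounded_linear[OF bounded_linear_fst IM] Z_deriv_smooth by (intro smooth_on_jet) simp_all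
  have Jeq: "?J z = solution_jet Z (fst z) (snd z)" if "z \<in> I \<times> M" for z
    using that solution_jet_eq by auto
  have Fd: "F differentiable (at (?J (x, t)))"
    using smooth_on_differentiable_at[OF F] Jeq[OF xt] jets_in[OF x t] by simp
  have "lie (\<lambda>_. (0, v)) (Z_deriv ?n) (x, t) = lie (\<lambda>_. (0, v)) (\<lambda>z. F (?J z)) (x, t)"
    by (rule lie_cong[OF IM xt]) (use ode_along Jeq in auto)
  also have "\<dots> = frechet_derivative F (at (?J (x, t))) (frechet_derivative ?J (at (x, t)) (0, v))"
    using frechet_derivative_compose[OF smooth_on_differentiable_at[OF J xt] Fd] by (simp add: lie_def o_def)
  also have "frechet_derivative ?J (at (x, t)) (0, v) = (0, \<chi> i. lie (\<lambda>_. (0, v)) (Z_deriv (pos i)) (x, t))"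
  proof -
    have "frechet_derivative (fst :: real \<times> (real ^ 'n) \<Rightarrow> real) (at (x, t)) = fst"
      using frechet_derivative_at[OF bounded_linear_imp_has_derivative[OF bounded_linear_fst]] by metis
    then show ?thesis
      unfolding frechet_derivative_jet[OF smooth_on_differentiable_at[OF J xt]] by (simp add: lie_def)
  qed
  also have "frechet_derivative F (at (?J (x, t))) \<dots> = (\<Sum>k<?n. lie (\<lambda>_. (0, v)) (Z_deriv k) (x, t) * pd_y k F (?J (x, t)))"
    unfolding frechet_derivative_jet_expand[OF Fd] by (auto intro!: sum.cong)
  finally show ?thesis
    unfolding lin_op_def variation_deriv[OF x t] F_along_def solution_jet_eq[OF x t]
    by (simp add: mult.commute)
qed

lemma conditions_along:
  assumes t: "t \<in> M" and x: "x \<in> I"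
  shows "coef_derivs (\<lambda>_. 1) (F_along t) x = coef_derivs (total_field F) (\<lambda>i. pd_y i F) (solution_jet Z x t)"
  unfolding F_along_def[abs_def]
  by (rule coef_derivs_related[where \<Phi> = "\<lambda>x. solution_jet Z x t", OF solution_jet_smooth_x[OF t] _ smooth_on_total_field[OF F] smooth_on_pd_y[OF F] _ x])
    (use jets_in t solution_jet_derivative in auto)

end

section \<open>Binary forms\<close>

lemma binary_form_eq_0:
  fixes c :: "real ^ 'n::finite"
  assumes "\<And>z. binary_form c z = 0"
  shows "c = 0"
proof -
  let ?n = "CARD('n)"
  have "(\<Sum>k\<le>?n - 1. c $ idx k * a ^ k) = 0" for a
  proof -
    have "binary_form c (vector [a, 1]) = (\<Sum>i\<in>(UNIV::'n set). c $ idx (pos i) * a ^ pos i)"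
      by (simp add: binary_form_def)
    also have "\<dots> = (\<Sum>k<?n. c $ idx k * a ^ k)" by (rule sum_idx)
    also have "{..<?n} = {..?n - 1}"
      using pos_less[of "undefined :: 'n"] by auto
    finally show ?thesis using assms by simp
  qed
  then have "\<forall>k\<le>?n - 1. c $ idx k = 0" using polyfun_eq_0[of "\<lambda>k. c $ idx k" "?n - 1"] by blast
  moreover have "pos i \<le> ?n - 1" for i :: 'n using pos_less[of i] by linarith
  ultimately have "c $ i = 0" for i by (metis idx_pos)
  then show ?thesis by (simp add: vec_eq_iff)
qed

lemma binary_form_diff: "binary_form (c - d) z = binary_form c z - binary_form d z"
  by (simp add: binary_form_def left_diff_distrib sum_subtractf)

lemma binary_form_eq:
  fixes c d :: "real ^ 'n::finite"
  assumes "\<And>z. binary_form c z = binary_form d z"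
  shows "c = d"
  using binary_form_eq_0[of "c - d"] assms by (simp add: binary_form_diff)

text \<open>
  The power \<open>(a z\<^sub>1 + b z\<^sub>2)^(n-1)\<close>.
\<close>

definition power_form :: "real \<Rightarrow> real \<Rightarrow> real ^ 'n::finite" where
  "power_form a b = (\<chi> i. real ((CARD('n) - 1) choose pos i) * a ^ pos i * b ^ (CARD('n) - 1 - pos i))"

lemma binary_form_power:
  "binary_form (power_form a b :: real ^ 'n::finite) z = (a * z $ 1 + b * z $ 2) ^ (CARD('n) - 1)"
proof -
  let ?m = "CARD('n) - 1"
  have n: "{..<CARD('n)} = {..?m}" using pos_less[of "undefined :: 'n"] by auto
  have "binary_form (power_form a b :: real ^ 'n) z =
    (\<Sum>i\<in>(UNIV::'n set). real (?m choose pos i) * (a * z $ 1) ^ pos i * (b * z $ 2) ^ (?m - pos i))"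
    by (simp add: binary_form_def power_form_def power_mult_distrib mult_ac)
  also have "\<dots> = (\<Sum>k<CARD('n). real (?m choose k) * (a * z $ 1) ^ k * (b * z $ 2) ^ (?m - k))"
    by (rule sum_idx)
  also have "\<dots> = (a * z $ 1 + b * z $ 2) ^ ?m"
    unfolding binomial_ring n by simp
  finally show ?thesis .
qed

lemma max_null_form_iff:
  fixes q :: "real ^ 'n::finite"
  shows "max_null_form q \<longleftrightarrow> (\<exists>k a b. k \<noteq> 0 \<and> (a \<noteq> 0 \<or> b \<noteq> 0) \<and> q = k *\<^sub>R power_form a b)"
proof
  assume "max_null_form q"
  then obtain l :: "real ^ 2" and k where l: "l \<noteq> 0" "k \<noteq> 0" "\<And>z. binary_form q z = k * (l \<bullet> z) ^ (CARD('n) - 1)"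
    unfolding max_null_form_def by blast
  have "binary_form q z = binary_form (k *\<^sub>R power_form (l $ 1) (l $ 2) :: real ^ 'n) z" for z
  proof -
    have "binary_form (k *\<^sub>R power_form (l $ 1) (l $ 2) :: real ^ 'n) z = k * binary_form (power_form (l $ 1) (l $ 2) :: real ^ 'n) z"
      by (simp add: binary_form_def sum_distrib_left mult_ac)
    then show ?thesis using l(3)[of z] by (simp add: binary_form_power inner_vec_def sum_2)
  qed
  then have "q = k *\<^sub>R power_form (l $ 1) (l $ 2)" by (rule binary_form_eq)
  moreover have "l $ 1 \<noteq> 0 \<or> l $ 2 \<noteq> 0" using l(1) by (auto simp: vec_eq_iff forall_2)
  ultimately show "\<exists>k a b. k \<noteq> 0 \<and> (a \<noteq> 0 \<or> b \<noteq> 0) \<and> q = k *\<^sub>R power_form a b" using l(2) by blast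
next
  assume "\<exists>k a b. k \<noteq> 0 \<and> (a \<noteq> 0 \<or> b \<noteq> 0) \<and> q = k *\<^sub>R power_form a b"
  then obtain k a b where q: "k \<noteq> 0" "a \<noteq> 0 \<or> b \<noteq> 0" "q = k *\<^sub>R power_form a b" by blast
  have "binary_form q z = k * (vector [a, b] \<bullet> z) ^ (CARD('n) - 1)" for z
  proof -
    have "binary_form q z = k * binary_form (power_form a b :: real ^ 'n) z"
      by (simp add: q(3) binary_form_def sum_distrib_left mult_ac)
    then show ?thesis by (simp add: binary_form_power inner_vec_def sum_2)
  qed
  moreover have "(vector [a, b] :: real ^ 2) \<noteq> 0" using q(2) by (auto simp: vec_eq_iff forall_2)
  ultimately show "max_null_form q" unfolding max_null_form_def using q(1) by blast
qed

section \<open>Null hypersurfaces force the conditions\<close>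

text \<open>
  In the parameter \<open>s\<close> and divided by \<open>\<rho>\<close>, the given solutions are polynomials of degree below \<open>n\<close> and
  are annihilated by the \<open>n\<close>-th derivative. Transported back, this becomes a symmetric power which
  annihilates the same functions as the given operator; independence makes the two operators equal.
\<close>

lemma is_sympow_of_powers:
  fixes J :: "real set" and \<rho> s :: "real \<Rightarrow> real"
  assumes n: "2 \<le> n" and f: "\<And>k. smooth_on J (f k)"
    and \<rho>: "smooth_on J \<rho>" "\<And>x. x \<in> J \<Longrightarrow> \<rho> x \<noteq> 0" and s: "smooth_on J s"
    and sol: "\<And>a b x. x \<in> J \<Longrightarrow> lin_op (\<lambda>_. 1) n f (\<lambda>x. \<rho> x * (a * s x + b) ^ (n - 1)) x = 0"
    and indep: "\<And>d x k. x \<in> J \<Longrightarrow>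
       (\<And>a b. (\<Sum>k<n. d k * (lie (\<lambda>_. 1) ^^ k) (\<lambda>x. \<rho> x * (a * s x + b) ^ (n - 1)) x) = 0) \<Longrightarrow> k < n \<Longrightarrow> d k = 0"
  shows "is_sympow n J (\<lambda>_. 1) f"
proof -
  have J: "open J" using s by (rule smooth_on_open)
  let ?d = "\<lambda>_ :: real. 1 :: real"
  have d: "smooth_on J ?d" using J by simp
  have lin: "smooth_on J (\<lambda>x. a * s x + b)" for a b by (intro smooth_on_add smooth_on_mult smooth_on_const J s)
  have lielin: "lie ?d (\<lambda>x. a * s x + b) x = a * lie ?d s x" if "x \<in> J" for a b x
    using lie_add[OF smooth_on_mult[OF smooth_on_const[OF J] s] smooth_on_const[OF J] that, of ?d a b]
      lie_cmult[OF s that] by simp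
  have s': "lie ?d s x \<noteq> 0" if x: "x \<in> J" for x
  proof
    assume 0: "lie ?d s x = 0"
    \<comment> \<open>At a zero of the derivative of \<open>s\<close>, all these functions have the logarithmic derivative of \<open>\<rho>\<close>.\<close>
    define c where "c = (\<lambda>k :: nat. if k = 0 then - lie ?d \<rho> x / \<rho> x else if k = 1 then 1 else 0)"
    have "(\<Sum>k<n. c k * (lie ?d ^^ k) (\<lambda>x. \<rho> x * (a * s x + b) ^ (n - 1)) x) = 0" for a b
    proof -
      let ?Y = "\<lambda>x. \<rho> x * (a * s x + b) ^ (n - 1)"
      have "lie ?d ?Y x = lie ?d \<rho> x * (a * s x + b) ^ (n - 1)"
        using lie_mult[OF \<rho>(1) smooth_on_power[OF lin] x, of ?d a b "n - 1"] lie_power[OF lin x, of ?d a b "n - 1"]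
          lielin[OF x, of a b] 0 by simp
      then have e: "c 0 * ?Y x + c 1 * lie ?d ?Y x = 0" using \<rho>(2)[OF x] by (simp add: c_def)
      obtain r where r: "n = Suc (Suc r)" using n by (metis One_nat_def Suc_1 Suc_le_D add_2_eq_Suc le_Suc_ex)
      have "(\<Sum>k<n. c k * (lie ?d ^^ k) ?Y x) = c 0 * ?Y x + (c 1 * lie ?d ?Y x + (\<Sum>k<r. c (Suc (Suc k)) * (lie ?d ^^ Suc (Suc k)) ?Y x))"
        unfolding r sum.lessThan_Suc_shift by simp
      also have "\<dots> = 0" using e by (simp add: c_def)
      finally show ?thesis .
    qed
    from indep[OF x this, of 1] show False using n by (simp add: c_def)
  qed
  have ls: "smooth_on J (lie ?d s)" by (rule smooth_on_lie[OF d s])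
  \<comment> \<open>Differentiation with respect to \<open>s\<close>; its \<open>n\<close>-th power is a symmetric power with \<open>p = q = 0\<close>.\<close>
  define \<xi> where "\<xi> = (\<lambda>x. inverse (lie ?d s x) *\<^sub>R ?d x)"
  define \<sigma> where "\<sigma> = (\<lambda>x. inverse (lie ?d s x))"
  have \<sigma>: "smooth_on J \<sigma>" "\<And>x. x \<in> J \<Longrightarrow> \<sigma> x \<noteq> 0"
    unfolding \<sigma>_def using smooth_on_inverse[OF ls s'] s' by auto
  have \<xi>: "smooth_on J \<xi>" using \<sigma>(1) by (simp add: \<xi>_def \<sigma>_def)
  have undo: "inverse (\<sigma> x) *\<^sub>R \<xi> x = ?d x" if "x \<in> J" for x using s'[OF that] by (simp add: \<sigma>_def \<xi>_def)
  have \<xi>s: "lie \<xi> s x = 1" if "x \<in> J" for x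
    using lie_scale[OF s that, of "\<lambda>x. inverse (lie ?d s x)" ?d] s'[OF that] by (simp add: \<xi>_def)
  have z: "smooth_on J (\<lambda>_. 0 :: real)" using J by simp
  obtain p q where pq: "smooth_on J p" "smooth_on J q"
    "\<And>u x. smooth_on J u \<Longrightarrow> x \<in> J \<Longrightarrow>
       sympow_op (\<lambda>x. inverse (\<sigma> x) *\<^sub>R \<xi> x) (real (n - 1)) p q n (\<lambda>x. \<rho> x * u x) x
         = \<rho> x * inverse (\<sigma> x) ^ n * sympow_op \<xi> (real (n - 1)) (\<lambda>_. 0) (\<lambda>_. 0) n u x"
    using sympow_op_gauge[OF \<xi> z z \<rho> \<sigma> n] by blast
  have X0: "(lie \<xi> ^^ n) (\<lambda>x. (a * s x + b) ^ (n - 1)) x = 0" if x: "x \<in> J" for a b x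
  proof -
    have "(\<lambda>x. (a * s x + b) ^ (n - 1)) = (\<lambda>x. \<Sum>i\<le>n - 1. (real ((n - 1) choose i) * a ^ i * b ^ (n - 1 - i)) * (s x - 0) ^ i)"
      by (simp add: binomial_ring power_mult_distrib mult_ac)
    then have "(lie \<xi> ^^ n) (\<lambda>x. (a * s x + b) ^ (n - 1)) x
      = (\<Sum>i\<le>n - 1. (real ((n - 1) choose i) * a ^ i * b ^ (n - 1 - i)) * (lie \<xi> ^^ n) (\<lambda>x. (s x - 0) ^ i) x)"
      using lie_iter_linear_comb[OF \<xi> _ x, of "{..n - 1}" "\<lambda>i x. (s x - 0) ^ i" n "\<lambda>i. real ((n - 1) choose i) * a ^ i * b ^ (n - 1 - i)"]
        smooth_on_power[OF s] by simp
    also have "\<dots> = 0"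
    proof (rule sum.neutral, intro ballI)
      fix i assume "i \<in> {..n - 1}"
      then have "i < n" using n by auto
      then show "(real ((n - 1) choose i) * a ^ i * b ^ (n - 1 - i)) * (lie \<xi> ^^ n) (\<lambda>x. (s x - 0) ^ i) x = 0"
        using lie_iter_power[OF s \<xi>s x, of n 0 i] by (simp add: binomial_eq_0)
    qed
    finally show ?thesis .
  qed
  have sy: "sympow_op ?d (real (n - 1)) p q n (\<lambda>x. \<rho> x * (a * s x + b) ^ (n - 1)) x = 0" if x: "x \<in> J" for a b x
  proof -
    have "sympow_op ?d (real (n - 1)) p q n (\<lambda>x. \<rho> x * (a * s x + b) ^ (n - 1)) x
      = sympow_op (\<lambda>x. inverse (\<sigma> x) *\<^sub>R \<xi> x) (real (n - 1)) p q n (\<lambda>x. \<rho> x * (a * s x + b) ^ (n - 1)) x"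
      by (rule sym, rule sympow_op_cong_field[OF J x undo])
    then show ?thesis using pq(3)[OF smooth_on_power[OF lin] x] X0[OF x] by (simp add: sympow_op_zero)
  qed
  have "sympow_coef ?d (real (n - 1)) p q n k x = - f k x" if x: "x \<in> J" and k: "k < n" for k x
  proof -
    have "(\<Sum>k<n. (sympow_coef ?d (real (n - 1)) p q n k x + f k x) * (lie ?d ^^ k) (\<lambda>x. \<rho> x * (a * s x + b) ^ (n - 1)) x) = 0" for a b
    proof -
      let ?Y = "\<lambda>x. \<rho> x * (a * s x + b) ^ (n - 1)"
      have Y: "smooth_on J ?Y" by (intro smooth_on_mult smooth_on_power \<rho> lin)
      have "{..n} = insert n {..<n}" by auto
      then have "sympow_op ?d (real (n - 1)) p q n ?Y x = (lie ?d ^^ n) ?Y x + (\<Sum>k<n. sympow_coef ?d (real (n - 1)) p q n k x * (lie ?d ^^ k) ?Y x)"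
        unfolding sympow_op_expand[OF d pq(1,2) Y x] by simp
      moreover have "(lie ?d ^^ n) ?Y x = (\<Sum>k<n. f k x * (lie ?d ^^ k) ?Y x)"
        using sol[OF x, of a b] by (simp add: lin_op_def)
      ultimately show ?thesis using sy[OF x, of a b] by (simp add: distrib_right sum.distrib)
    qed
    from indep[OF x this k] show ?thesis by simp
  qed
  then have "\<forall>u. smooth_on J u \<longrightarrow> (\<forall>x\<in>J. sympow_op ?d (real (n - 1)) p q n u x = lin_op ?d n f u x)"
    using sympow_op_eq_lin_op_iff[OF s _ d pq(1,2)] sympow_op_expand[OF d pq(1,2)]
    by (auto simp: lin_op_sum intro!: sum.cong)
  then show ?thesis unfolding is_sympow_def using pq(1,2) by blast
qed

text \<open>
  A curve of powers of linear forms is, locally and in an affine coordinate on the projective line, of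
  the form \<open>\<rho> (a s + b)^(n-1)\<close>. Two affine coordinates cover the line; \<open>\<rho>\<close> is the coefficient of the
  highest power of one variable and \<open>s\<close> is read off from the neighbouring coefficient, which shows
  that both are smooth.
\<close>

lemma is_sympow_of_max_null_curve:
  fixes Q :: "'n::finite \<Rightarrow> real \<Rightarrow> real"
  assumes n: "2 \<le> CARD('n)" and f: "\<And>k. smooth_on I (f k)" and Qs: "\<And>i. smooth_on I (Q i)"
    and QL: "\<And>i x. x \<in> I \<Longrightarrow> lin_op (\<lambda>_. 1) CARD('n) f (Q i) x = 0"
    and Qind: "\<And>x d k. x \<in> I \<Longrightarrow> (\<And>i. (\<Sum>k<CARD('n). d k * (lie (\<lambda>_. 1) ^^ k) (Q i) x) = 0)
       \<Longrightarrow> k < CARD('n) \<Longrightarrow> d k = 0"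
    and null: "\<And>x. x \<in> I \<Longrightarrow> max_null_form (\<chi> i. Q i x)" and x0: "x0 \<in> I"
  shows "\<exists>J. x0 \<in> J \<and> J \<subseteq> I \<and> is_sympow CARD('n) J (\<lambda>_. 1) f"
proof -
  let ?n = "CARD('n)" and ?d = "\<lambda>_ :: real. 1 :: real"
  have I: "open I" by (rule smooth_on_open[OF f])
  have d: "smooth_on I ?d" using I by simp
  define Y where "Y z x = binary_form (\<chi> i. Q i x) z" for z x
  have Ysum: "Y z = (\<lambda>x. \<Sum>i\<in>UNIV. (z $ 1 ^ pos i * z $ 2 ^ (?n - 1 - pos i)) * Q i x)" for z
    by (rule ext) (simp add: Y_def binary_form_def mult_ac)
  have YL: "lin_op ?d ?n f (Y z) x = 0" if "x \<in> I" for z x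
    unfolding Ysum using lin_op_linear_comb[OF d _ that, of UNIV Q ?n f] Qs QL[OF that] by simp
  have YX: "(\<Sum>k<?n. d k * (lie ?d ^^ k) (Y z) x)
      = binary_form (\<chi> i. \<Sum>k<?n. d k * (lie ?d ^^ k) (Q i) x) z" if "x \<in> I" for d z x
  proof -
    have "(lie ?d ^^ k) (Y z) x = (\<Sum>i\<in>UNIV. (z $ 1 ^ pos i * z $ 2 ^ (?n - 1 - pos i)) * (lie ?d ^^ k) (Q i) x)" for k
      unfolding Ysum
      using lie_iter_linear_comb[OF smooth_on_const[OF I] _ that, of UNIV Q k 1] Qs by simp
    then have "(\<Sum>k<?n. d k * (lie ?d ^^ k) (Y z) x)
      = (\<Sum>k<?n. \<Sum>i\<in>UNIV. (z $ 1 ^ pos i * z $ 2 ^ (?n - 1 - pos i)) * (d k * (lie ?d ^^ k) (Q i) x))"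
      by (simp add: sum_distrib_left mult_ac)
    also have "\<dots> = (\<Sum>i\<in>UNIV. (z $ 1 ^ pos i * z $ 2 ^ (?n - 1 - pos i)) * (\<Sum>k<?n. d k * (lie ?d ^^ k) (Q i) x))"
      by (subst sum.swap) (simp add: sum_distrib_left)
    finally show ?thesis by (simp add: binary_form_def mult_ac)
  qed
  have Yind: "d k = 0" if x: "x \<in> I" and z: "\<And>z. (\<Sum>k<?n. d k * (lie ?d ^^ k) (Y z) x) = 0" and k: "k < ?n" for d k x
  proof (rule Qind[OF x _ k])
    fix i
    have "(\<chi> i. \<Sum>k<?n. d k * (lie ?d ^^ k) (Q i) x) = 0"
      by (rule binary_form_eq_0) (use YX[OF x] z in simp)
    then show "(\<Sum>k<?n. d k * (lie ?d ^^ k) (Q i) x) = 0" by (simp add: vec_eq_iff)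
  qed
  \<comment> \<open>A form with \<open>\<rho> = Q i\<close> nonzero at \<open>x0\<close> has, near \<open>x0\<close>, the root \<open>- s\<close> in a suitable affine
    coordinate, where \<open>s\<close> is a quotient of two coefficients.\<close>
  have chart: "\<exists>J. x0 \<in> J \<and> J \<subseteq> I \<and> is_sympow ?n J ?d f"
    if nz: "Q i x0 \<noteq> 0" and m: "c \<noteq> 0"
      and YQ: "\<And>a b x. x \<in> I \<Longrightarrow> Q i x \<noteq> 0 \<Longrightarrow> Y (z a b) x = Q i x * (a * (Q j x / (c * Q i x)) + b) ^ (?n - 1)"
      and zs: "\<And>v. \<exists>a b. z a b = v" for i j c and z :: "real \<Rightarrow> real \<Rightarrow> real ^ 2"
  proof -
    define J where "J = {x \<in> I. Q i x \<noteq> 0}"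
    define s where "s = (\<lambda>x. Q j x / (c * Q i x))"
    have JI: "J \<subseteq> I" by (auto simp: J_def)
    have "continuous_on I (Q i)"
      using smooth_on_differentiable_at[OF Qs]
      by (intro continuous_at_imp_continuous_on ballI differentiable_imp_continuous_within)
    then have "open (I \<inter> Q i -` (- {0}))" using I by (intro continuous_open_preimage) auto
    moreover have "I \<inter> Q i -` (- {0}) = J" by (auto simp: J_def)
    ultimately have Jo: "open J" by simp
    have s: "smooth_on J s" unfolding s_def
      using m JI Jo by (intro smooth_on_divide smooth_on_mult smooth_on_const smooth_on_subset[OF Qs]) (auto simp: J_def)
    have e: "(lie ?d ^^ k) (Y (z a b)) x = (lie ?d ^^ k) (\<lambda>x. Q i x * (a * s x + b) ^ (?n - 1)) x" if "x \<in> J" for k a b x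
      by (rule lie_iter_cong[OF Jo that]) (use YQ in \<open>auto simp: J_def s_def\<close>)
    have "is_sympow ?n J ?d f"
    proof (rule is_sympow_of_powers[OF n _ smooth_on_subset[OF Qs Jo JI] _ s])
      show "smooth_on J (f k)" for k by (rule smooth_on_subset[OF f Jo JI])
      show "Q i x \<noteq> 0" if "x \<in> J" for x using that by (simp add: J_def)
      show "lin_op ?d ?n f (\<lambda>x. Q i x * (a * s x + b) ^ (?n - 1)) x = 0" if "x \<in> J" for a b x
        using YL[of x "z a b"] that JI e[OF that] by (auto simp: lin_op_def)
      show "d k = 0" if x: "x \<in> J" and 0: "\<And>a b. (\<Sum>k<?n. d k * (lie ?d ^^ k) (\<lambda>x. Q i x * (a * s x + b) ^ (?n - 1)) x) = 0"
        and k: "k < ?n" for d x k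
      proof (rule Yind[OF _ _ k])
        show "x \<in> I" using x JI by blast
        fix v
        obtain a b where "z a b = v" using zs by blast
        then show "(\<Sum>k<?n. d k * (lie ?d ^^ k) (Y v) x) = 0" using 0[of a b] e[OF x, of _ a b] by simp
      qed
    qed
    then show ?thesis using JI x0 nz by (intro exI[of _ J]) (simp add: J_def)
  qed
  obtain m where m: "?n = Suc m" "m \<ge> 1" using n by (cases ?n) auto
  have p0: "pos (idx 0 :: 'n) = 0" "pos (idx 1 :: 'n) = 1" "pos (idx m :: 'n) = m" "pos (idx (m - 1) :: 'n) = m - 1"
    using m by auto
  have coef: "\<exists>k a b. k \<noteq> 0 \<and> (a \<noteq> 0 \<or> b \<noteq> 0) \<and> (\<forall>z. Y z x = k * (a * z $ 1 + b * z $ 2) ^ m) \<and>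
     Q (idx 0) x = k * b ^ m \<and> Q (idx 1) x = k * (real m * a * b ^ (m - 1)) \<and>
     Q (idx m) x = k * a ^ m \<and> Q (idx (m - 1)) x = k * (real m * a ^ (m - 1) * b)" if x: "x \<in> I" for x
  proof -
    obtain k a b where kab: "k \<noteq> 0" "a \<noteq> 0 \<or> b \<noteq> 0" "(\<chi> i. Q i x) = k *\<^sub>R power_form a b"
      using null[OF x] unfolding max_null_form_iff by blast
    have Y: "Y z x = k * (a * z $ 1 + b * z $ 2) ^ m" for z
    proof -
      have "Y z x = k * binary_form (power_form a b :: real ^ 'n) z"
        unfolding Y_def kab(3) by (simp add: binary_form_def sum_distrib_left mult_ac)
      then show ?thesis using m by (simp add: binary_form_power)
    qed
    have "Q i x = k * (real (m choose pos i) * a ^ pos i * b ^ (m - pos i))" for i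
      using arg_cong[OF kab(3), of "\<lambda>v. v $ i"] m by (simp add: power_form_def)
    moreover have "m choose (m - 1) = m" using m(2) binomial_symmetric[of 1 m] by simp
    moreover have "m - (m - 1) = 1" using m(2) by simp
    ultimately show ?thesis using kab Y p0 by (intro exI[of _ k] exI[of _ a] exI[of _ b]) simp
  qed
  have mpow: "c ^ m = c * c ^ (m - 1)" for c :: real using m(2) by (cases m) auto
  have quot: "k * (real m * a * b ^ (m - 1)) / (real m * (k * b ^ m)) = a / b" if "k \<noteq> 0" "b \<noteq> 0" for k a b :: real
    unfolding mpow[of b] using that m(2) by (simp add: field_simps)
  show ?thesis
  proof (cases "Q (idx 0) x0 = 0")
    case False
    then show ?thesis
    proof (rule chart)
      show "real m \<noteq> 0" using m by simp
      show "\<exists>a b. vector [a, b] = v" for v :: "real ^ 2"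
        by (intro exI[of _ "v $ 1"] exI[of _ "v $ 2"]) (simp add: vec_eq_iff forall_2)
      fix c d x assume x: "x \<in> I" and nz: "Q (idx 0) x \<noteq> 0"
      obtain k a b where e: "\<And>z. Y z x = k * (a * z $ 1 + b * z $ 2) ^ m" "Q (idx 0) x = k * b ^ m"
        "Q (idx 1) x = k * (real m * a * b ^ (m - 1))" using coef[OF x] by blast
      have b: "b \<noteq> 0" "k \<noteq> 0" using nz e(2) m(2) by (auto simp: power_0_left)
      have s: "Q (idx 1) x / (real m * Q (idx 0) x) = a / b" unfolding e(2,3) by (rule quot[OF b(2,1)])
      have "b * (c * (a / b) + d) = a * c + b * d" using b by (simp add: field_simps)
      then show "Y (vector [c, d]) x = Q (idx 0) x * (c * (Q (idx 1) x / (real m * Q (idx 0) x)) + d) ^ (?n - 1)"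
        unfolding s unfolding e(1) e(2) using m by (simp add: power_mult_distrib[symmetric] mult.assoc)
    qed
  next
    case True
    have "Q (idx m) x0 \<noteq> 0"
      using coef[OF x0] True by auto
    then show ?thesis
    proof (rule chart)
      show "real m \<noteq> 0" using m by simp
      show "\<exists>a b. vector [b, a] = v" for v :: "real ^ 2"
        by (intro exI[of _ "v $ 2"] exI[of _ "v $ 1"]) (simp add: vec_eq_iff forall_2)
      fix c d x assume x: "x \<in> I" and nz: "Q (idx m) x \<noteq> 0"
      obtain k a b where e: "\<And>z. Y z x = k * (a * z $ 1 + b * z $ 2) ^ m" "Q (idx m) x = k * a ^ m"
        "Q (idx (m - 1)) x = k * (real m * a ^ (m - 1) * b)" using coef[OF x] by blast
      have a: "a \<noteq> 0" "k \<noteq> 0" using nz e(2) m(2) by (auto simp: power_0_left)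
      have s: "Q (idx (m - 1)) x / (real m * Q (idx m) x) = b / a"
        unfolding e(2,3) using quot[OF a(2,1), of b] by (simp add: mult_ac)
      have "a * (c * (b / a) + d) = a * d + b * c" using a by (simp add: field_simps)
      then show "Y (vector [d, c]) x = Q (idx m) x * (c * (Q (idx (m - 1)) x / (real m * Q (idx m) x)) + d) ^ (?n - 1)"
        unfolding s unfolding e(1) e(2) using m by (simp add: power_mult_distrib[symmetric] mult.assoc)
    qed
  qed
qed

context family_of_solutions
begin

text \<open>
  A paraconformal structure turns the covectors \<open>v \<mapsto> \<partial>Z/\<partial>t(v)\<close> at fixed \<open>t\<close> into binary forms.
  Their coefficients are again variations, hence solutions of the linearised equation.
\<close>

lemma max_null_curve:
  assumes pc: "paraconformal_structure M V g \<phi>"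
    and mn: "\<forall>(x, y) \<in> solution_points I M Z. max_null_hypersurface M V \<phi> (Z x) y" and t: "t \<in> M"
  obtains Q :: "'n \<Rightarrow> real \<Rightarrow> real" where "\<And>i. smooth_on I (Q i)"
    "\<And>i x. x \<in> I \<Longrightarrow> lin_op (\<lambda>_. 1) CARD('n) (F_along t) (Q i) x = 0"
    "\<And>x d k. x \<in> I \<Longrightarrow> (\<And>i. (\<Sum>k<CARD('n). d k * (lie (\<lambda>_. 1) ^^ k) (Q i) x) = 0)
       \<Longrightarrow> k < CARD('n) \<Longrightarrow> d k = 0"
    "\<And>x. x \<in> I \<Longrightarrow> max_null_form (\<chi> i. Q i x)"
proof -
  let ?n = "CARD('n)" and ?d = "\<lambda>_ :: real. 1 :: real"
  have d: "smooth_on I ?d" using I by simp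
  have tV: "t \<in> V t" using pc t by (auto simp: paraconformal_structure_def rank_two_bundle_def)
  then have \<phi>: "bij (\<phi> t t)" using pc t by (auto simp: paraconformal_structure_def)
  have "\<exists>q. (\<forall>v. variation t v x = form_pairing (\<phi> t t v) q) \<and> max_null_form q" if "x \<in> I" for x
  proof -
    have "(x, Z x t) \<in> solution_points I M Z" using that t by (auto simp: solution_points_def)
    then have "max_null_hypersurface M V \<phi> (Z x) (Z x t)" using mn by blast
    then show ?thesis using t tV unfolding max_null_hypersurface_def max_null_covector_def variation_def by blast
  qed
  then obtain q where q: "\<And>x v. x \<in> I \<Longrightarrow> variation t v x = form_pairing (\<phi> t t v) (q x)"
    "\<And>x. x \<in> I \<Longrightarrow> max_null_form (q x)" by metis
  define B where "B i = real ((?n - 1) choose pos i)" for i :: 'n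
  have B: "B i \<noteq> 0" for i :: 'n using pos_less[of i] by (auto simp: B_def)
  \<comment> \<open>The coefficients of \<open>q x\<close> are variations in the directions which \<open>\<phi>\<close> sends to monomials.\<close>
  define w where "w i = inv (\<phi> t t) (axis i 1)" for i
  have \<phi>w: "\<phi> t t (w i) = axis i 1" for i using \<phi> by (simp add: w_def bij_is_surj surj_f_inv_f)
  define Q where "Q i x = B i * variation t (w i) x" for i x
  have qi: "q x $ i = Q i x" if "x \<in> I" for x i
  proof -
    have "form_pairing (axis i 1) (q x) = (\<Sum>j\<in>UNIV. if j = i then q x $ i / B i else 0)"
      unfolding form_pairing_def by (rule sum.cong) (auto simp: axis_def B_def)
    then show ?thesis using q(1)[OF that, of "w i"] B[of i] by (simp add: \<phi>w Q_def)
  qed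
  have Qs: "smooth_on I (Q i)" for i unfolding Q_def[abs_def]
    by (intro smooth_on_mult smooth_on_const I variation_smooth[OF t])
  show ?thesis
  proof (rule that[OF Qs])
    show "lin_op ?d ?n (F_along t) (Q i) x = 0" if "x \<in> I" for i x
      using lin_op_linear_comb[OF d _ that, of "{i}" "\<lambda>i. variation t (w i)" ?n "F_along t" B]
        variation_smooth[OF t] linearised_equation[OF that t] by (simp add: Q_def[abs_def])
    show "max_null_form (\<chi> i. Q i x)" if "x \<in> I" for x
    proof -
      have "(\<chi> i. Q i x) = q x" using qi[OF that] by (simp add: vec_eq_iff)
      then show ?thesis using q(2)[OF that] by simp
    qed
    show "c k = 0" if x: "x \<in> I" and z: "\<And>i. (\<Sum>k<?n. c k * (lie ?d ^^ k) (Q i) x) = 0" and k: "k < ?n" for x c k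
    proof (rule variation_independent[OF x t _ k])
      fix v
      have e: "variation t v y = (\<Sum>i\<in>UNIV. (\<phi> t t v $ i / B i) * Q i y)" if "y \<in> I" for y
        using q(1)[OF that, of v] qi[OF that] by (simp add: form_pairing_def B_def)
      have "(lie ?d ^^ k) (variation t v) x = (\<Sum>i\<in>UNIV. (\<phi> t t v $ i / B i) * (lie ?d ^^ k) (Q i) x)" for k
        using lie_iter_cong[OF I(1) x e]
          lie_iter_linear_comb[OF d _ x, of UNIV Q k "\<lambda>i. \<phi> t t v $ i / B i"] Qs by simp
      then have "(\<Sum>k<?n. c k * (lie ?d ^^ k) (variation t v) x)
        = (\<Sum>k<?n. \<Sum>i\<in>UNIV. (\<phi> t t v $ i / B i) * (c k * (lie ?d ^^ k) (Q i) x))"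
        by (simp add: sum_distrib_left mult_ac)
      also have "\<dots> = (\<Sum>i\<in>UNIV. (\<phi> t t v $ i / B i) * (\<Sum>k<?n. c k * (lie ?d ^^ k) (Q i) x))"
        by (subst sum.swap) (simp add: sum_distrib_left)
      finally show "(\<Sum>k<?n. c k * (lie ?d ^^ k) (variation t v) x) = 0" using z by simp
    qed
  qed
qed

theorem conditions_of_paraconformal:
  assumes n: "2 \<le> CARD('n)" and pc: "paraconformal_structure M V g \<phi>"
    and mn: "\<forall>(x, y) \<in> solution_points I M Z. max_null_hypersurface M V \<phi> (Z x) y"
  shows "satisfies_conditions (condition_poly CARD('n)) F U"
  unfolding satisfies_conditions_iff[OF F]
proof (intro ballI)
  let ?n = "CARD('n)" and ?d = "\<lambda>_ :: real. 1 :: real"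
  fix k p assume k: "k \<in> {1..?n - 2}" and "p \<in> U"
  then obtain x0 t where x0: "x0 \<in> I" and t: "t \<in> M" and p: "p = solution_jet Z x0 t"
    using jets_onto by auto
  have "\<exists>J. x0 \<in> J \<and> J \<subseteq> I \<and> is_sympow ?n J ?d (F_along t)"
  proof (rule max_null_curve[OF pc mn t])
    fix Q :: "'n \<Rightarrow> real \<Rightarrow> real"
    assume Qs: "\<And>i. smooth_on I (Q i)" and QL: "\<And>i x. x \<in> I \<Longrightarrow> lin_op ?d ?n (F_along t) (Q i) x = 0"
      and Qind: "\<And>x d k. x \<in> I \<Longrightarrow> (\<And>i. (\<Sum>k<?n. d k * (lie ?d ^^ k) (Q i) x) = 0) \<Longrightarrow> k < ?n \<Longrightarrow> d k = 0"
      and null: "\<And>x. x \<in> I \<Longrightarrow> max_null_form (\<chi> i. Q i x)"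
    show "\<exists>J. x0 \<in> J \<and> J \<subseteq> I \<and> is_sympow ?n J ?d (F_along t)"
      by (rule is_sympow_of_max_null_curve[where Q = Q and I = I, OF n F_along_smooth[OF t] Qs QL _ null x0])
        (assumption | rule Qind)+
  qed
  then obtain J where J: "x0 \<in> J" "J \<subseteq> I" "is_sympow ?n J ?d (F_along t)" by blast
  then obtain p' where "smooth_on J (p' :: real \<Rightarrow> real)" unfolding is_sympow_def by blast
  then have Jo: "open J" by (rule smooth_on_open)
  have li: "lie ?d (\<lambda>x. x) x = 1" for x by (simp add: lie_def)
  have "\<forall>k\<in>{1..?n - 2}. \<forall>x\<in>J. deval (coef_derivs ?d (F_along t) x) (cond_exp ?n k) = 0"
    using conditions_iff_is_sympow[where f = "F_along t" and U = J and \<xi> = ?d and xh = "\<lambda>x. x", OF n]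
      J(3) Jo smooth_on_subset[OF F_along_smooth[OF t] Jo J(2)] li
      smooth_on_bounded_linear[OF bounded_linear_ident Jo] by simp
  then show "deval (coef_derivs (total_field F) (\<lambda>i. pd_y i F) p) (cond_exp ?n k) = 0"
    using k J(1) unfolding p conditions_along[OF t x0, symmetric] by blast
qed

end

section \<open>A linear system along an interval\<close>

text \<open>
  The Picard series converges on the whole interval because its terms are bounded by those of an
  exponential series.
\<close>

lemma linear_ode_exists:
  fixes B :: "real \<Rightarrow> 'e::banach \<Rightarrow> 'e"
  assumes ab: "a \<le> b" and lin: "\<And>x. x \<in> {a..b} \<Longrightarrow> linear (B x)"
    and K: "\<And>x y. x \<in> {a..b} \<Longrightarrow> norm (B x y) \<le> K * norm y" "0 \<le> K"
    and cont: "\<And>y. continuous_on {a..b} y \<Longrightarrow> continuous_on {a..b} (\<lambda>x. B x (y x))"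
  shows "\<exists>y. y a = y0 \<and> (\<forall>x\<in>{a..b}. (y has_vector_derivative B x (y x)) (at x within {a..b}))"
proof -
  \<comment> \<open>The terms of the Picard series\<close>
  define Y where "Y = rec_nat (\<lambda>x. y0) (\<lambda>k f x. integral {a..x} (\<lambda>s. B s (f s)))"
  have Y0: "Y 0 = (\<lambda>x. y0)" and YS: "Y (Suc k) = (\<lambda>x. integral {a..x} (\<lambda>s. B s (Y k s)))" for k
    by (simp_all add: Y_def)
  have c: "continuous_on {a..b} (Y k)" for k
  proof (induction k)
    case 0 then show ?case by (simp add: Y0)
  next
    case (Suc k)
    have "((\<lambda>u. integral {a..u} (\<lambda>s. B s (Y k s))) has_vector_derivative B x (Y k x)) (at x within {a..b})"
      if "x \<in> {a..b}" for x by (rule integral_has_vector_derivative[OF cont[OF Suc] that])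
    then show ?case
      unfolding YS by (meson continuous_on_eq_continuous_within has_vector_derivative_continuous)
  qed
  have dY: "(Y (Suc k) has_vector_derivative B x (Y k x)) (at x within {a..b})" if "x \<in> {a..b}" for k x
    unfolding YS by (rule integral_has_vector_derivative[OF cont[OF c] that])
  have bound: "norm (Y k x) \<le> norm y0 * (K * (x - a)) ^ k / fact k" if "x \<in> {a..b}" for k x
    using that
  proof (induction k arbitrary: x)
    case 0 then show ?case by (simp add: Y0)
  next
    case (Suc k)
    show ?case
    proof (cases "x = a")
      case True then show ?thesis by (simp add: YS)
    next
      case False
      then have ax: "a < x" using Suc.prems by simp
      define \<phi> where "\<phi> s = norm y0 * (K * (s - a)) ^ Suc k / fact (Suc k)" for s
      have "norm (Y (Suc k) x - Y (Suc k) a) \<le> \<phi> x - \<phi> a"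
      proof (rule differentiable_bound_general[OF ax, where f' = "\<lambda>s. B s (Y k s)" and \<phi>' = "\<lambda>s. K * (norm y0 * (K * (s - a)) ^ k / fact k)"])
        show "continuous_on {a..x} (Y (Suc k))" using Suc.prems by (intro continuous_on_subset[OF c]) auto
        show "continuous_on {a..x} \<phi>" unfolding \<phi>_def by (intro continuous_intros) simp
        fix s assume s: "a < s" "s < x"
        then have sI: "s \<in> {a..b}" using Suc.prems by auto
        show "(Y (Suc k) has_vector_derivative B s (Y k s)) (at s)"
          using dY[OF sI, of k] s Suc.prems at_within_interior[of s "{a..b}"] by (simp add: interior_atLeastAtMost_real)
        have "(\<phi> has_real_derivative K * (norm y0 * (K * (s - a)) ^ k / fact k)) (at s)"
          unfolding \<phi>_def by (rule derivative_eq_intros refl | simp)+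
        then show "(\<phi> has_vector_derivative K * (norm y0 * (K * (s - a)) ^ k / fact k)) (at s)"
          by (simp add: has_real_derivative_iff_has_vector_derivative)
        show "norm (B s (Y k s)) \<le> K * (norm y0 * (K * (s - a)) ^ k / fact k)"
          using K(1)[OF sI, of "Y k s"] mult_left_mono[OF Suc.IH[OF sI] K(2)] by linarith
      qed
      then show ?thesis by (simp add: YS \<phi>_def)
    qed
  qed
  define c where "c k = norm y0 * (K * (b - a)) ^ k / fact k" for k
  have sc: "summable c"
  proof -
    have "summable (\<lambda>k. norm y0 * ((K * (b - a)) ^ k /\<^sub>R fact k))"
      by (intro summable_mult summable_exp_generic)
    then show ?thesis by (simp add: c_def[abs_def] divide_inverse mult_ac)
  qed
  have bc: "norm (Y k x) \<le> c k" if "x \<in> {a..b}" for k x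
  proof -
    have "norm y0 * (K * (x - a)) ^ k / fact k \<le> c k"
      unfolding c_def using that K(2) by (intro divide_right_mono mult_left_mono power_mono) auto
    then show ?thesis using bound[OF that, of k] by linarith
  qed
  define y where "y x = suminf (\<lambda>k. Y k x)" for x
  have unif: "uniform_limit {a..b} (\<lambda>N x. \<Sum>k<N. Y k x) y sequentially"
    unfolding y_def by (rule Weierstrass_m_test[OF bc sc])
  have sums: "(\<lambda>k. Y k x) sums y x" if "x \<in> {a..b}" for x
    unfolding y_def using summable_comparison_test'[OF sc bc[OF that]] by (rule summable_sums)
  define D where "D k x h = (case k of 0 \<Rightarrow> 0 | Suc k \<Rightarrow> h *\<^sub>R B x (Y k x))" for k x and h :: real
  have Dsum: "(\<Sum>k<Suc N. D k x h) = h *\<^sub>R B x (\<Sum>k<N. Y k x)" if "x \<in> {a..b}" for N x h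
    unfolding sum.lessThan_Suc_shift by (simp add: D_def linear_sum[OF lin[OF that]] scaleR_sum_right)
  have "\<exists>g. \<forall>x\<in>{a..b}. (\<lambda>n. Y n x) sums (g x) \<and> (g has_derivative (\<lambda>h. h *\<^sub>R B x (y x))) (at x within {a..b})"
  proof (rule has_derivative_series[where f' = D])
    show "convex {a..b}" by simp
    show "(Y n has_derivative D n x) (at x within {a..b})" if "x \<in> {a..b}" for n x
    proof (cases n)
      case 0
      have "D 0 x = (\<lambda>h. 0)" by (rule ext) (simp add: D_def)
      then show ?thesis using 0 by (simp add: Y0)
    next
      case (Suc k)
      have "D (Suc k) x = (\<lambda>h. h *\<^sub>R B x (Y k x))" by (rule ext) (simp add: D_def)
      then show ?thesis using dY[OF that, of k] Suc by (simp add: has_vector_derivative_def)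
    qed
    show "\<forall>\<^sub>F n in sequentially. \<forall>x\<in>{a..b}. \<forall>h. norm ((\<Sum>i<n. D i x h) - h *\<^sub>R B x (y x)) \<le> e * norm h" if e: "e > 0" for e
    proof -
      have "e / (K + 1) > 0" using e K(2) by simp
      then obtain N where N: "\<And>n x. N \<le> n \<Longrightarrow> x \<in> {a..b} \<Longrightarrow> dist (\<Sum>k<n. Y k x) (y x) < e / (K + 1)"
        using unif unfolding uniform_limit_iff eventually_sequentially by blast
      have "norm ((\<Sum>i<n. D i x h) - h *\<^sub>R B x (y x)) \<le> e * norm h" if n: "Suc N \<le> n" and x: "x \<in> {a..b}" for n x h
      proof -
        obtain r where r: "n = Suc r" "N \<le> r" using n by (cases n) auto
        have "(\<Sum>i<n. D i x h) - h *\<^sub>R B x (y x) = h *\<^sub>R B x ((\<Sum>k<r. Y k x) - y x)"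
          unfolding r(1) Dsum[OF x] by (simp add: linear_diff[OF lin[OF x]] scaleR_diff_right)
        also have "norm \<dots> \<le> \<bar>h\<bar> * (K * norm ((\<Sum>k<r. Y k x) - y x))"
          using K(1)[OF x] by (simp add: mult_left_mono)
        also have "\<dots> \<le> \<bar>h\<bar> * ((K + 1) * (e / (K + 1)))"
          using N[OF r(2) x] K(2) by (intro mult_left_mono mult_mono) (auto simp: dist_norm)
        also have "\<dots> = e * norm h" using K(2) by simp
        finally show ?thesis .
      qed
      then show ?thesis unfolding eventually_sequentially by blast
    qed
    show "a \<in> {a..b}" using ab by simp
    show "(\<lambda>n. Y n a) sums y a" using sums ab by simp
  qed
  then obtain g where g: "\<And>x. x \<in> {a..b} \<Longrightarrow> (\<lambda>n. Y n x) sums (g x)"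
    "\<And>x. x \<in> {a..b} \<Longrightarrow> (g has_derivative (\<lambda>h. h *\<^sub>R B x (y x))) (at x within {a..b})" by blast
  have gy: "g x = y x" if "x \<in> {a..b}" for x using sums_unique2[OF g(1)[OF that] sums[OF that]] .
  have "(\<lambda>k. Y k a) sums y0"
  proof -
    have "Y k a = (if k = 0 then y0 else 0)" for k by (cases k) (simp_all add: Y0 YS)
    then show ?thesis using sums_single[of 0 "\<lambda>_. y0"] by simp
  qed
  then have "g a = y0" using sums_unique2 g(1)[of a] ab by auto
  then show ?thesis using g(2) gy by (intro exI[of _ g]) (auto simp: has_vector_derivative_def)
qed

text \<open>
  These are the equations under which \<open>\<alpha> w + \<beta> w'\<close> is constant for every solution \<open>w\<close> of
  \<open>w'' + p w' + q w = 0\<close>; the factor \<open>h\<close> allows for a reparametrisation.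
\<close>

lemma dual_solution_exists:
  fixes p q :: "real \<Rightarrow> real"
  assumes p: "continuous_on {0..1} p" and q: "continuous_on {0..1} q"
  obtains \<alpha> \<beta> where "\<alpha> 0 = 1" "\<beta> 0 = (0::real)"
    "\<And>s. s \<in> {0..1} \<Longrightarrow> (\<alpha> has_real_derivative h * (q s * \<beta> s)) (at s within {0..1})"
    "\<And>s. s \<in> {0..1} \<Longrightarrow> (\<beta> has_real_derivative h * (p s * \<beta> s - \<alpha> s)) (at s within {0..1})"
proof -
  define B where "B s y = (h * (q s * snd y), h * (p s * snd y - fst y))" for s and y :: "real \<times> real"
  obtain P where "\<forall>s\<in>{0..1}. \<bar>p s\<bar> \<le> P"
    using compact_imp_bounded[OF compact_continuous_image[OF p compact_Icc]] unfolding bounded_iff by auto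
  then have P: "\<And>s. s \<in> {0..1} \<Longrightarrow> \<bar>p s\<bar> \<le> P" by blast
  obtain Q where "\<forall>s\<in>{0..1}. \<bar>q s\<bar> \<le> Q"
    using compact_imp_bounded[OF compact_continuous_image[OF q compact_Icc]] unfolding bounded_iff by auto
  then have Q: "\<And>s. s \<in> {0..1} \<Longrightarrow> \<bar>q s\<bar> \<le> Q" by blast
  define K where "K = \<bar>h\<bar> * (Q + P + 1)"
  have PQ: "0 \<le> P" "0 \<le> Q" using P[of 0] Q[of 0] by auto
  have "\<exists>y. y 0 = (1, 0) \<and> (\<forall>x\<in>{0..1}. (y has_vector_derivative B x (y x)) (at x within {0..1}))"
  proof (rule linear_ode_exists)
    show "linear (B x)" for x
      by (rule linearI) (simp_all add: B_def algebra_simps)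
    show "0 \<le> K" using PQ by (simp add: K_def)
    show "norm (B x y) \<le> K * norm y" if "x \<in> {0..1}" for x y
    proof -
      have "norm (B x y) \<le> \<bar>h * (q x * snd y)\<bar> + \<bar>h * (p x * snd y - fst y)\<bar>"
        unfolding B_def using norm_Pair_le[of "h * (q x * snd y)" "h * (p x * snd y - fst y)"] by simp
      also have "\<dots> \<le> \<bar>h\<bar> * (Q * norm y) + \<bar>h\<bar> * (P * norm y + norm y)"
      proof (intro add_mono)
        have s: "\<bar>snd y\<bar> \<le> norm y" "\<bar>fst y\<bar> \<le> norm y" 
          using norm_snd_le[of "snd y" "fst y"] norm_fst_le[of "fst y" "snd y"] by simp_all
        show "\<bar>h * (q x * snd y)\<bar> \<le> \<bar>h\<bar> * (Q * norm y)"
          unfolding abs_mult using Q[OF that] s PQ by (intro mult_left_mono mult_mono) auto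
        have "\<bar>p x * snd y - fst y\<bar> \<le> \<bar>p x\<bar> * \<bar>snd y\<bar> + \<bar>fst y\<bar>"
          using abs_triangle_ineq4[of "p x * snd y" "fst y"] by (simp add: abs_mult)
        also have "\<dots> \<le> P * norm y + norm y" using P[OF that] s PQ by (intro add_mono mult_mono) auto
        finally show "\<bar>h * (p x * snd y - fst y)\<bar> \<le> \<bar>h\<bar> * (P * norm y + norm y)"
          unfolding abs_mult by (intro mult_left_mono) auto
      qed
      also have "\<dots> = K * norm y" by (simp add: K_def algebra_simps)
      finally show ?thesis .
    qed
    show "continuous_on {0..1} (\<lambda>x. B x (y x))" if "continuous_on {0..1} y" for y
      unfolding B_def by (intro continuous_intros p q that)
  qed simp
  then obtain y where y: "y 0 = (1, 0)" "\<And>x. x \<in> {0..1} \<Longrightarrow> (y has_vector_derivative B x (y x)) (at x within {0..1})"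
    by blast
  show ?thesis
  proof (rule that[of "\<lambda>s. fst (y s)" "\<lambda>s. snd (y s)"])
    fix s :: real assume s: "s \<in> {0..1}"
    show "((\<lambda>s. fst (y s)) has_real_derivative h * (q s * snd (y s))) (at s within {0..1})"
      using bounded_linear.has_vector_derivative[OF bounded_linear_fst y(2)[OF s]]
      by (simp add: has_real_derivative_iff_has_vector_derivative B_def)
    show "((\<lambda>s. snd (y s)) has_real_derivative h * (p s * snd (y s) - fst (y s))) (at s within {0..1})"
      using bounded_linear.has_vector_derivative[OF bounded_linear_snd y(2)[OF s]]
      by (simp add: has_real_derivative_iff_has_vector_derivative B_def)
  qed (simp_all add: y)
qed

text \<open>
  The derivative of the pairing in \<open>sympow_chain_dual_pairing\<close>. The terms with \<open>p\<close> cancel, and those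
  with and without \<open>q\<close> each form a telescoping sum.
\<close>

lemma dual_pairing_telescopes:
  fixes R :: "nat \<Rightarrow> real" and p q \<alpha> \<beta> :: real and m :: nat
  defines "DR \<equiv> \<lambda>i. R (Suc i) - real i * p * R i - real i * (real m - real i + 1) * q * R (i - 1)"
  assumes "R (Suc m) = 0"
  shows "(\<Sum>i\<le>m. (DR i * \<alpha> ^ (m - i) * \<beta> ^ i + R i * (real (m - i) * \<alpha> ^ (m - i - 1) * (q * \<beta>) * \<beta> ^ i
     + \<alpha> ^ (m - i) * (real i * \<beta> ^ (i - 1) * (p * \<beta> - \<alpha>)))) / fact i) = 0" (is "(\<Sum>i\<le>m. ?t i / fact i) = 0")
proof -
  define T where "T i = (if i = 0 then 0 else R i * \<alpha> ^ (Suc m - i) * \<beta> ^ (i - 1) / fact (i - 1))" for i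
  define W where "W i = real i * (real m - real i + 1) * q * R (i - 1) * \<alpha> ^ (m - i) * \<beta> ^ i / fact i" for i
  have "(\<Sum>i\<le>m. ?t i / fact i) = (\<Sum>i\<le>m. (T (Suc i) + W (Suc i)) - (T i + W i))"
  proof (rule sum.cong[OF refl])
    fix i assume "i \<in> {..m}"
    then have i: "i \<le> m" by simp
    have T1: "T (Suc i) = R (Suc i) * \<alpha> ^ (m - i) * \<beta> ^ i / fact i" by (simp add: T_def)
    have T0: "T i = R i * \<alpha> ^ (m - i) * (real i * \<beta> ^ (i - 1) * \<alpha>) / fact i"
    proof (cases i)
      case 0 then show ?thesis by (simp add: T_def)
    next
      case (Suc r)
      then have "Suc m - i = Suc (m - i)" using i by simp
      moreover have "real (Suc r) / fact (Suc r) = 1 / (fact r :: real)" by (simp del: of_nat_Suc)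
      moreover have "R i * \<alpha> ^ (m - i) * (real i * \<beta> ^ (i - 1) * \<alpha>) / fact i
        = (real (Suc r) / fact (Suc r)) * (R i * \<alpha> ^ (m - i) * \<beta> ^ r * \<alpha>)"
        using Suc by simp
      ultimately show ?thesis using Suc by (simp add: T_def)
    qed
    have W1: "W (Suc i) = R i * (real (m - i) * \<alpha> ^ (m - i - 1) * (q * \<beta>) * \<beta> ^ i) / fact i"
    proof -
      have "real (Suc i) / fact (Suc i) = 1 / (fact i :: real)" by (simp del: of_nat_Suc)
      moreover have "W (Suc i) = (real (Suc i) / fact (Suc i)) * ((real m - real i) * q * R i * \<alpha> ^ (m - Suc i) * \<beta> ^ Suc i)"
        by (simp add: W_def)
      ultimately show ?thesis using i by (simp add: of_nat_diff mult_ac)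
    qed
    have pp: "R i * \<alpha> ^ (m - i) * (real i * \<beta> ^ (i - 1) * (p * \<beta>)) = real i * p * R i * \<alpha> ^ (m - i) * \<beta> ^ i"
      by (cases i) simp_all
    have "?t i = R (Suc i) * \<alpha> ^ (m - i) * \<beta> ^ i + R i * (real (m - i) * \<alpha> ^ (m - i - 1) * (q * \<beta>) * \<beta> ^ i)
        - R i * \<alpha> ^ (m - i) * (real i * \<beta> ^ (i - 1) * \<alpha>)
        - real i * (real m - real i + 1) * q * R (i - 1) * \<alpha> ^ (m - i) * \<beta> ^ i
        + (R i * \<alpha> ^ (m - i) * (real i * \<beta> ^ (i - 1) * (p * \<beta>)) - real i * p * R i * \<alpha> ^ (m - i) * \<beta> ^ i)"
      by (simp add: DR_def left_diff_distrib right_diff_distrib distrib_left mult.assoc)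
    then show "?t i / fact i = (T (Suc i) + W (Suc i)) - (T i + W i)"
      unfolding T1 T0 W1 W_def[of i] pp by (simp add: add_divide_distrib diff_divide_distrib)
  qed
  also have "\<dots> = (T (Suc m) + W (Suc m)) - (T 0 + W 0)"
    using sum_lessThan_telescope[of "\<lambda>i. T i + W i" "Suc m"] by (simp add: lessThan_Suc_atMost)
  also have "\<dots> = 0" using assms by (simp add: T_def W_def)
  finally show ?thesis .
qed

text \<open>
  If \<open>\<alpha> w + \<beta> w'\<close> is constant for all solutions \<open>w\<close>, then so is its power, and for \<open>R i = S\<^sub>i (w^m)\<close> the
  expansion of the power is the sum on the right. Starting with \<open>\<alpha> = 1\<close> and \<open>\<beta> = 0\<close> at \<open>x1\<close> expresses the
  value at \<open>x1\<close> by the values of the chain at \<open>x0\<close>, for every chain that ends with 0.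
\<close>

lemma sympow_chain_dual_pairing:
  fixes p q :: "real \<Rightarrow> real"
  assumes p: "smooth_on I p" and q: "smooth_on I q"
    and I: "is_interval I" and x0: "x0 \<in> I" and x1: "x1 \<in> I"
  obtains \<alpha> \<beta> where
    "\<And>R. sympow_chain I (\<lambda>_. 1) (real m) p q R \<Longrightarrow> (\<And>x. x \<in> I \<Longrightarrow> R (Suc m) x = 0) \<Longrightarrow>
       R 0 x1 = (\<Sum>i\<le>m. R i x0 * \<alpha> ^ (m - i) * \<beta> ^ i / fact i)"
proof -
  \<comment> \<open>The segment from \<open>x1\<close> to \<open>x0\<close> is parametrised by \<open>{0..1}\<close>, whatever the order of the two points.\<close>
  define h where "h = x0 - x1"
  define \<gamma> where "\<gamma> s = x1 + s * h" for s
  have \<gamma>I: "\<gamma> s \<in> I" if "s \<in> {0..1}" for s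
  proof -
    have "\<gamma> s = (1 - s) *\<^sub>R x1 + s *\<^sub>R x0" by (simp add: \<gamma>_def h_def algebra_simps)
    then show ?thesis
      using convexD_alt[of I x1 x0 s] I x0 x1 that by (simp add: is_interval_convex_1)
  qed
  have \<gamma>c: "continuous_on {0..1} \<gamma>" unfolding \<gamma>_def by (intro continuous_intros)
  have pc: "continuous_on {0..1} (\<lambda>s. f (\<gamma> s))" if "smooth_on I f" for f :: "real \<Rightarrow> real"
  proof (rule continuous_on_compose2[OF _ \<gamma>c])
    show "continuous_on I f"
      using smooth_on_differentiable_at[OF that] by (intro continuous_at_imp_continuous_on ballI differentiable_imp_continuous_within)
    show "\<gamma> ` {0..1} \<subseteq> I" using \<gamma>I by blast
  qed
  obtain \<alpha> \<beta> where \<alpha>\<beta>: "\<alpha> 0 = 1" "\<beta> 0 = (0::real)"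
    "\<And>s. s \<in> {0..1} \<Longrightarrow> (\<alpha> has_real_derivative h * (q (\<gamma> s) * \<beta> s)) (at s within {0..1})"
    "\<And>s. s \<in> {0..1} \<Longrightarrow> (\<beta> has_real_derivative h * (p (\<gamma> s) * \<beta> s - \<alpha> s)) (at s within {0..1})"
    using dual_solution_exists[OF pc[OF p] pc[OF q], of h] by blast
  show ?thesis
  proof (rule that)
    fix R assume R: "sympow_chain I (\<lambda>_. 1) (real m) p q R" and top: "\<And>x. x \<in> I \<Longrightarrow> R (Suc m) x = 0"
    define H where "H s = (\<Sum>i\<le>m. R i (\<gamma> s) * \<alpha> s ^ (m - i) * \<beta> s ^ i / fact i)" for s
    define DR where "DR i s = R (Suc i) (\<gamma> s) - real i * p (\<gamma> s) * R i (\<gamma> s)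
      - real i * (real m - real i + 1) * q (\<gamma> s) * R (i - 1) (\<gamma> s)" for i s
    define DH where "DH i s = (DR i s * \<alpha> s ^ (m - i) * \<beta> s ^ i
      + R i (\<gamma> s) * (real (m - i) * \<alpha> s ^ (m - i - 1) * (q (\<gamma> s) * \<beta> s) * \<beta> s ^ i
          + \<alpha> s ^ (m - i) * (real i * \<beta> s ^ (i - 1) * (p (\<gamma> s) * \<beta> s - \<alpha> s)))) / fact i" for i s
    have dR: "((\<lambda>s. R i (\<gamma> s)) has_real_derivative h * DR i s) (at s within {0..1})" if s: "s \<in> {0..1}" for i s
    proof -
      have Rs: "smooth_on I (R i)" using R by (simp add: sympow_chain_def)
      have "(R i has_real_derivative lie (\<lambda>_. 1) (R i) (\<gamma> s)) (at (\<gamma> s))"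
        using DERIV_along_line[OF Rs, of 0 "\<gamma> s" 1] \<gamma>I[OF s] by (simp add: lie_def)
      moreover have "(\<gamma> has_real_derivative h) (at s within {0..1})"
        unfolding \<gamma>_def by (auto intro!: derivative_eq_intros)
      ultimately have "((\<lambda>s. R i (\<gamma> s)) has_real_derivative lie (\<lambda>_. 1) (R i) (\<gamma> s) * h) (at s within {0..1})"
        by (rule DERIV_chain2)
      moreover have "R (Suc i) (\<gamma> s) = lie (\<lambda>_. 1) (R i) (\<gamma> s) + real i * p (\<gamma> s) * R i (\<gamma> s)
         + real i * (real m - real i + 1) * q (\<gamma> s) * R (i - 1) (\<gamma> s)"
        using R \<gamma>I[OF s] unfolding sympow_chain_def by blast
      ultimately show ?thesis by (simp add: DR_def mult.commute)
    qed
    have "(H has_real_derivative 0) (at s within {0..1})" if s: "s \<in> {0..1}" for s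
    proof -
      have "(H has_real_derivative (\<Sum>i\<le>m. h * DH i s)) (at s within {0..1})"
        unfolding H_def[abs_def]
      proof (rule DERIV_sum)
        fix i
        show "((\<lambda>s. R i (\<gamma> s) * \<alpha> s ^ (m - i) * \<beta> s ^ i / fact i) has_real_derivative h * DH i s) (at s within {0..1})"
          by (rule DERIV_cong[OF DERIV_cdivide[OF DERIV_mult[OF DERIV_mult[OF dR[OF s]
                  DERIV_power[OF \<alpha>\<beta>(3)[OF s]]] DERIV_power[OF \<alpha>\<beta>(4)[OF s]]]]])
            (simp add: DH_def algebra_simps)
      qed
      moreover have "(\<Sum>i\<le>m. DH i s) = 0"
        unfolding DH_def DR_def by (rule dual_pairing_telescopes) (rule top[OF \<gamma>I[OF s]])
      ultimately show ?thesis by (simp add: sum_distrib_left[symmetric])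
    qed
    then have "\<exists>c. \<forall>s\<in>{0..1}. H s = c" by (intro has_field_derivative_zero_constant) simp_all
    then have "H 0 = H 1" by auto
    moreover have "H 0 = R 0 x1"
    proof -
      have "H 0 = (\<Sum>i\<le>m. if i = 0 then R 0 x1 else 0)"
        unfolding H_def by (rule sum.cong) (auto simp: \<alpha>\<beta> \<gamma>_def power_0_left)
      then show ?thesis by simp
    qed
    moreover have "\<gamma> 1 = x0" by (simp add: \<gamma>_def h_def)
    ultimately show "R 0 x1 = (\<Sum>i\<le>m. R i x0 * \<alpha> 1 ^ (m - i) * \<beta> 1 ^ i / fact i)" by (simp add: H_def)
  qed
qed

section \<open>The conditions yield a paraconformal structure\<close>

context family_of_solutions
begin

definition coef_along :: "nat \<Rightarrow> nat \<Rightarrow> real ^ 'n \<Rightarrow> real \<Rightarrow> real" where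
  "coef_along i j t x = sympow_coef (\<lambda>_. 1) (real (CARD('n) - 1)) (canon_p (\<lambda>_. 1) CARD('n) (F_along t))
     (canon_q (\<lambda>_. 1) CARD('n) (F_along t)) i j x"

text \<open>
  The binary form attached to the tangent vector \<open>v\<close> at \<open>t\<close>: its coefficients are \<open>S\<^sub>i u(x0) / i!\<close> for the
  variation \<open>u\<close> in the direction \<open>v\<close>. They are written through the coefficients of \<open>S\<^sub>i\<close> to exhibit the
  smooth dependence on \<open>t\<close>.
\<close>

definition frame :: "real \<Rightarrow> real ^ 'n \<Rightarrow> real ^ 'n \<Rightarrow> real ^ 'n" where
  "frame x0 t v = (\<chi> i. (\<Sum>j\<le>pos i. coef_along (pos i) j t x0 * (lie (\<lambda>_. 1) ^^ j) (variation t v) x0) / fact (pos i))"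

lemma coef_along_smooth_t:
  assumes x: "x \<in> I" shows "smooth_on M (\<lambda>t. coef_along i j t x)"
proof (rule smooth_on_cong)
  have e: "\<lbrakk>t \<in> M\<rbrakk> \<Longrightarrow> solution_jet Z x t \<in> U" for t using jets_in[OF x] .
  show "smooth_on M (\<lambda>t. deval (coef_derivs (total_field F) (\<lambda>i. pd_y i F) (solution_jet Z x t))
     (sympow_coef_exp (real (CARD('n) - 1)) (p_exp CARD('n)) (q_exp CARD('n)) i j))"
    by (rule smooth_on_compose[OF solution_jet_smooth_t[OF x]
          smooth_on_deval[OF smooth_on_total_field[OF F] smooth_on_pd_y[OF F]]]) (use e in auto)
  show "deval (coef_derivs (total_field F) (\<lambda>i. pd_y i F) (solution_jet Z x t))
     (sympow_coef_exp (real (CARD('n) - 1)) (p_exp CARD('n)) (q_exp CARD('n)) i j) = coef_along i j t x" if t: "t \<in> M" for t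
    unfolding coef_along_def sympow_coef_canonical[where f = "F_along t", OF smooth_on_const[OF I(1)] F_along_smooth[OF t] x]
      conditions_along[OF t x] ..
qed

lemma frame_smooth:
  assumes x0: "x0 \<in> I" shows "smooth_on M (\<lambda>t. frame x0 t v)"
proof (rule smooth_on_vec[OF M])
  fix i
  show "smooth_on M (\<lambda>t. frame x0 t v $ i)"
    unfolding frame_def vec_lambda_beta
    by (intro smooth_on_divide smooth_on_sum smooth_on_mult coef_along_smooth_t[OF x0] variation_deriv_smooth_t[OF x0] smooth_on_const M)
      simp
qed

lemma variation_deriv_linear:
  assumes x: "x \<in> I" and t: "t \<in> M"
  shows "linear (\<lambda>v. (lie (\<lambda>_. 1) ^^ k) (variation t v) x)"
proof -
  have xt: "(x, t) \<in> I \<times> M" using x t by simp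
  have lin: "linear (frechet_derivative (Z_deriv k) (at (x, t)))"
    by (rule linear_frechet_derivative[OF smooth_on_differentiable_at[OF Z_deriv_smooth xt]])
  have "linear (\<lambda>v :: real ^ 'n. (0 :: real, v))" by (rule linearI) auto
  from linear_compose[OF this lin] show ?thesis
    unfolding variation_deriv[OF x t] lie_def by (simp add: o_def)
qed

text \<open>
  The \<open>n\<close> differentials of \<open>Z, Z', \<dots>\<close> are independent, hence a basis of the dual space.
\<close>

lemma variation_deriv_injective:
  assumes x: "x \<in> I" and t: "t \<in> M" and v: "\<And>k. k < CARD('n) \<Longrightarrow> (lie (\<lambda>_. 1) ^^ k) (variation t v) x = 0"
  shows "v = 0"
proof -
  define A :: "real ^ 'n \<Rightarrow> real ^ 'n" where "A v = (\<chi> i. (lie (\<lambda>_. 1) ^^ pos i) (variation t v) x)" for v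
  have lin: "linear A"
    using variation_deriv_linear[OF x t] unfolding A_def linear_iff by (simp add: vec_eq_iff)
  have "surj A"
  proof (rule ccontr)
    assume "\<not> surj A"
    moreover have "span (range A) = range A"
      using linear_span_image[OF lin, of UNIV] unfolding span_UNIV by simp
    ultimately have "span (range A) \<noteq> UNIV" by metis
    then obtain c where "c \<noteq> 0" and "\<forall>y\<in>span (range A). c \<bullet> y = 0"
      using span_not_UNIV_orthogonal by blast
    then have c: "c \<noteq> 0" "\<And>y. y \<in> range A \<Longrightarrow> c \<bullet> y = 0"
      using span_base by blast+
    have "(\<Sum>k<CARD('n). c $ idx k * (lie (\<lambda>_. 1) ^^ k) (variation t v) x) = 0" for v
    proof -
      have "c \<bullet> A v = (\<Sum>i\<in>(UNIV :: 'n set). c $ idx (pos i) * (lie (\<lambda>_. 1) ^^ pos i) (variation t v) x)"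
        by (simp add: inner_vec_def A_def)
      also have "\<dots> = (\<Sum>k<CARD('n). c $ idx k * (lie (\<lambda>_. 1) ^^ k) (variation t v) x)" by (rule sum_idx)
      finally show ?thesis using c(2)[of "A v"] by simp
    qed
    from variation_independent[OF x t this] have "c $ idx k = 0" if "k < CARD('n)" for k using that by blast
    then have "c $ i = 0" for i using pos_less[of i] by (metis idx_pos)
    then show False using c(1) by (simp add: vec_eq_iff)
  qed
  then have "inj A" by (rule linear_surjective_imp_injective[OF lin]) (rule refl)
  moreover have "A v = 0" using v pos_less[where 'n = 'n] by (simp add: A_def vec_eq_iff)
  ultimately show ?thesis using linear_0[OF lin] by (metis injD)
qed

lemma frame_linear:
  assumes x: "x \<in> I" and t: "t \<in> M"
  shows "linear (frame x t)"
proof (rule linearI)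
  note l = variation_deriv_linear[OF x t]
  show "frame x t (v + w) = frame x t v + frame x t w" for v w
    using linear_add[OF l] by (simp add: frame_def vec_eq_iff distrib_left sum.distrib add_divide_distrib)
  show "frame x t (c *\<^sub>R v) = c *\<^sub>R frame x t v" for c v
    using linear_cmul[OF l] by (simp add: frame_def vec_eq_iff sum_distrib_left mult_ac)
qed

text \<open>
  The operators \<open>S\<^sub>i\<close> arise from the derivatives by a triangular change with 1 on the diagonal.
\<close>

lemma frame_bij:
  assumes x: "x \<in> I" and t: "t \<in> M"
  shows "bij (frame x t)"
proof -
  note lin = frame_linear[OF x t]
  have "v = 0" if v: "frame x t v = 0" for v
  proof (rule variation_deriv_injective[OF x t])
    fix k assume "k < CARD('n)"
    then show "(lie (\<lambda>_. 1) ^^ k) (variation t v) x = 0"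
    proof (induction k rule: less_induct)
      case (less k)
      have "frame x t v $ idx k = 0" using v by simp
      then have "(\<Sum>j\<le>k. coef_along k j t x * (lie (\<lambda>_. 1) ^^ j) (variation t v) x) = 0"
        using less.prems by (simp add: frame_def)
      moreover have "{..k} = insert k {..<k}" by auto
      moreover have "(\<Sum>j<k. coef_along k j t x * (lie (\<lambda>_. 1) ^^ j) (variation t v) x) = 0"
        using less by (intro sum.neutral) simp
      ultimately show ?case by (simp add: coef_along_def)
    qed
  qed
  then have "inj (frame x t)" using linear_injective_0[OF lin] by blast
  then show ?thesis using linear_injective_imp_surjective[OF lin] by (simp add: bij_def)
qed

theorem frame_max_null:
  assumes n: "2 \<le> CARD('n)" and C: "satisfies_conditions (condition_poly CARD('n)) F U"
    and x0: "x0 \<in> I" and x1: "x1 \<in> I" and t: "t \<in> M"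
  shows "\<exists>q. (\<forall>v. variation t v x1 = form_pairing (frame x0 t v) q) \<and> max_null_form q"
proof -
  let ?n = "CARD('n)" and ?d = "\<lambda>_ :: real. 1 :: real"
  let ?m = "?n - 1"
  let ?P = "canon_p ?d ?n (F_along t)" and ?Q = "canon_q ?d ?n (F_along t)"
  have d: "smooth_on I ?d" using I by simp
  have PQ: "smooth_on I ?P" "smooth_on I ?Q"
    using smooth_on_canon[where f = "F_along t", OF d F_along_smooth[OF t]] by auto
  have n1: "Suc ?m = ?n" using n by simp
  have "\<forall>k\<in>{1..?n - 2}. \<forall>x\<in>I. deval (coef_derivs ?d (F_along t) x) (cond_exp ?n k) = 0"
    using C conditions_along[OF t] jets_in[OF _ t] unfolding satisfies_conditions_iff[OF F] by auto
  then have A: "\<forall>x\<in>I. \<forall>j<?n. sympow_coef ?d (real ?m) ?P ?Q ?n j x = - F_along t j x"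
    using conditions_iff_sympow_coef[where f = "F_along t", OF n d F_along_smooth[OF t]] by blast
  have li: "lie ?d (\<lambda>x. x) x = 1" for x by (simp add: lie_def)
  have L: "sympow_op ?d (real ?m) ?P ?Q ?n u x = lin_op ?d ?n (F_along t) u x" if "smooth_on I u" "x \<in> I" for u x
    using sympow_op_eq_lin_op_iff[OF smooth_on_bounded_linear[OF bounded_linear_ident I(1)] li d PQ, of "real ?m" ?n "F_along t"] A that
    by blast
  define R where "R v i = sympow_op ?d (real ?m) ?P ?Q i (variation t v)" for v i
  have ch: "sympow_chain I ?d (real ?m) ?P ?Q (R v)" for v
    unfolding R_def[abs_def] by (rule sympow_chain_op[OF d PQ variation_smooth[OF t]])
  have top: "R v (Suc ?m) x = 0" if "x \<in> I" for v x
    using L[OF variation_smooth[OF t] that] linearised_equation[OF that t] unfolding n1 R_def by simp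
  obtain \<alpha> \<beta> where ab: "\<And>R. sympow_chain I ?d (real ?m) ?P ?Q R \<Longrightarrow> (\<And>x. x \<in> I \<Longrightarrow> R (Suc ?m) x = 0) \<Longrightarrow>
       R 0 x1 = (\<Sum>i\<le>?m. R i x0 * \<alpha> ^ (?m - i) * \<beta> ^ i / fact i)"
    using sympow_chain_dual_pairing[OF PQ I(2) x0 x1] by blast
  have Rf: "frame x0 t v $ i = R v (pos i) x0 / fact (pos i)" for v i
    unfolding R_def sympow_op_expand[OF d PQ variation_smooth[OF t] x0] by (simp add: frame_def coef_along_def)
  have u: "variation t v x1 = form_pairing (frame x0 t v) (power_form \<beta> \<alpha>)" for v
  proof -
    have nz: "real (?m choose pos i) \<noteq> 0" for i :: 'n using pos_less[of i] by auto
    have "variation t v x1 = R v 0 x1" by (simp add: R_def)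
    also have "\<dots> = (\<Sum>i\<le>?m. R v i x0 * \<alpha> ^ (?m - i) * \<beta> ^ i / fact i)" by (rule ab[OF ch top])
    also have "{..?m} = {..<?n}" using n by auto
    also have "(\<Sum>i<?n. R v i x0 * \<alpha> ^ (?m - i) * \<beta> ^ i / fact i)
       = (\<Sum>i\<in>(UNIV :: 'n set). R v (pos i) x0 * \<alpha> ^ (?m - pos i) * \<beta> ^ pos i / fact (pos i))"
      by (rule sum_idx[symmetric])
    also have "\<dots> = form_pairing (frame x0 t v) (power_form \<beta> \<alpha>)"
      unfolding form_pairing_def Rf power_form_def using nz by (intro sum.cong) (simp_all add: mult_ac)
    finally show ?thesis .
  qed
  have "\<alpha> \<noteq> 0 \<or> \<beta> \<noteq> 0"
  proof (rule ccontr)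
    assume z: "\<not> (\<alpha> \<noteq> 0 \<or> \<beta> \<noteq> 0)"
    have "(power_form \<beta> \<alpha> :: real ^ 'n) = 0"
    proof (rule binary_form_eq_0)
      show "binary_form (power_form \<beta> \<alpha> :: real ^ 'n) z = 0" for z
        using z n unfolding binary_form_power by (simp add: power_0_left)
    qed
    then have 0: "variation t v x1 = 0" for v using u[of v] by (simp add: form_pairing_def)
    have "(\<Sum>k<?n. (if k = 0 then 1 else 0) * (lie ?d ^^ k) (variation t v) x1) = 0" for v
      by (rule sum.neutral) (simp add: 0)
    from variation_independent[OF x1 t this, of 0] n show False by simp
  qed
  then have "max_null_form (power_form \<beta> \<alpha> :: real ^ 'n)"
    unfolding max_null_form_iff by (intro exI[of _ 1] exI[of _ \<beta>] exI[of _ \<alpha>]) auto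
  then show ?thesis using u by blast
qed

lemma trivial_paraconformal_structure:
  fixes \<phi> :: "real ^ 'n \<Rightarrow> real ^ 'n \<Rightarrow> real ^ 'n"
  assumes "\<And>t. t \<in> M \<Longrightarrow> linear (\<phi> t) \<and> bij (\<phi> t)" "\<And>v. smooth_on M (\<lambda>t. \<phi> t v)"
  shows "paraconformal_structure M (\<lambda>_. M) (\<lambda>_ _ _. mat 1) (\<lambda>_. \<phi>)"
proof -
  have "invertible (mat 1 :: real ^ 2 ^ 2)" by (auto simp: invertible_def intro!: exI[of _ "mat 1"])
  then show ?thesis
    using assms M unfolding paraconformal_structure_def rank_two_bundle_def by simp
qed

text \<open>
  One point \<open>x0\<close> of the interval serves for all solutions, so the bundle is trivial. If the interval is
  empty, there are no hypersurfaces and any structure will do.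
\<close>

theorem paraconformal_of_conditions:
  assumes n: "2 \<le> CARD('n)" and C: "satisfies_conditions (condition_poly CARD('n)) F U"
  shows "\<exists>V g \<phi>. paraconformal_structure M V g \<phi> \<and>
     (\<forall>(x, y) \<in> solution_points I M Z. max_null_hypersurface M V \<phi> (Z x) y)"
proof (cases "I = {}")
  case True
  have "paraconformal_structure M (\<lambda>_. M) (\<lambda>_ _ _. mat 1) (\<lambda>_ t v. v)"
    by (rule trivial_paraconformal_structure) (simp_all add: linear_ident M bij_def)
  moreover have "solution_points I M Z = {}" using True by (simp add: solution_points_def)
  ultimately show ?thesis by blast
next
  case False
  then obtain x0 where x0: "x0 \<in> I" by blast
  have "paraconformal_structure M (\<lambda>_. M) (\<lambda>_ _ _. mat 1) (\<lambda>_. frame x0)"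
    by (rule trivial_paraconformal_structure) (use frame_linear[OF x0] frame_bij[OF x0] frame_smooth[OF x0] in auto)
  moreover have "max_null_hypersurface M (\<lambda>_. M) (\<lambda>_. frame x0) (Z x) y" if "(x, y) \<in> solution_points I M Z" for x y
  proof -
    have x: "x \<in> I" using that by (auto simp: solution_points_def)
    show ?thesis
      using frame_max_null[OF n C x0 x] by (simp add: max_null_hypersurface_def max_null_covector_def variation_def)
  qed
  ultimately show ?thesis by blast
qed

end

section \<open>The theorem\<close>

theorem theorem1p2:
  assumes "2 \<le> CARD('n::finite)"
  shows "\<exists>C :: nat \<Rightarrow> dpoly.
    (\<forall>k \<in> {1..CARD('n) - 2}. dpoly_vars (C k) \<subseteq> {0..CARD('n) - 1} \<times> {0..CARD('n) - 1}) \<and>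
    (\<forall>(F :: 'n jet \<Rightarrow> real) U. smooth_on U F \<longrightarrow>
       (\<forall>I M Z V g \<phi>.
          general_solution F U I M Z \<and>
          paraconformal_structure M V g \<phi> \<and>
          (\<forall>(x, y) \<in> solution_points I M Z. max_null_hypersurface M V \<phi> (Z x) y)
          \<longrightarrow> satisfies_conditions C F U) \<and>
       (\<forall>\<psi> F' U'.
          smooth_on U' F' \<and> point_transforms \<psi> F U F' U'
          \<longrightarrow> (satisfies_conditions C F U \<longleftrightarrow> satisfies_conditions C F' U')) \<and>
       (\<forall>I M Z.
          general_solution F U I M Z \<and> satisfies_conditions C F U
          \<longrightarrow> (\<exists>V g \<phi>.
                 paraconformal_structure M V g \<phi> \<and>
                 (\<forall>(x, y) \<in> solution_points I M Z. max_null_hypersurface M V \<phi> (Z x) y))))"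
proof (rule exI[of _ "condition_poly CARD('n)"], intro conjI allI impI ballI; (elim conjE)?)
  fix k assume "k \<in> {1..CARD('n) - 2}"
  then show "dpoly_vars (condition_poly CARD('n) k) \<subseteq> {0..CARD('n) - 1} \<times> {0..CARD('n) - 1}"
    using dpoly_vars_of[of "cond_exp CARD('n) k"] dvars_cond_exp[OF assms] unfolding condition_poly_def by blast
next
  fix F :: "'n jet \<Rightarrow> real" and U I M Z V g \<phi>
  assume F: "smooth_on U F" and gs: "general_solution F U I M Z" and pc: "paraconformal_structure M V g \<phi>"
    and mn: "\<forall>(x, y) \<in> solution_points I M Z. max_null_hypersurface M V \<phi> (Z x) y"
  interpret family_of_solutions F U I M Z using F gs by unfold_locales
  show "satisfies_conditions (condition_poly CARD('n)) F U" by (rule conditions_of_paraconformal[OF assms pc mn])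
next
  fix F F' :: "'n jet \<Rightarrow> real" and U U' \<psi>
  assume F: "smooth_on U F" "smooth_on U' F'" and pt: "point_transforms \<psi> F U F' U'"
  then obtain W W' where "diffeomorphism W W' \<psi>" "jet_base ` U \<subseteq> W"
    unfolding point_transforms_def by blast
  then interpret point_transformation F F' U U' \<psi> W W'
    using assms F pt unfolding point_transforms_def by unfold_locales blast+
  show "satisfies_conditions (condition_poly CARD('n)) F U \<longleftrightarrow> satisfies_conditions (condition_poly CARD('n)) F' U'"
    by (rule conditions_invariant)
next
  fix F :: "'n jet \<Rightarrow> real" and U I M Z
  assume F: "smooth_on U F" and gs: "general_solution F U I M Z" and C: "satisfies_conditions (condition_poly CARD('n)) F U"
  interpret family_of_solutions F U I M Z using F gs by unfold_locales
  show "\<exists>V g \<phi>. paraconformal_structure M V g \<phi> \<and>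
     (\<forall>(x, y) \<in> solution_points I M Z. max_null_hypersurface M V \<phi> (Z x) y)"
    by (rule paraconformal_of_conditions[OF assms C])
qed

end
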